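(* Let $(\Omega,g)$ be a 3-dimensional Riemannian manifold with periodic or homogeneous boundary conditions, let $c>0$, and let $K=K[\boldsymbol{e}^1,\boldsymbol{b}^2]$ be a twice differentiable real-valued functional of $\boldsymbol{e}^1\in\Lambda^1$, $\boldsymbol{b}^2\in\Lambda^2$. Put $$\tilde{\boldsymbol{d}}^2=\star\boldsymbol{e}^1-4\pi\frac{\tilde\delta K}{\delta\boldsymbol{e}^1},\qquad\tilde{\boldsymbol{h}}^1=\star\boldsymbol{b}^2+4\pi\frac{\tilde\delta K}{\delta\boldsymbol{b}^2},$$ assume that $(\boldsymbol{e}^1,\boldsymbol{b}^2)\mapsto(\tilde{\boldsymbol{d}}^2,\boldsymbol{b}^2)$ is a diffeomorphism, and define $\overline H$ by $$\overline H[\tilde{\boldsymbol{d}}^2,\boldsymbol{b}^2]=K-\Big(\boldsymbol{e}^1,\frac{\delta K}{\delta\boldsymbol{e}^1}\Big)+\frac1{8\pi}\Big[(\boldsymbol{e}^1,\boldsymbol{e}^1)+(\boldsymbol{b}^2,\boldsymbol{b}^2)\Big].$$ For functionals $F,G$ of $(\tilde{\boldsymbol{d}}^2,\boldsymbol{b}^2)$ let $$\{F,G\}=4\pi c\left[\left\langle\frac{\tilde\delta F}{\delta\tilde{\boldsymbol{d}}^2},\mathsf{d}\frac{\tilde\delta G}{\delta\boldsymbol{b}^2}\right\rangle-\left\langle\frac{\tilde\delta G}{\delta\tilde{\boldsymbol{d}}^2},\mathsf{d}\frac{\tilde\delta F}{\delta\boldsymbol{b}^2}\right\rangle\right].$$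 Then for every functional $F=F[\tilde{\boldsymbol{d}}^2,\boldsymbol{b}^2]$, $$\{F,\overline H\}=c\left[\left\langle\frac{\tilde\delta F}{\delta\tilde{\boldsymbol{d}}^2},\mathsf{d}\tilde{\boldsymbol{h}}^1\right\rangle-\left\langle\boldsymbol{e}^1,\mathsf{d}\frac{\tilde\delta F}{\delta\boldsymbol{b}^2}\right\rangle\right],$$ and the Hamiltonian evolution, i.e. the requirement $\dot F=\{F,\overline H\}$ for all functionals $F$, yields the source-free macroscopic Maxwell evolution equations $$\partial_t\tilde{\boldsymbol{d}}^2=c\,\mathsf{d}\tilde{\boldsymbol{h}}^1\qquad\text{and}\qquad\partial_t\boldsymbol{b}^2=-c\,\mathsf{d}\boldsymbol{e}^1 .$$
   Context: $\Lambda^k$ denotes straight differential $k$-forms on $\Omega$ and $\tilde\Lambda^k$ twisted $k$-forms (which additionally change sign under orientation-reversing coordinate changes); $\mathsf{d}$ is the exterior derivative. $(\omega,\eta)=\int_\Omega g_x(\omega,\eta)\,\mathrm{vol}^3$ is the $L^2$ inner product on $k$-forms, $\langle\omega^k,\tilde\eta^{3-k}\rangle=\int_\Omega\omega^k\wedge\tilde\eta^{3-k}$ is the Poincaré pairing, and the Hodge star $\star:\Lambda^k\to\tilde\Lambda^{3-k}$ is defined by $(\omega,\eta)=\langle\omega,\star\eta\rangle$. Functional derivatives: for a functional of a straight $k$-form $\omega$, $DK[\omega]\eta=(\eta,\frac{\delta K}{\delta\omega})=\langle\eta,\frac{\tilde\delta K}{\delta\omega}\rangle$, with $\frac{\delta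 K}{\delta\omega}\in\Lambda^k$, $\frac{\tilde\delta K}{\delta\omega}\in\tilde\Lambda^{3-k}$. For a functional of a twisted $k$-form $\tilde\omega$, $\frac{\tilde\delta K}{\delta\tilde\omega}\in\Lambda^{3-k}$ is defined by $DK[\tilde\omega]\tilde\eta=\langle\frac{\tilde\delta K}{\delta\tilde\omega},\tilde\eta\rangle$. For functionals of two arguments these are partial derivatives with the other argument fixed. Boundary conditions are such that all boundary terms from integration by parts vanish. Functional derivatives are assumed to exist and be sufficiently regular; $\dot F$ denotes the time derivative of $F[\tilde{\boldsymbol{d}}^2(t),\boldsymbol{b}^2(t)]$ along the evolution. *)

theory Defs
  imports "HOL-Analysis.Analysis" "HOL-Library.Function_Algebras"
begin

text \<open>Pointwise real vector space structure on functions, so that differential forms can be added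
  and scaled, and \<open>linear\<close> can be used for maps into spaces of forms.\<close>

instantiation "fun" :: (type, real_vector) real_vector
begin

definition scaleR_fun :: "real \<Rightarrow> ('a \<Rightarrow> 'b) \<Rightarrow> 'a \<Rightarrow> 'b"
  where "scaleR_fun a f = (\<lambda>x. a *\<^sub>R f x)"

instance
  by standard (auto simp: scaleR_fun_def fun_eq_iff scaleR_add_left scaleR_add_right)

end


section \<open>Smooth 3-manifolds with (possibly empty) boundary\<close>

text \<open>Charts take values in relatively open subsets of a closed half space; an interior chart is one
  whose image avoids the bounding plane. All derivatives are taken within the half space: at points
  with positive first coordinate this is the usual derivative, at the bounding plane it is the
  one-sided one and still unique.\<close>

definition half_space :: "(real^3) set"
  where "half_space = {x. 0 \<le> x $ 1}"

abbreviation hderiv :: "(real^3 \<Rightarrow> 'b::real_normed_vector) \<Rightarrow> real^3 \<Rightarrow> real^3 \<Rightarrow> 'b"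
  where "hderiv f x \<equiv> frechet_derivative f (at x within half_space)"

fun C_k_on :: "nat \<Rightarrow> (real^3) set \<Rightarrow> (real^3 \<Rightarrow> 'b::real_normed_vector) \<Rightarrow> bool" where
  "C_k_on 0 S f \<longleftrightarrow> continuous_on S f"
| "C_k_on (Suc n) S f \<longleftrightarrow>
     (\<forall>x\<in>S. f differentiable (at x within half_space)) \<and> (\<forall>v. C_k_on n S (\<lambda>x. hderiv f x v))"

text \<open>Only used for relatively open subsets of the half space.\<close>

definition smooth_on :: "(real^3) set \<Rightarrow> (real^3 \<Rightarrow> 'b::real_normed_vector) \<Rightarrow> bool"
  where "smooth_on S f \<longleftrightarrow> (\<forall>n. C_k_on n S f)"

type_synonym 'm chart = "'m set \<times> ('m \<Rightarrow> real^3)"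

abbreviation chart_image :: "'m chart \<Rightarrow> (real^3) set"
  where "chart_image c \<equiv> snd c ` fst c"

definition transition :: "'m chart \<Rightarrow> 'm chart \<Rightarrow> real^3 \<Rightarrow> real^3"
  where "transition c c' = snd c' \<circ> the_inv_into (fst c) (snd c)"

definition overlap :: "'m chart \<Rightarrow> 'm chart \<Rightarrow> (real^3) set"
  where "overlap c c' = snd c ` (fst c \<inter> fst c')"

definition smooth_atlas :: "'m::{t2_space, second_countable_topology} chart set \<Rightarrow> bool" where
  "smooth_atlas A \<longleftrightarrow>
     (\<Union>c\<in>A. fst c) = UNIV \<and>
     (\<forall>c\<in>A. open (fst c) \<and> openin (top_of_set half_space) (chart_image c) \<and>
        (\<exists>\<psi>. homeomorphism (fst c) (chart_image c) (snd c) \<psi>)) \<and>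
     (\<forall>c\<in>A. \<forall>c'\<in>A. smooth_on (overlap c c') (transition c c'))"

definition manifold_interior :: "'m chart set \<Rightarrow> 'm set"
  where "manifold_interior A = {p. \<exists>c\<in>A. p \<in> fst c \<and> 0 < snd c p $ 1}"

definition chart_at :: "'m chart set \<Rightarrow> 'm \<Rightarrow> 'm chart"
  where "chart_at A p = (SOME c. c \<in> A \<and> p \<in> fst c)"

text \<open>A metric is given by its coefficient matrix in every chart.\<close>

type_synonym 'm metric = "'m chart \<Rightarrow> real^3 \<Rightarrow> real^3^3"

definition riemannian_metric :: "'m chart set \<Rightarrow> 'm metric \<Rightarrow> bool" where
  "riemannian_metric A g \<longleftrightarrow>
     (\<forall>c\<in>A. \<forall>x\<in>chart_image c.
        transpose (g c x) = g c x \<and> (\<forall>v. v \<noteq> 0 \<longrightarrow> 0 < v \<bullet> (g c x *v v))) \<and>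
     (\<forall>c\<in>A. smooth_on (chart_image c) (g c)) \<and>
     (\<forall>c\<in>A. \<forall>c'\<in>A. \<forall>x\<in>overlap c c'. \<forall>v w.
        v \<bullet> (g c x *v w) =
          hderiv (transition c c') x v \<bullet>
            (g c' (transition c c' x) *v hderiv (transition c c') x w))"

locale riemannian_3_manifold =
  fixes A :: "'m::{t2_space, second_countable_topology} chart set"
    and g :: "'m metric"
  assumes smooth_atlas: "smooth_atlas A"
    and riemannian_metric: "riemannian_metric A g"


section \<open>Straight and twisted differential forms\<close>

text \<open>A \<open>k\<close>-form is the family of its coordinate representations: \<open>\<omega> c x vs\<close> is the value, in
  chart \<open>c\<close> at the coordinate point \<open>x\<close>, on the list \<open>vs\<close> of \<open>k\<close> coordinate vectors. It is \<open>0\<close>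
  outside its domain of definition, so that equality of forms is equality of functions. Twisted
  forms pick up the sign of the Jacobian determinant under changes of coordinates.\<close>

type_synonym 'm form = "'m chart \<Rightarrow> real^3 \<Rightarrow> (real^3) list \<Rightarrow> real"

definition alternating_multilinear :: "nat \<Rightarrow> ((real^3) list \<Rightarrow> real) \<Rightarrow> bool" where
  "alternating_multilinear k \<alpha> \<longleftrightarrow>
     (\<forall>vs i. length vs = k \<longrightarrow> i < k \<longrightarrow> linear (\<lambda>v. \<alpha> (vs[i := v]))) \<and>
     (\<forall>vs i j. length vs = k \<longrightarrow> i < j \<longrightarrow> j < k \<longrightarrow> vs ! i = vs ! j \<longrightarrow> \<alpha> vs = 0)"

definition twist_sign :: "bool \<Rightarrow> (real^3 \<Rightarrow> real^3) \<Rightarrow> real"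
  where "twist_sign tw J = (if tw then sgn (det (matrix J)) else 1)"

definition smooth_form :: "'m chart set \<Rightarrow> bool \<Rightarrow> nat \<Rightarrow> 'm form \<Rightarrow> bool" where
  "smooth_form A tw k \<omega> \<longleftrightarrow>
     (\<forall>c x vs. c \<notin> A \<or> x \<notin> chart_image c \<or> length vs \<noteq> k \<longrightarrow> \<omega> c x vs = 0) \<and>
     (\<forall>c\<in>A. \<forall>x\<in>chart_image c. alternating_multilinear k (\<omega> c x)) \<and>
     (\<forall>c\<in>A. \<forall>vs. length vs = k \<longrightarrow> smooth_on (chart_image c) (\<lambda>x. \<omega> c x vs)) \<and>
     (\<forall>c\<in>A. \<forall>c'\<in>A. \<forall>x\<in>overlap c c'. \<forall>vs. length vs = k \<longrightarrow>
        \<omega> c x vs =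
          twist_sign tw (hderiv (transition c c') x) *
            \<omega> c' (transition c c' x) (map (hderiv (transition c c') x) vs))"

abbreviation straight_form :: "'m chart set \<Rightarrow> nat \<Rightarrow> 'm form \<Rightarrow> bool"
  where "straight_form A \<equiv> smooth_form A False"

abbreviation twisted_form :: "'m chart set \<Rightarrow> nat \<Rightarrow> 'm form \<Rightarrow> bool"
  where "twisted_form A \<equiv> smooth_form A True"

definition compact_interior_support ::
    "'m::topological_space chart set \<Rightarrow> 'm form \<Rightarrow> bool" where
  "compact_interior_support A \<omega> \<longleftrightarrow>
     (\<exists>C. compact C \<and> C \<subseteq> manifold_interior A \<and>
        (\<forall>c\<in>A. \<forall>p\<in>fst c - C. \<forall>vs. \<omega> c (snd c p) vs = 0))"

definition wedge :: "nat \<Rightarrow> nat \<Rightarrow> 'm form \<Rightarrow> 'm form \<Rightarrow> 'm form" where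
  "wedge k l \<omega> \<eta> = (\<lambda>c x vs.
     if length vs = k + l then
       (\<Sum>\<sigma> | \<sigma> permutes {..<k + l}. of_int (sign \<sigma>) *
          \<omega> c x (map (\<lambda>i. vs ! \<sigma> i) [0..<k]) * \<eta> c x (map (\<lambda>i. vs ! \<sigma> i) [k..<k + l]))
       / (fact k * fact l)
     else 0)"

text \<open>\<open>(d\<omega>)(v\<^sub>0, \<dots>, v\<^sub>k)\<close> is the alternating sum of the derivatives of
  \<open>\<omega>(v\<^sub>0, \<dots>, v\<^sub>k without v\<^sub>i)\<close> in the direction \<open>v\<^sub>i\<close>.\<close>

definition ext_d :: "'m chart set \<Rightarrow> nat \<Rightarrow> 'm form \<Rightarrow> 'm form" where
  "ext_d A k \<omega> = (\<lambda>c x vs.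
     if c \<in> A \<and> x \<in> chart_image c \<and> length vs = Suc k then
       (\<Sum>i\<le>k. (-1) ^ i * hderiv (\<lambda>y. \<omega> c y (take i vs @ drop (Suc i) vs)) x (vs ! i))
     else 0)"


section \<open>Integration, inner product, Poincare pairing, Hodge star\<close>

definition riemannian_volume ::
    "'m::{t2_space, second_countable_topology} chart set \<Rightarrow> 'm metric \<Rightarrow> 'm measure" where
  "riemannian_volume A g = (THE \<mu>. sets \<mu> = sets borel \<and>
     (\<forall>c\<in>A. \<forall>S\<in>sets borel. S \<subseteq> fst c \<longrightarrow>
        emeasure \<mu> S = (\<integral>\<^sup>+x\<in>snd c ` S. ennreal (sqrt (det (g c x))) \<partial>lborel)))"

text \<open>A twisted 3-form \<open>\<theta>\<close> is a multiple \<open>f vol\<^sup>3\<close> of the Riemannian volume form, whose coefficient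
  in every chart is \<open>sqrt (det g)\<close>; \<open>f\<close> does not depend on the chart.\<close>

definition volume_density :: "'m chart set \<Rightarrow> 'm metric \<Rightarrow> 'm form \<Rightarrow> 'm \<Rightarrow> real" where
  "volume_density A g \<theta> p =
     (let c = chart_at A p; x = snd c p
      in \<theta> c x [axis 1 1, axis 2 1, axis 3 1] / sqrt (det (g c x)))"

definition form_integrable ::
    "'m::{t2_space, second_countable_topology} chart set \<Rightarrow> 'm metric \<Rightarrow> 'm form \<Rightarrow> bool"
  where "form_integrable A g \<theta> \<longleftrightarrow> integrable (riemannian_volume A g) (volume_density A g \<theta>)"

definition form_integral ::
    "'m::{t2_space, second_countable_topology} chart set \<Rightarrow> 'm metric \<Rightarrow> 'm form \<Rightarrow> real"
  where "form_integral A g \<theta> = (\<integral>p. volume_density A g \<theta> p \<partial>riemannian_volume A g)"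

text \<open>Full contraction of all indices with the inverse metric, divided by \<open>k!\<close>; so
  \<open>dx \<and> dy\<close> has norm 1 in the Euclidean metric.\<close>

definition covector_inner ::
    "nat \<Rightarrow> real^3^3 \<Rightarrow> ((real^3) list \<Rightarrow> real) \<Rightarrow> ((real^3) list \<Rightarrow> real) \<Rightarrow> real" where
  "covector_inner k G \<alpha> \<beta> =
     (\<Sum>is | length is = k. \<Sum>js | length js = k.
        (\<Prod>r<k. matrix_inv G $ (is ! r) $ (js ! r)) *
        \<alpha> (map (\<lambda>i. axis i 1) is) * \<beta> (map (\<lambda>j. axis j 1) js)) / fact k"

definition form_inner ::
    "'m chart set \<Rightarrow> 'm metric \<Rightarrow> nat \<Rightarrow> 'm form \<Rightarrow> 'm form \<Rightarrow> 'm \<Rightarrow> real" where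
  "form_inner A g k \<omega> \<eta> p =
     (let c = chart_at A p; x = snd c p in covector_inner k (g c x) (\<omega> c x) (\<eta> c x))"

definition l2_inner ::
    "'m::{t2_space, second_countable_topology} chart set \<Rightarrow> 'm metric \<Rightarrow> nat \<Rightarrow>
     'm form \<Rightarrow> 'm form \<Rightarrow> real"
  where "l2_inner A g k \<omega> \<eta> = (\<integral>p. form_inner A g k \<omega> \<eta> p \<partial>riemannian_volume A g)"

definition poincare_pairing ::
    "'m::{t2_space, second_countable_topology} chart set \<Rightarrow> 'm metric \<Rightarrow> nat \<Rightarrow>
     'm form \<Rightarrow> 'm form \<Rightarrow> real"
  where "poincare_pairing A g k \<omega> \<eta> = form_integral A g (wedge k (3 - k) \<omega> \<eta>)"

definition hodge_star ::
    "'m::{t2_space, second_countable_topology} chart set \<Rightarrow> 'm metric \<Rightarrow> nat \<Rightarrow>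
     'm form \<Rightarrow> 'm form" where
  "hodge_star A g k \<eta> = (THE \<theta>. twisted_form A (3 - k) \<theta> \<and>
     (\<forall>\<omega>. straight_form A k \<omega> \<and> compact_interior_support A \<omega> \<longrightarrow>
        l2_inner A g k \<omega> \<eta> = poincare_pairing A g k \<omega> \<theta>))"


section \<open>Spaces of fields\<close>

text \<open>A space of \<open>k\<close>-forms subject to boundary conditions is presented as a normed space together
  with an injective linear map that sends a field to the underlying smooth form. The norm is the
  one with respect to which functionals are differentiated; it need not be complete.
  Boundary conditions do not restrict forms supported away from the boundary.\<close>

definition form_space ::
    "'m::{t2_space, second_countable_topology} chart set \<Rightarrow> bool \<Rightarrow> nat \<Rightarrow>
     ('v::real_normed_vector \<Rightarrow> 'm form) \<Rightarrow> bool" where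
  "form_space A tw k X \<longleftrightarrow>
     linear X \<and> inj X \<and> (\<forall>u. smooth_form A tw k (X u)) \<and>
     (\<forall>\<omega>. smooth_form A tw k \<omega> \<and> compact_interior_support A \<omega> \<longrightarrow> \<omega> \<in> range X)"

text \<open>\<open>E1\<close> and \<open>B2\<close> present the straight 1- and 2-forms, \<open>H1\<close> and \<open>D2\<close> the twisted 1- and 2-forms.
  The assumption on boundary terms is that the exact form \<open>d(e \<and> h)\<close> integrates to zero, i.e., by
  Stokes, that the boundary integral of \<open>e \<and> h\<close> vanishes. On a closed manifold (periodic case) all
  smooth forms may be taken.\<close>

locale em_field_spaces = riemannian_3_manifold A g
  for A :: "'m::{t2_space, second_countable_topology} chart set" and g :: "'m metric" +
  fixes E1 :: "'e::real_normed_vector \<Rightarrow> 'm form"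
    and B2 :: "'b::real_normed_vector \<Rightarrow> 'm form"
    and D2 :: "'d::real_normed_vector \<Rightarrow> 'm form"
    and H1 :: "'h::real_normed_vector \<Rightarrow> 'm form"
  assumes E1: "form_space A False 1 E1"
    and B2: "form_space A False 2 B2"
    and D2: "form_space A True 2 D2"
    and H1: "form_space A True 1 H1"
    and star_E1: "hodge_star A g 1 (E1 e) \<in> range D2"
    and star_B2: "hodge_star A g 2 (B2 b) \<in> range H1"
    and integrable_ED: "form_integrable A g (wedge 1 2 (E1 e) (D2 d))"
    and integrable_BH: "form_integrable A g (wedge 2 1 (B2 b) (H1 h))"
    and integrable_dEH: "form_integrable A g (wedge 2 1 (ext_d A 1 (E1 e)) (H1 h))"
    and integrable_EdH: "form_integrable A g (wedge 1 2 (E1 e) (ext_d A 1 (H1 h)))"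
    and bounded_inner_E: "bounded_bilinear (\<lambda>e e'. l2_inner A g 1 (E1 e) (E1 e'))"
    and bounded_inner_B: "bounded_bilinear (\<lambda>b b'. l2_inner A g 2 (B2 b) (B2 b'))"
    and bounded_pairing_ED: "bounded_bilinear (\<lambda>e d. poincare_pairing A g 1 (E1 e) (D2 d))"
    and bounded_pairing_BH: "bounded_bilinear (\<lambda>b h. poincare_pairing A g 2 (B2 b) (H1 h))"
    and boundary_terms_vanish: "form_integral A g (ext_d A 2 (wedge 1 1 (E1 e) (H1 h))) = 0"


section \<open>Functional derivatives and the bracket\<close>

text \<open>Partial functional derivatives of a functional of two fields: the vector representing the
  partial derivative through a pairing \<open>P\<close> (perturbation first, representing vector second).\<close>

definition represents_fst ::
    "('x \<Rightarrow> 'v \<Rightarrow> real) \<Rightarrow> ('x::real_normed_vector \<times> 'y \<Rightarrow> real) \<Rightarrow> 'x \<times> 'y \<Rightarrow> 'v \<Rightarrow> bool" where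
  "represents_fst P F z v \<longleftrightarrow>
     (\<forall>\<eta>. frechet_derivative (\<lambda>x. F (x, snd z)) (at (fst z)) \<eta> = P \<eta> v)"

definition represents_snd ::
    "('y \<Rightarrow> 'v \<Rightarrow> real) \<Rightarrow> ('x \<times> 'y::real_normed_vector \<Rightarrow> real) \<Rightarrow> 'x \<times> 'y \<Rightarrow> 'v \<Rightarrow> bool" where
  "represents_snd P F z v \<longleftrightarrow>
     (\<forall>\<eta>. frechet_derivative (\<lambda>y. F (fst z, y)) (at (snd z)) \<eta> = P \<eta> v)"

definition twice_differentiable ::
    "('x::real_normed_vector \<Rightarrow> 'y::real_normed_vector) \<Rightarrow> bool" where
  "twice_differentiable F \<longleftrightarrow>
     (\<exists>F'. (\<forall>z. (F has_derivative blinfun_apply (F' z)) (at z)) \<and> (\<forall>z. F' differentiable (at z)))"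

definition diffeomorphism ::
    "('x::real_normed_vector \<Rightarrow> 'y::real_normed_vector) \<Rightarrow> bool" where
  "diffeomorphism f \<longleftrightarrow>
     bij f \<and> (\<forall>x. f differentiable (at x)) \<and> (\<forall>y. inv f differentiable (at y))"

context em_field_spaces
begin

abbreviation inner_E :: "'e \<Rightarrow> 'e \<Rightarrow> real"
  where "inner_E e e' \<equiv> l2_inner A g 1 (E1 e) (E1 e')"

abbreviation inner_B :: "'b \<Rightarrow> 'b \<Rightarrow> real"
  where "inner_B b b' \<equiv> l2_inner A g 2 (B2 b) (B2 b')"

abbreviation pairing_ED :: "'e \<Rightarrow> 'd \<Rightarrow> real"
  where "pairing_ED e d \<equiv> poincare_pairing A g 1 (E1 e) (D2 d)"

abbreviation pairing_BH :: "'b \<Rightarrow> 'h \<Rightarrow> real"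
  where "pairing_BH b h \<equiv> poincare_pairing A g 2 (B2 b) (H1 h)"

text \<open>For functionals \<open>K[e, b]\<close>: the straight derivative with respect to \<open>e\<close> and the twisted ones
  with respect to \<open>e\<close> and \<open>b\<close>.\<close>

definition delta_e :: "('e \<times> 'b \<Rightarrow> real) \<Rightarrow> 'e \<times> 'b \<Rightarrow> 'e"
  where "delta_e K z = (THE v. represents_fst inner_E K z v)"

definition tdelta_e :: "('e \<times> 'b \<Rightarrow> real) \<Rightarrow> 'e \<times> 'b \<Rightarrow> 'd"
  where "tdelta_e K z = (THE v. represents_fst pairing_ED K z v)"

definition tdelta_d :: "('d \<times> 'b \<Rightarrow> real) \<Rightarrow> 'd \<times> 'b \<Rightarrow> 'e"
  where "tdelta_d F z = (THE v. represents_fst (\<lambda>\<eta> v. pairing_ED v \<eta>) F z v)"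

text \<open>The first argument, held fixed, may be \<open>e\<close> or \<open>d\<close>.\<close>

definition tdelta_b :: "('x \<times> 'b \<Rightarrow> real) \<Rightarrow> 'x \<times> 'b \<Rightarrow> 'h"
  where "tdelta_b F z = (THE v. represents_snd pairing_BH F z v)"

definition regular_K :: "('e \<times> 'b \<Rightarrow> real) \<Rightarrow> bool" where
  "regular_K K \<longleftrightarrow> twice_differentiable K \<and>
     (\<forall>z. (\<exists>v. represents_fst inner_E K z v) \<and> (\<exists>v. represents_fst pairing_ED K z v) \<and>
          (\<exists>v. represents_snd pairing_BH K z v))"

definition regular_functional :: "('d \<times> 'b \<Rightarrow> real) \<Rightarrow> bool" where
  "regular_functional F \<longleftrightarrow>
     (\<forall>z. F differentiable (at z) \<and> (\<exists>v. represents_fst (\<lambda>\<eta> v. pairing_ED v \<eta>) F z v) \<and>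
          (\<exists>v. represents_snd pairing_BH F z v))"

definition bracket ::
    "real \<Rightarrow> ('d \<times> 'b \<Rightarrow> real) \<Rightarrow> ('d \<times> 'b \<Rightarrow> real) \<Rightarrow> 'd \<times> 'b \<Rightarrow> real" where
  "bracket c F G z = 4 * pi * c *
     (poincare_pairing A g 1 (E1 (tdelta_d F z)) (ext_d A 1 (H1 (tdelta_b G z)))
      - poincare_pairing A g 1 (E1 (tdelta_d G z)) (ext_d A 1 (H1 (tdelta_b F z))))"

end

end

theory Submission
  imports Defs
begin

text \<open>In a chart a 1-form is a covector field \<open>a\<close> and a 2-form a vector field \<open>b\<close>, via
  \<open>b \<bullet> (v \<times> w)\<close>; the pairing has density \<open>a \<bullet> b\<close>, and the Hodge star is the relation
  \<open>g b = sqrt (det g) a\<close>. Testing a form against its own star times a bump function shows that it is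
  determined by its pairings, so the Hodge star and all functional derivatives are well defined.
  Since \<open>Hbar\<close> is a Legendre transform, \<open>4\<pi> dHbar = \<langle>e, \<delta>d\<rangle> + \<langle>\<delta>b, h\<rangle>\<close>, i.e. its functional derivatives are
  \<open>e / 4\<pi>\<close> and \<open>h / 4\<pi>\<close>; this is the formula for the bracket. Evaluating it on functionals
  linear in \<open>d\<close> and \<open>b\<close> and integrating by parts gives Maxwell's equations.\<close>

section \<open>Calculus on the half space\<close>

text \<open>\<open>riemannian_volume\<close>, \<open>hodge_star\<close> and the functional
  derivatives are definite descriptions: existence and uniqueness come before any use, and most of
  the work goes there. Two obstacles shape it. First, charts end at a bounding plane while test
  forms are supported in the interior. So derivatives are taken within the half space, symmetry of
  second derivatives has to reach the plane, and vanishing on the interior is extended to the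
  boundary by continuity. Second, the Bochner integral of a non-integrable function is 0, so a
  pairing of arbitrary smooth forms may be a meaningless 0. Integrals are split only after
  multiplication with a bump function or where integrability is assumed. On the functional side,
  \<open>Hbar\<close> is given only through \<open>d\<close> and contains \<open>delta_e K\<close>,
  whose differentiability as a field is not assumed. Rewriting it as K + <e,d>/4pi - (e,e)/8pi +
  (b,b)/8pi removes \<open>delta_e K\<close>, and the inverse of the diffeomorphism carries the
  derivative over to the variables \<open>(d, b)\<close>.\<close>

abbreviation relopen :: "(real^3) set \<Rightarrow> bool"
  where "relopen S \<equiv> openin (top_of_set half_space) S"

lemma relopen_subset: "relopen S \<Longrightarrow> S \<subseteq> half_space"
  by (metis openin_imp_subset)

text \<open>A relatively open set agrees with the half space near each of its points, so derivatives
  may be computed within either of them.\<close>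

lemma at_within_relopen: "relopen S \<Longrightarrow> x \<in> S \<Longrightarrow> at x within S = at x within half_space"
proof -
  assume S: "relopen S" "x \<in> S"
  then obtain T where T: "open T" "S = half_space \<inter> T"
    by (auto simp: openin_open)
  show ?thesis
    by (rule at_within_nhd[where S = T]) (use S T in auto)
qed

lemma hderiv_unique:
  fixes f :: "real^3 \<Rightarrow> 'b::real_normed_vector"
  assumes "x \<in> half_space" and f: "(f has_derivative f') (at x within half_space)"
  shows "hderiv f x = f'"
proof -
  have "\<exists>d. 0 < \<bar>d\<bar> \<and> \<bar>d\<bar> < e \<and> (x + d *\<^sub>R i) \<in> half_space" if "i \<in> Basis" "e > 0" for i and e :: real
  proof -
    \<comment> \<open>Standard basis vectors never point out of the half space, so the positive step
      e/2 stays inside even on the bounding plane; this is what uniqueness of the derivative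
      requires.\<close>
    have "0 \<le> i $ 1"
      using that(1) by (auto simp: Basis_vec_def axis_def)
    then show ?thesis
      using assms(1) that(2) by (intro exI[of _ "e/2"]) (auto simp: half_space_def)
  qed
  moreover have "(f has_derivative hderiv f x) (at x within half_space)"
    using f frechet_derivative_works unfolding differentiable_def by blast
  ultimately show ?thesis
    using f frechet_derivative_unique_within by blast
qed

lemma differentiable_hderiv:
  "f differentiable (at x within half_space) \<Longrightarrow> (f has_derivative hderiv f x) (at x within half_space)"
  using frechet_derivative_works by blast

lemma has_derivative_cong_relopen:
  assumes "relopen S" "x \<in> S" "\<And>y. y \<in> S \<Longrightarrow> f y = g y"
  shows "(f has_derivative f') (at x within half_space) \<longleftrightarrow> (g has_derivative f') (at x within half_space)"
  unfolding at_within_relopen[OF assms(1,2), symmetric]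
  using has_derivative_transform[OF assms(2), of f g f'] has_derivative_transform[OF assms(2), of g f f'] assms(3)
  by metis

lemma hderiv_cong:
  assumes "relopen S" "x \<in> S" "\<And>y. y \<in> S \<Longrightarrow> f y = g y"
  shows "hderiv f x = hderiv g x"
  unfolding frechet_derivative_def using has_derivative_cong_relopen[OF assms] by simp

lemma differentiable_cong_relopen:
  assumes "relopen S" "x \<in> S" "\<And>y. y \<in> S \<Longrightarrow> f y = g y"
  shows "f differentiable (at x within half_space) \<longleftrightarrow> g differentiable (at x within half_space)"
  unfolding differentiable_def using has_derivative_cong_relopen[OF assms] by simp

section \<open>Functions of class C^k on relatively open sets\<close>

lemma C_k_on_cong:
  assumes "relopen S" "\<And>y. y \<in> S \<Longrightarrow> f y = g y"
  shows "C_k_on n S f \<longleftrightarrow> C_k_on n S g"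
  using assms(2)
proof (induction n arbitrary: f g)
  case 0 then show ?case by simp
next
  case (Suc n)
  have "C_k_on n S (\<lambda>x. hderiv f x v) \<longleftrightarrow> C_k_on n S (\<lambda>x. hderiv g x v)" for v
    by (rule Suc.IH) (metis hderiv_cong Suc.prems assms(1))
  then show ?case
    using differentiable_cong_relopen[OF assms(1) _ Suc.prems] by auto
qed

lemma C_k_on_SucD: "C_k_on (Suc n) S f \<Longrightarrow> S \<subseteq> half_space \<Longrightarrow> C_k_on n S f"
proof (induction n arbitrary: f)
  case 0
  then show ?case
    by (auto intro!: continuous_on_subset[of half_space] simp: continuous_on_eq_continuous_within)
      (meson "0.prems"(2) continuous_within_subset differentiable_imp_continuous_within)
qed (auto)

text \<open>Used to glue a function from two formulas on overlapping pieces, such as a bump function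
  and its extension by zero.\<close>

lemma C_k_on_Un:
  assumes "relopen S" "relopen S'"
  shows "C_k_on n S f \<Longrightarrow> C_k_on n S' f \<Longrightarrow> C_k_on n (S \<union> S') f"
proof (induction n arbitrary: f)
  case 0
  have "openin (top_of_set (S \<union> S')) S" "openin (top_of_set (S \<union> S')) S'"
    using assms by (meson openin_subset_trans relopen_subset Un_upper1 Un_upper2 le_sup_iff)+
  with 0 show ?case
    by (simp add: continuous_on_Un_local_open)
qed auto

text \<open>Induction step of the closure properties below: a derivative formula known on
  \<open>S\<close> alone may replace \<open>hderiv\<close>, because derivatives within the half
  space are unique.\<close>

lemma C_k_on_Suc_intro:
  assumes S: "relopen S"
    and f: "\<And>x. x \<in> S \<Longrightarrow> (f has_derivative f' x) (at x within half_space)"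
    and f': "\<And>v. C_k_on n S (\<lambda>x. f' x v)"
  shows "C_k_on (Suc n) S f"
proof -
  have "hderiv f x = f' x" if "x \<in> S" for x
    using that f hderiv_unique relopen_subset[OF S] by blast
  then have "C_k_on n S (\<lambda>x. hderiv f x v)" for v
    using C_k_on_cong[OF S, of "\<lambda>x. hderiv f x v" "\<lambda>x. f' x v"] f' by simp
  then show ?thesis
    using f unfolding C_k_on.simps differentiable_def by blast
qed

lemma C_k_on_SucE:
  assumes "C_k_on (Suc n) S f" "x \<in> S"
  shows "(f has_derivative hderiv f x) (at x within half_space)"
  using assms differentiable_hderiv by auto

lemma C_k_on_const:
  assumes S: "relopen S" shows "C_k_on n S (\<lambda>x. c)"
proof (induction n arbitrary: c)
  case (Suc n)
  show ?case
    by (rule C_k_on_Suc_intro[OF S has_derivative_const Suc.IH])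
qed simp

lemma C_k_on_bounded_linear:
  assumes S: "relopen S" and L: "bounded_linear L"
  shows "C_k_on n S f \<Longrightarrow> C_k_on n S (\<lambda>x. L (f x))"
proof (induction n arbitrary: f)
  case 0
  then show ?case using L linear_continuous_on_compose bounded_linear.continuous_on by fastforce
next
  case (Suc n)
  show ?case
    by (rule C_k_on_Suc_intro[OF S bounded_linear.has_derivative[OF L C_k_on_SucE[OF Suc.prems]]])
      (use Suc in auto)
qed

lemma C_k_on_add:
  assumes S: "relopen S"
  shows "C_k_on n S f \<Longrightarrow> C_k_on n S f' \<Longrightarrow> C_k_on n S (\<lambda>x. f x + f' x)"
proof (induction n arbitrary: f f')
  case 0
  then show ?case by (simp add: continuous_on_add)
next
  case (Suc n)
  show ?case
    by (rule C_k_on_Suc_intro[OF S has_derivative_add[OF C_k_on_SucE[OF Suc.prems(1)] C_k_on_SucE[OF Suc.prems(2)]]])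
      (use Suc in auto)
qed

lemma C_k_on_mult:
  fixes f f' :: "real^3 \<Rightarrow> real"
  assumes S: "relopen S"
  shows "C_k_on n S f \<Longrightarrow> C_k_on n S f' \<Longrightarrow> C_k_on n S (\<lambda>x. f x * f' x)"
proof (induction n arbitrary: f f')
  case 0
  then show ?case by (simp add: continuous_on_mult)
next
  case (Suc n)
  \<comment> \<open>The product rule contains the undifferentiated factors, which therefore have to
    be of order n as well.\<close>
  note mono = C_k_on_SucD[OF Suc.prems(1) relopen_subset[OF S]] C_k_on_SucD[OF Suc.prems(2) relopen_subset[OF S]]
  show ?case
    by (rule C_k_on_Suc_intro[OF S has_derivative_mult[OF C_k_on_SucE[OF Suc.prems(1)] C_k_on_SucE[OF Suc.prems(2)]]])
      (use Suc mono in \<open>auto intro!: C_k_on_add[OF S]\<close>)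
qed

text \<open>Reduces an arbitrary direction to the coordinate directions, so that the chain rule
  becomes a sum of products of scalar functions.\<close>

lemma hderiv_basis:
  fixes f :: "real^3 \<Rightarrow> 'b::real_normed_vector"
  assumes "f differentiable (at x within half_space)"
  shows "hderiv f x v = (\<Sum>i\<in>UNIV. v $ i *\<^sub>R hderiv f x (axis i 1))"
proof -
  have L: "linear (hderiv f x)"
    using assms linear_frechet_derivative by blast
  have "hderiv f x v = hderiv f x (\<Sum>i\<in>UNIV. v $ i *\<^sub>R axis i 1)"
    by (simp add: basis_expansion scalar_mult_eq_scaleR[symmetric])
  also have "\<dots> = (\<Sum>i\<in>UNIV. v $ i *\<^sub>R hderiv f x (axis i 1))"
    by (simp add: linear_sum[OF L] linear_scale[OF L])
  finally show ?thesis .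
qed

text \<open>\<open>T\<close> is controlled on \<open>S\<close> only, so its derivative is restricted
  to \<open>S\<close> and the result is transferred back; the two filters agree at points of
  \<open>S\<close>.\<close>

lemma has_derivative_compose_relopen:
  assumes "relopen S" "x \<in> S" "T ` S \<subseteq> half_space"
    and "(T has_derivative T') (at x within half_space)"
    and "(f has_derivative f') (at (T x) within half_space)"
  shows "((\<lambda>y. f (T y)) has_derivative (\<lambda>v. f' (T' v))) (at x within half_space)"
proof -
  have "(T has_derivative T') (at x within S)"
    using assms(1,2,4) at_within_relopen by simp
  moreover have "(f has_derivative f') (at (T x) within T ` S)"
    using assms(3,5) has_derivative_subset by blast
  ultimately have "((\<lambda>y. f (T y)) has_derivative (\<lambda>v. f' (T' v))) (at x within S)"
    by (rule has_derivative_in_compose)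
  then show ?thesis
    using at_within_relopen[OF assms(1,2)] by simp
qed

lemma C_k_on_compose:
  fixes f :: "real^3 \<Rightarrow> real"
  assumes S: "relopen S" and S': "relopen S'"
    and T: "\<And>n. C_k_on n S T" "T ` S \<subseteq> S'"
  shows "C_k_on n S' f \<Longrightarrow> C_k_on n S (\<lambda>x. f (T x))"
proof (induction n arbitrary: f)
  case 0
  then show ?case using T(1)[of 0] T(2) by (auto intro: continuous_on_compose2)
next
  case (Suc n)
  have T1: "C_k_on (Suc n) S T" by (rule T(1))
  \<comment> \<open>The direction enters only through the derivative of \<open>T\<close>. The other
    factors are partial derivatives of \<open>f\<close> composed with \<open>T\<close>, which the
    induction hypothesis covers.\<close>
  have *: "((\<lambda>y. f (T y)) has_derivative (\<lambda>v. \<Sum>i\<in>UNIV. hderiv T x v $ i * hderiv f (T x) (axis i 1)))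
      (at x within half_space)" if "x \<in> S" for x
  proof -
    have Tx: "T x \<in> S'" using T(2) that by auto
    have "((\<lambda>y. f (T y)) has_derivative (\<lambda>v. hderiv f (T x) (hderiv T x v))) (at x within half_space)"
      using has_derivative_compose_relopen[OF S that _ C_k_on_SucE[OF T1 that] C_k_on_SucE[OF Suc.prems Tx]]
        T(2) relopen_subset[OF S'] by blast
    moreover have "f differentiable (at (T x) within half_space)"
      using Suc.prems Tx by auto
    ultimately show ?thesis
      by (simp only: hderiv_basis[of f "T x" "hderiv T x _"] real_scaleR_def)
  qed
  have 1: "C_k_on n S (\<lambda>x. hderiv f (T x) (axis i 1))" for i
    using Suc by auto
  have 2: "C_k_on n S (\<lambda>x. hderiv T x v $ i)" for v i
    using T1 by (intro C_k_on_bounded_linear[OF S bounded_linear_vec_nth]) auto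
  show ?case
    by (rule C_k_on_Suc_intro[OF S *])
      (auto simp: sum_3 intro!: C_k_on_add[OF S] C_k_on_mult[OF S] 1 2)
qed

text \<open>Generalising over a family closed under differentiation makes the induction work without
  a formula for higher derivatives of a composition. It serves both powers and flat
  exponentials.\<close>

lemma C_k_on_real_family:
  fixes q :: "real^3 \<Rightarrow> real"
  assumes S: "relopen S" and q: "\<And>n. C_k_on n S q" "q ` S \<subseteq> I"
    and fam: "\<And>\<phi>. \<phi> \<in> \<F> \<Longrightarrow> \<exists>\<phi>'\<in>\<F>. \<forall>t\<in>I. (\<phi> has_real_derivative \<phi>' t) (at t)"
  shows "\<phi> \<in> \<F> \<Longrightarrow> C_k_on n S (\<lambda>x. \<phi> (q x))"
proof (induction n arbitrary: \<phi>)
  case 0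
  then obtain \<phi>' where "\<And>t. t \<in> I \<Longrightarrow> (\<phi> has_real_derivative \<phi>' t) (at t)"
    using fam by blast
  then have "continuous_on I \<phi>"
    by (meson DERIV_isCont continuous_at_imp_continuous_on)
  then show ?case using q(1)[of 0] q(2) by (auto intro: continuous_on_compose2)
next
  case (Suc n)
  then obtain \<phi>' where \<phi>': "\<And>t. t \<in> I \<Longrightarrow> (\<phi> has_real_derivative \<phi>' t) (at t)" "\<phi>' \<in> \<F>"
    using fam by blast
  have "((\<lambda>x. \<phi> (q x)) has_derivative (\<lambda>v. \<phi>' (q x) * hderiv q x v)) (at x within half_space)" if "x \<in> S" for x
    using has_derivative_compose[OF C_k_on_SucE[OF q(1)[of "Suc 0"] that], of \<phi> "(*) (\<phi>' (q x))"]
      \<phi>'(1) that q(2) has_derivative_at_withinI unfolding has_field_derivative_def by blast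
  then show ?case
    by (rule C_k_on_Suc_intro[OF S])
      (use Suc.IH \<phi>'(2) q(1)[of "Suc n"] in \<open>auto intro!: C_k_on_mult[OF S]\<close>)
qed

section \<open>Smooth functions\<close>

lemma smooth_on_cong:
  assumes "relopen S" "\<And>y. y \<in> S \<Longrightarrow> f y = g y"
  shows "smooth_on S f \<longleftrightarrow> smooth_on S g"
  using C_k_on_cong[of S f g, OF assms] unfolding smooth_on_def by blast

lemma smooth_on_Un: "relopen S \<Longrightarrow> relopen S' \<Longrightarrow> smooth_on S f \<Longrightarrow> smooth_on S' f \<Longrightarrow> smooth_on (S \<union> S') f"
  unfolding smooth_on_def using C_k_on_Un by blast

lemma smooth_on_const: "relopen S \<Longrightarrow> smooth_on S (\<lambda>x. c)"
  unfolding smooth_on_def using C_k_on_const by blast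

lemma smooth_on_bounded_linear:
  "relopen S \<Longrightarrow> bounded_linear L \<Longrightarrow> smooth_on S f \<Longrightarrow> smooth_on S (\<lambda>x. L (f x))"
  unfolding smooth_on_def using C_k_on_bounded_linear by blast

lemma smooth_on_add: "relopen S \<Longrightarrow> smooth_on S f \<Longrightarrow> smooth_on S f' \<Longrightarrow> smooth_on S (\<lambda>x. f x + f' x)"
  unfolding smooth_on_def using C_k_on_add by blast

lemma smooth_on_mult:
  fixes f f' :: "real^3 \<Rightarrow> real"
  shows "relopen S \<Longrightarrow> smooth_on S f \<Longrightarrow> smooth_on S f' \<Longrightarrow> smooth_on S (\<lambda>x. f x * f' x)"
  unfolding smooth_on_def using C_k_on_mult by blast

lemma smooth_on_diff:
  fixes f f' :: "real^3 \<Rightarrow> real"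
  assumes "relopen S" "smooth_on S f" "smooth_on S f'" shows "smooth_on S (\<lambda>x. f x - f' x)"
  using smooth_on_add[OF assms(1,2) smooth_on_mult[OF assms(1) smooth_on_const[OF assms(1), of "-1"] assms(3)]]
  by simp

lemma smooth_on_compose:
  fixes f :: "real^3 \<Rightarrow> real"
  assumes "relopen S" "relopen S'" "smooth_on S T" "T ` S \<subseteq> S'" "smooth_on S' f"
  shows "smooth_on S (\<lambda>x. f (T x))"
  using C_k_on_compose[OF assms(1,2) _ assms(4)] assms(3,5) unfolding smooth_on_def by blast

lemma smooth_on_hderiv: "smooth_on S f \<Longrightarrow> smooth_on S (\<lambda>x. hderiv f x v)"
  unfolding smooth_on_def using C_k_on.simps(2) by blast

lemma smooth_on_differentiable: "smooth_on S f \<Longrightarrow> x \<in> S \<Longrightarrow> f differentiable (at x within half_space)"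
  unfolding smooth_on_def using C_k_on.simps(2) by blast

lemma smooth_on_has_derivative:
  "smooth_on S f \<Longrightarrow> x \<in> S \<Longrightarrow> (f has_derivative hderiv f x) (at x within half_space)"
  using smooth_on_differentiable differentiable_hderiv by blast

lemma smooth_on_continuous: "smooth_on S f \<Longrightarrow> continuous_on S f"
  unfolding smooth_on_def using C_k_on.simps(1) by blast

lemma smooth_on_powr:
  fixes q :: "real^3 \<Rightarrow> real"
  assumes "relopen S" "smooth_on S q" "\<And>x. x \<in> S \<Longrightarrow> 0 < q x"
  shows "smooth_on S (\<lambda>x. q x powr a)"
proof -
  \<comment> \<open>The constant factor makes the family of powers closed under
    differentiation.\<close>
  define \<F> where "\<F> = range (\<lambda>(c, a) t. c * t powr a :: real)"
  have "\<exists>\<phi>'\<in>\<F>. \<forall>t\<in>{0<..}. (\<phi> has_real_derivative \<phi>' t) (at t)" if \<phi>\<F>: "\<phi> \<in> \<F>" for \<phi>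
  proof -
    obtain c a where \<phi>: "\<phi> = (\<lambda>t. c * t powr a)"
      using \<phi>\<F> unfolding \<F>_def by (auto simp: image_iff)
    have "(\<phi> has_real_derivative (c * a) * t powr (a - 1)) (at t)" if "t > 0" for t
      unfolding \<phi> using that by (auto intro!: derivative_eq_intros)
    then show ?thesis
      unfolding \<F>_def by (intro bexI[of _ "\<lambda>t. (c * a) * t powr (a - 1)"]) auto
  qed
  moreover have "(\<lambda>t. 1 * t powr a) \<in> \<F>"
    unfolding \<F>_def by (rule range_eqI[of _ _ "(1, a)"]) simp
  ultimately have "C_k_on n S (\<lambda>x. 1 * q x powr a)" for n
    by (intro C_k_on_real_family[OF assms(1), of q "{0<..}" \<F> "\<lambda>t. 1 * t powr a"])
      (use assms in \<open>auto simp: smooth_on_def simp del: C_k_on.simps\<close>)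
  then show ?thesis by (simp add: smooth_on_def)
qed

text \<open>A class of functions that contains exp(-1/t), extended by 0, and is closed under
  differentiation; the polynomial in 1/t absorbs the factors that derivatives produce.\<close>

definition flat_exp :: "real poly \<Rightarrow> real \<Rightarrow> real"
  where "flat_exp p t = (if t \<le> 0 then 0 else poly p (inverse t) * exp (- inverse t))"

lemma poly_exp_tendsto_0: "((\<lambda>u. poly p u * exp (- u)) \<longlongrightarrow> (0::real)) at_top"
proof -
  have "((\<lambda>u. \<Sum>i\<le>degree p. coeff p i * (u ^ i / exp u)) \<longlongrightarrow> (\<Sum>i\<le>degree p. coeff p i * 0)) at_top"
    by (intro tendsto_intros tendsto_power_div_exp_0)
  then show ?thesis
    by (simp add: poly_altdef sum_distrib_right exp_minus divide_inverse mult.assoc)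
qed

text \<open>With u = 1/t one has du/dt = -u^2, hence the derivative of p(u) exp(-u) is u^2 (p -
  p')(u) exp(-u). At 0 only the right-hand difference quotient needs an estimate.\<close>

lemma flat_exp_has_derivative:
  "(flat_exp p has_real_derivative flat_exp (monom 1 2 * (p - pderiv p)) t) (at t)"
proof -
  consider "t < 0" | "t > 0" | "t = 0" by linarith
  then show ?thesis
  proof cases
    case 1
    have "((\<lambda>t. 0) has_real_derivative flat_exp (monom 1 2 * (p - pderiv p)) t) (at t)"
      using 1 by (simp add: flat_exp_def)
    then show ?thesis
      by (rule has_field_derivative_transform_within_open[of _ _ _ "{..<0}"]) (use 1 in \<open>auto simp: flat_exp_def\<close>)
  next
    case 2
    have "((\<lambda>t. poly p (inverse t) * exp (- inverse t)) has_real_derivative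
        flat_exp (monom 1 2 * (p - pderiv p)) t) (at t)"
      using 2 by (auto intro!: derivative_eq_intros DERIV_chain2[OF poly_DERIV]
          simp: flat_exp_def poly_monom field_simps power2_eq_square)
    then show ?thesis
      by (rule has_field_derivative_transform_within_open[of _ _ _ "{0<..}"]) (use 2 in \<open>auto simp: flat_exp_def\<close>)
  next
    case 3
    have "((\<lambda>h. flat_exp p h / h) \<longlongrightarrow> 0) (at_left 0)"
      by (rule tendsto_eventually) (auto simp: flat_exp_def eventually_at_filter)
    moreover have "((\<lambda>h. flat_exp p h / h) \<longlongrightarrow> 0) (at_right 0)"
    proof -
      \<comment> \<open>Dividing by h multiplies by u = 1/h, which is the factor
        \<open>[:0, 1:]\<close>; the exponential decay in u still wins.\<close>
      have "((\<lambda>h. poly ([:0, 1:] * p) (inverse h) * exp (- inverse h)) \<longlongrightarrow> 0) (at_right 0)"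
        by (rule filterlim_compose[OF poly_exp_tendsto_0 filterlim_inverse_at_top_right])
      then show ?thesis
        by (rule Lim_transform_eventually)
          (auto simp: flat_exp_def eventually_at_filter divide_inverse)
    qed
    ultimately have "((\<lambda>h. flat_exp p h / h) \<longlongrightarrow> 0) (at 0)"
      by (rule filterlim_split_at)
    then show ?thesis
      using 3 by (simp add: DERIV_def flat_exp_def)
  qed
qed

lemma smooth_on_flat_exp:
  assumes "relopen S" "smooth_on S q"
  shows "smooth_on S (\<lambda>x. flat_exp p (q x))"
proof -
  have "C_k_on n S (\<lambda>x. flat_exp p (q x))" for n
    by (rule C_k_on_real_family[OF assms(1), where \<F> = "range flat_exp" and I = UNIV])
      (use assms flat_exp_has_derivative in \<open>auto simp: smooth_on_def simp del: C_k_on.simps\<close>)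
  then show ?thesis
    by (simp add: smooth_on_def)
qed

section \<open>Symmetry of second derivatives up to the boundary\<close>

lemma mvt_within_segment:
  fixes f :: "real^3 \<Rightarrow> real"
  assumes "0 < s"
    and seg: "\<And>\<tau>. 0 \<le> \<tau> \<Longrightarrow> \<tau> \<le> s \<Longrightarrow> x + \<tau> *\<^sub>R v \<in> half_space"
    and f: "\<And>\<tau>. 0 \<le> \<tau> \<Longrightarrow> \<tau> \<le> s \<Longrightarrow>
      (f has_derivative f' (x + \<tau> *\<^sub>R v)) (at (x + \<tau> *\<^sub>R v) within half_space)"
  shows "\<exists>\<tau>. 0 < \<tau> \<and> \<tau> < s \<and> f (x + s *\<^sub>R v) - f x = s * f' (x + \<tau> *\<^sub>R v) v"
proof -
  have der: "((\<lambda>\<tau>. f (x + \<tau> *\<^sub>R v)) has_derivative (\<lambda>h. h * f' (x + \<tau> *\<^sub>R v) v)) (at \<tau> within {0..s})"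
    if \<tau>: "0 \<le> \<tau>" "\<tau> \<le> s" for \<tau>
  proof -
    have "((\<lambda>\<tau>. x + \<tau> *\<^sub>R v) has_derivative (\<lambda>h. h *\<^sub>R v)) (at \<tau> within {0..s})"
      by (auto intro!: derivative_eq_intros)
    moreover have "(f has_derivative f' (x + \<tau> *\<^sub>R v)) (at (x + \<tau> *\<^sub>R v) within (\<lambda>\<tau>. x + \<tau> *\<^sub>R v) ` {0..s})"
      by (rule has_derivative_subset[OF f[OF \<tau>]]) (use seg in auto)
    ultimately have "((\<lambda>\<tau>. f (x + \<tau> *\<^sub>R v)) has_derivative (\<lambda>h. f' (x + \<tau> *\<^sub>R v) (h *\<^sub>R v))) (at \<tau> within {0..s})"
      by (rule has_derivative_in_compose)
    then show ?thesis
      using linear_scale[OF has_derivative_linear[OF f[OF \<tau>]]] by simp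
  qed
  from mvt_simple[OF \<open>0 < s\<close>, of "\<lambda>\<tau>. f (x + \<tau> *\<^sub>R v)" "\<lambda>\<tau> h. h * f' (x + \<tau> *\<^sub>R v) v"] der
  show ?thesis by auto
qed

lemma relopen_ball:
  assumes "relopen S" "x \<in> S"
  obtains r where "0 < r" "\<And>y. y \<in> half_space \<Longrightarrow> dist y x < r \<Longrightarrow> y \<in> S"
  using assms unfolding openin_euclidean_subtopology_iff by metis

text \<open>The mean value theorem is applied twice: along v to the increment of \<open>f\<close> in
  direction w, then along w to the derivative of \<open>f\<close> in direction v. As w does not
  point out of the half space, translation by a positive multiple of w maps the half space into
  itself, which the chain rule needs.\<close>

lemma second_difference_mvt:
  fixes f :: "real^3 \<Rightarrow> real"
  assumes f: "smooth_on S f" and "0 < s" and vw: "0 \<le> v $ 1" "0 \<le> w $ 1"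
    and inS: "\<And>\<tau> \<sigma>. 0 \<le> \<tau> \<Longrightarrow> \<tau> \<le> s \<Longrightarrow> 0 \<le> \<sigma> \<Longrightarrow> \<sigma> \<le> s \<Longrightarrow> x + \<tau> *\<^sub>R v + \<sigma> *\<^sub>R w \<in> S"
    and S: "S \<subseteq> half_space"
  shows "\<exists>\<tau> \<sigma>. 0 < \<tau> \<and> \<tau> < s \<and> 0 < \<sigma> \<and> \<sigma> < s \<and>
    f (x + s *\<^sub>R v + s *\<^sub>R w) - f (x + s *\<^sub>R v) - f (x + s *\<^sub>R w) + f x =
      s * (s * hderiv (\<lambda>y. hderiv f y v) (x + \<tau> *\<^sub>R v + \<sigma> *\<^sub>R w) w)"
proof -
  define D where "D y = f (y + s *\<^sub>R w) - f y" for y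
  define D' where "D' y = (\<lambda>u. hderiv f (y + s *\<^sub>R w) u - hderiv f y u)" for y
  have "\<exists>\<tau>. 0 < \<tau> \<and> \<tau> < s \<and> D (x + s *\<^sub>R v) - D x = s * D' (x + \<tau> *\<^sub>R v) v"
  proof (rule mvt_within_segment[OF \<open>0 < s\<close>])
    fix \<tau> :: real assume \<tau>: "0 \<le> \<tau>" "\<tau> \<le> s"
    let ?y = "x + \<tau> *\<^sub>R v"
    have y: "?y \<in> S" "?y + s *\<^sub>R w \<in> S"
      using inS[OF \<tau>, of 0] inS[OF \<tau>, of s] \<open>0 < s\<close> by auto
    then show "?y \<in> half_space" using S by auto
    have "((\<lambda>y. y + s *\<^sub>R w) has_derivative (\<lambda>u. u)) (at ?y within half_space)"
      by (auto intro!: derivative_eq_intros)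
    moreover have "(f has_derivative hderiv f (?y + s *\<^sub>R w)) (at (?y + s *\<^sub>R w) within (\<lambda>y. y + s *\<^sub>R w) ` half_space)"
      by (rule has_derivative_subset[OF smooth_on_has_derivative[OF f y(2)]])
        (use vw \<open>0 < s\<close> in \<open>auto simp: half_space_def\<close>)
    ultimately have "((\<lambda>y. f (y + s *\<^sub>R w)) has_derivative hderiv f (?y + s *\<^sub>R w)) (at ?y within half_space)"
      by (rule has_derivative_in_compose)
    from has_derivative_diff[OF this smooth_on_has_derivative[OF f y(1)]]
    show "(D has_derivative D' ?y) (at ?y within half_space)"
      unfolding D_def D'_def .
  qed
  then obtain \<tau> where \<tau>: "0 < \<tau>" "\<tau> < s" "D (x + s *\<^sub>R v) - D x = s * D' (x + \<tau> *\<^sub>R v) v"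
    by blast
  let ?y = "x + \<tau> *\<^sub>R v"
  obtain \<sigma> where \<sigma>: "0 < \<sigma>" "\<sigma> < s" "hderiv f (?y + s *\<^sub>R w) v - hderiv f ?y v =
      s * hderiv (\<lambda>y. hderiv f y v) (?y + \<sigma> *\<^sub>R w) w"
    using mvt_within_segment[OF \<open>0 < s\<close>, of ?y w "\<lambda>y. hderiv f y v" "hderiv (\<lambda>y. hderiv f y v)"]
      inS[of \<tau>] \<tau> S smooth_on_has_derivative[OF smooth_on_hderiv[OF f]] by (auto simp: subset_iff)
  have "D (x + s *\<^sub>R v) - D x = s * (s * hderiv (\<lambda>y. hderiv f y v) (?y + \<sigma> *\<^sub>R w) w)"
    using \<tau>(3) \<sigma>(3) by (simp add: D'_def)
  then show ?thesis
    using \<tau> \<sigma> unfolding D_def by (intro exI[of _ \<tau>] exI[of _ \<sigma>]) auto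
qed

text \<open>The second difference is symmetric in v and w, so the two mixed derivatives agree at
  suitable points arbitrarily close to x; continuity then excludes a gap at x.\<close>

lemma hderiv_symmetric_nonneg:
  fixes f :: "real^3 \<Rightarrow> real"
  assumes S: "relopen S" and f: "smooth_on S f" and x: "x \<in> S" and vw: "0 \<le> v $ 1" "0 \<le> w $ 1"
  shows "hderiv (\<lambda>y. hderiv f y v) x w = hderiv (\<lambda>y. hderiv f y w) x v"
proof (rule ccontr)
  let ?F = "\<lambda>x. hderiv (\<lambda>y. hderiv f y v) x w" and ?G = "\<lambda>x. hderiv (\<lambda>y. hderiv f y w) x v"
  assume neq: "?F x \<noteq> ?G x"
  define e where "e = \<bar>?F x - ?G x\<bar> / 2"
  have e: "0 < e" using neq by (simp add: e_def)
  have cont: "continuous_on S ?F" "continuous_on S ?G"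
    by (intro smooth_on_continuous smooth_on_hderiv f)+
  obtain r0 where r0: "0 < r0" "\<And>y. y \<in> half_space \<Longrightarrow> dist y x < r0 \<Longrightarrow> y \<in> S"
    using relopen_ball[OF S x] by blast
  obtain r1 where r1: "0 < r1" "\<And>y. y \<in> S \<Longrightarrow> dist y x < r1 \<Longrightarrow> dist (?F y) (?F x) < e"
    using cont(1) x e unfolding continuous_on_iff by blast
  obtain r2 where r2: "0 < r2" "\<And>y. y \<in> S \<Longrightarrow> dist y x < r2 \<Longrightarrow> dist (?G y) (?G x) < e"
    using cont(2) x e unfolding continuous_on_iff by blast
  define r where "r = min r0 (min r1 r2)"
  \<comment> \<open>Keeps the whole parallelogram spanned by s v and s w within distance r of x; the
    summand 1 covers the case v = w = 0.\<close>
  define s where "s = r / (2 * (norm v + norm w + 1))"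
  have r: "0 < r" using r0 r1 r2 by (simp add: r_def)
  have nv: "0 < norm v + norm w + 1"
    by (smt (verit) norm_ge_zero)
  then have s: "0 < s" using r by (simp add: s_def)
  have sr: "s * (norm v + norm w) < r"
  proof -
    have "s * (norm v + norm w) \<le> s * (norm v + norm w + 1)"
      using s by (simp add: algebra_simps)
    also have "\<dots> = r / 2"
      using nonzero_mult_divide_mult_cancel_right[of "norm v + norm w + 1" r 2] nv by (simp add: s_def del: nonzero_mult_divide_mult_cancel_right)
    finally show ?thesis using r by simp
  qed
  have near: "dist (x + \<tau> *\<^sub>R v + \<sigma> *\<^sub>R w) x < r" if "0 \<le> \<tau>" "\<tau> \<le> s" "0 \<le> \<sigma>" "\<sigma> \<le> s" for \<tau> \<sigma>
  proof -
    have "dist (x + \<tau> *\<^sub>R v + \<sigma> *\<^sub>R w) x = norm (\<tau> *\<^sub>R v + \<sigma> *\<^sub>R w)"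
      by (simp add: dist_norm algebra_simps)
    also have "\<dots> \<le> \<tau> * norm v + \<sigma> * norm w"
      using norm_triangle_ineq[of "\<tau> *\<^sub>R v" "\<sigma> *\<^sub>R w"] that by simp
    also have "\<dots> \<le> s * norm v + s * norm w"
      using that by (intro add_mono mult_right_mono) auto
    finally show ?thesis using sr by (simp add: algebra_simps)
  qed
  have inS: "x + \<tau> *\<^sub>R v + \<sigma> *\<^sub>R w \<in> S" if "0 \<le> \<tau>" "\<tau> \<le> s" "0 \<le> \<sigma>" "\<sigma> \<le> s" for \<tau> \<sigma>
  proof (rule r0(2))
    show "x + \<tau> *\<^sub>R v + \<sigma> *\<^sub>R w \<in> half_space"
      using relopen_subset[OF S] x vw that by (auto simp: half_space_def)
    show "dist (x + \<tau> *\<^sub>R v + \<sigma> *\<^sub>R w) x < r0"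
      using near[OF that] by (simp add: r_def)
  qed
  obtain \<tau> \<sigma> where 1: "0 < \<tau>" "\<tau> < s" "0 < \<sigma>" "\<sigma> < s"
    "f (x + s *\<^sub>R v + s *\<^sub>R w) - f (x + s *\<^sub>R v) - f (x + s *\<^sub>R w) + f x = s * (s * ?F (x + \<tau> *\<^sub>R v + \<sigma> *\<^sub>R w))"
    using second_difference_mvt[OF f s vw inS relopen_subset[OF S]] by blast
  have inS': "x + \<tau> *\<^sub>R w + \<sigma> *\<^sub>R v \<in> S" if "0 \<le> \<tau>" "\<tau> \<le> s" "0 \<le> \<sigma>" "\<sigma> \<le> s" for \<tau> \<sigma>
    using inS[OF that(3,4,1,2)] by (simp add: algebra_simps)
  obtain \<tau>' \<sigma>' where 2: "0 < \<tau>'" "\<tau>' < s" "0 < \<sigma>'" "\<sigma>' < s"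
    "f (x + s *\<^sub>R w + s *\<^sub>R v) - f (x + s *\<^sub>R w) - f (x + s *\<^sub>R v) + f x = s * (s * ?G (x + \<tau>' *\<^sub>R w + \<sigma>' *\<^sub>R v))"
    using second_difference_mvt[OF f s vw(2,1) inS' relopen_subset[OF S]] by blast
  define y z where "y = x + \<tau> *\<^sub>R v + \<sigma> *\<^sub>R w" and "z = x + \<tau>' *\<^sub>R w + \<sigma>' *\<^sub>R v"
  have z: "z = x + \<sigma>' *\<^sub>R v + \<tau>' *\<^sub>R w" by (simp add: z_def algebra_simps)
  have comm: "x + s *\<^sub>R w + s *\<^sub>R v = x + s *\<^sub>R v + s *\<^sub>R w" by (simp add: algebra_simps)
  have "s * (s * ?F y) = s * (s * ?G z)"
    using 1(5) 2(5) unfolding y_def z_def comm by linarith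
  then have "?F y = ?G z" using s by simp
  moreover have "dist (?F y) (?F x) < e"
    using r1(2)[of y] inS[of \<tau> \<sigma>] near[of \<tau> \<sigma>] 1 by (simp add: y_def r_def)
  moreover have "dist (?G z) (?G x) < e"
    using r2(2)[of z] inS[of \<sigma>' \<tau>'] near[of \<sigma>' \<tau>'] 2(1-4) unfolding z by (simp add: r_def)
  ultimately show False
    unfolding e_def dist_real_def by (smt (verit) field_sum_of_halves)
qed

lemma hderiv_minus_direction:
  assumes "f differentiable (at x within half_space)"
  shows "hderiv f x (- v) = - hderiv f x v"
  using linear_neg[OF linear_frechet_derivative[OF assms]] .

text \<open>Schwarz' theorem up to the boundary: directions are flipped so that difference quotients
  stay inside the half space.\<close>

lemma hderiv_symmetric:
  fixes f :: "real^3 \<Rightarrow> real"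
  assumes S: "relopen S" and f: "smooth_on S f" and x: "x \<in> S"
  shows "hderiv (\<lambda>y. hderiv f y v) x w = hderiv (\<lambda>y. hderiv f y w) x v"
proof -
  have outer: "hderiv (\<lambda>y. hderiv f y v) x (- w) = - hderiv (\<lambda>y. hderiv f y v) x w" for v w
    using smooth_on_differentiable[OF smooth_on_hderiv[OF f] x] by (rule hderiv_minus_direction)
  have inner: "hderiv (\<lambda>y. hderiv f y (- v)) x w = - hderiv (\<lambda>y. hderiv f y v) x w" for v w
  proof -
    have "hderiv (\<lambda>y. hderiv f y (- v)) x = hderiv (\<lambda>y. - hderiv f y v) x"
      by (rule hderiv_cong[OF S x]) (rule hderiv_minus_direction[OF smooth_on_differentiable[OF f]])
    also have "\<dots> = (\<lambda>w. - hderiv (\<lambda>y. hderiv f y v) x w)"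
      using x relopen_subset[OF S]
      by (intro hderiv_unique has_derivative_minus smooth_on_has_derivative[OF smooth_on_hderiv[OF f] x]) auto
    finally show ?thesis by simp
  qed
  define v' w' where "v' = (if 0 \<le> v $ 1 then v else - v)" and "w' = (if 0 \<le> w $ 1 then w else - w)"
  have "hderiv (\<lambda>y. hderiv f y v') x w' = hderiv (\<lambda>y. hderiv f y w') x v'"
    by (rule hderiv_symmetric_nonneg[OF S f x]) (auto simp: v'_def w'_def)
  then show ?thesis
    unfolding v'_def w'_def by (auto simp: outer inner split: if_splits)
qed

section \<open>Charts and the Riemannian volume\<close>

text \<open>For a nonnegative function, absolute integrability means that the integral is finite.
  The equivalence \<open>cov\<close> therefore yields equal finite values or infinity on both sides.
  Continuity supplies measurability.\<close>

lemma nn_integral_change_of_variables: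
  fixes f :: "real^3 \<Rightarrow> real" and T :: "real^3 \<Rightarrow> real^3"
  assumes S: "S \<in> sets borel" "T ` S \<in> sets borel"
    and T: "\<And>x. x \<in> S \<Longrightarrow> (T has_derivative T' x) (at x within S)" "inj_on T S"
    and f: "continuous_on (T ` S) f" "\<And>y. y \<in> T ` S \<Longrightarrow> 0 \<le> f y"
    and D: "continuous_on S (\<lambda>x. \<bar>det (matrix (T' x))\<bar> * f (T x))"
  shows "(\<integral>\<^sup>+y\<in>T ` S. ennreal (f y) \<partial>lborel) = (\<integral>\<^sup>+x\<in>S. ennreal (\<bar>det (matrix (T' x))\<bar> * f (T x)) \<partial>lborel)"
proof -
  let ?D = "\<lambda>x. \<bar>det (matrix (T' x))\<bar> * f (T x)"
  have cov: "?D absolutely_integrable_on S \<and> integral S ?D = b \<longleftrightarrow> f absolutely_integrable_on T ` S \<and> integral (T ` S) f = b" for b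
  proof -
    have S': "S \<in> sets lebesgue" using S(1) by simp
    \<comment> \<open>The change of variables used here is for functions into \<open>real^n\<close>;
      scalars are passed through \<open>real^1\<close>.\<close>
    have "vec (integral S ?D) = (vec b :: real^1) \<longleftrightarrow> integral S ?D = b" "vec (integral (T ` S) f) = (vec b :: real^1) \<longleftrightarrow> integral (T ` S) f = b"
      by (auto simp: vec_eq_iff)
    then show ?thesis
      using has_absolute_integral_change_of_variables[OF S' T, of "\<lambda>y. vec (f y) :: real^1" "vec b"]
      by (simp add: absolutely_integrable_on_1_iff integral_on_1_eq)
  qed
  have nn: "set_integrable lebesgue U h \<longleftrightarrow> (\<integral>\<^sup>+y\<in>U. ennreal (h y) \<partial>lborel) < \<infinity>"
    "set_integrable lebesgue U h \<Longrightarrow> (\<integral>\<^sup>+y\<in>U. ennreal (h y) \<partial>lborel) = ennreal (integral U h)"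
    if U: "U \<in> sets borel" "continuous_on U h" "\<And>y. y \<in> U \<Longrightarrow> 0 \<le> h y" for U and h :: "real^3 \<Rightarrow> real"
  proof -
    have m: "(\<lambda>y. indicator U y *\<^sub>R h y) \<in> borel_measurable lborel"
      using borel_measurable_continuous_on_indicator[OF U(1,2)] by simp
    have nneg: "0 \<le> indicator U y *\<^sub>R h y" for y
      using U(3) by (auto simp: indicator_def)
    have e: "(\<integral>\<^sup>+y\<in>U. ennreal (h y) \<partial>lborel) = (\<integral>\<^sup>+y. ennreal (indicator U y *\<^sub>R h y) \<partial>lborel)"
      by (intro nn_integral_cong) (auto simp: indicator_def)
    have s: "set_integrable lebesgue U h \<longleftrightarrow> integrable lborel (\<lambda>y. indicator U y *\<^sub>R h y)"
      unfolding set_integrable_def using m by (simp add: integrable_completion)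
    show "set_integrable lebesgue U h \<longleftrightarrow> (\<integral>\<^sup>+y\<in>U. ennreal (h y) \<partial>lborel) < \<infinity>"
      unfolding s e using integrableI_nonneg[OF m] m nneg by (auto simp: integrable_iff_bounded)
    assume i: "set_integrable lebesgue U h"
    have "(\<integral>\<^sup>+y. ennreal (indicator U y *\<^sub>R h y) \<partial>lborel) = ennreal (\<integral>y. indicator U y *\<^sub>R h y \<partial>lborel)"
      using i nneg unfolding s by (intro nn_integral_eq_integral) auto
    also have "(\<integral>y. indicator U y *\<^sub>R h y \<partial>lborel) = set_lebesgue_integral lebesgue U h"
      unfolding set_lebesgue_integral_def by (rule integral_completion[symmetric]) (rule m)
    also have "\<dots> = integral U h"
      using set_lebesgue_integral_eq_integral(2)[OF i] .
    finally show "(\<integral>\<^sup>+y\<in>U. ennreal (h y) \<partial>lborel) = ennreal (integral U h)"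
      unfolding e .
  qed
  have D0: "0 \<le> ?D x" if "x \<in> S" for x
    using f(2) that by simp
  note nD = nn[OF S(1) D D0] and nf = nn[OF S(2) f]
  show ?thesis
  proof (cases "f absolutely_integrable_on T ` S")
    case True
    then have "?D absolutely_integrable_on S" "integral S ?D = integral (T ` S) f"
      using cov by blast+
    then show ?thesis using nD(2) nf(2) True by simp
  next
    case False
    then have "\<not> ?D absolutely_integrable_on S"
      using cov by blast
    then show ?thesis using nD(1) nf(1) False by (simp add: less_top[symmetric])
  qed
qed

text \<open>Three test vectors suffice: the third axis, a vector whose quadratic form is
  \<open>G$3$3 * m\<close> for the lower 2 by 2 minor m, and the first column v of the adjugate. The
  latter satisfies G v = det G times the first axis, hence v . G v = m det G.\<close>

lemma positive_definite_det_pos: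
  fixes G :: "real^3^3"
  assumes sym: "transpose G = G" and pos: "\<And>v. v \<noteq> 0 \<Longrightarrow> 0 < v \<bullet> (G *v v)"
  shows "0 < det G"
proof -
  have s: "G $ i $ j = G $ j $ i" for i j
    using arg_cong[OF sym, of "\<lambda>M. M $ i $ j"] by (simp add: transpose_def)
  define m where "m = G$2$2 * G$3$3 - G$2$3 * G$2$3"
  have "axis 3 1 \<noteq> (0::real^3)" by (simp add: axis_eq_0_iff)
  from pos[OF this] have g33: "0 < G$3$3"
    by (simp add: matrix_vector_mult_def inner_vec_def sum_3 axis_def)
  have "vector [0, G$3$3, - G$2$3] \<noteq> (0::real^3)"
    using g33 by (auto simp: vec_eq_iff forall_3)
  from pos[OF this] have "0 < G$3$3 * m"
    by (simp add: matrix_vector_mult_def inner_vec_def sum_3 m_def s[of 3 2] algebra_simps)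
  then have m: "0 < m" using g33 by (simp add: zero_less_mult_iff)
  define v :: "real^3" where "v = vector [m, G$2$3 * G$1$3 - G$1$2 * G$3$3, G$1$2 * G$2$3 - G$1$3 * G$2$2]"
  have "v \<noteq> 0" using m by (auto simp: v_def vec_eq_iff forall_3)
  moreover have "v \<bullet> (G *v v) = m * det G"
    by (simp add: v_def m_def matrix_vector_mult_def inner_vec_def sum_3 det_3 s[of 3 2] s[of 3 1] s[of 2 1] algebra_simps)
  ultimately have "0 < m * det G" using pos by metis
  then show ?thesis using m by (simp add: zero_less_mult_iff)
qed

lemma inner_matrix_vector_transpose:
  fixes M :: "real^'n^'m" shows "(M *v v) \<bullet> u = v \<bullet> (transpose M *v u)"
  by (metis dot_lmul_matrix transpose_matrix_vector inner_commute)

context riemannian_3_manifold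
begin

section \<open>Charts, transition maps and the metric in coordinates\<close>

definition pt :: "'m chart \<Rightarrow> real^3 \<Rightarrow> 'm"
  where "pt c = the_inv_into (fst c) (snd c)"

abbreviation jac :: "'m chart \<Rightarrow> 'm chart \<Rightarrow> real^3 \<Rightarrow> real^3 \<Rightarrow> real^3"
  where "jac c c' x \<equiv> hderiv (transition c c') x"

abbreviation vol_factor :: "'m chart \<Rightarrow> real^3 \<Rightarrow> real"
  where "vol_factor c x \<equiv> sqrt (det (g c x))"

lemma chart_cover: "\<exists>c\<in>A. p \<in> fst c"
  using smooth_atlas unfolding smooth_atlas_def by blast

lemma chart_at: "chart_at A p \<in> A" "p \<in> fst (chart_at A p)"
  using someI_ex[OF chart_cover[of p, unfolded Bex_def]] unfolding chart_at_def by auto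

lemma chart_open: "c \<in> A \<Longrightarrow> open (fst c)"
  using smooth_atlas unfolding smooth_atlas_def by blast

lemma chart_relopen: "c \<in> A \<Longrightarrow> relopen (chart_image c)"
  using smooth_atlas unfolding smooth_atlas_def by blast

lemma chart_inj: "c \<in> A \<Longrightarrow> inj_on (snd c) (fst c)"
  using smooth_atlas unfolding smooth_atlas_def homeomorphism_def by (metis inj_onI)

lemma pt_chart [simp]: "c \<in> A \<Longrightarrow> p \<in> fst c \<Longrightarrow> pt c (snd c p) = p"
  unfolding pt_def using chart_inj by (rule the_inv_into_f_f)

lemma chart_pt [simp]: "c \<in> A \<Longrightarrow> x \<in> chart_image c \<Longrightarrow> snd c (pt c x) = x"
  by auto

lemma pt_in_chart: "c \<in> A \<Longrightarrow> x \<in> chart_image c \<Longrightarrow> pt c x \<in> fst c"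
  by auto

lemma chart_homeomorphism:
  assumes c: "c \<in> A" shows "homeomorphism (fst c) (chart_image c) (snd c) (pt c)"
proof -
  obtain \<psi> where \<psi>: "homeomorphism (fst c) (chart_image c) (snd c) \<psi>"
    using smooth_atlas c unfolding smooth_atlas_def by blast
  have "pt c x = \<psi> x" if "x \<in> chart_image c" for x
    using that c \<psi> unfolding homeomorphism_def by force
  then show ?thesis
    by (intro homeomorphism_cong[OF \<psi> refl refl refl])
qed

lemma chart_continuous: "c \<in> A \<Longrightarrow> continuous_on (fst c) (snd c)"
  and pt_continuous: "c \<in> A \<Longrightarrow> continuous_on (chart_image c) (pt c)"
  using chart_homeomorphism unfolding homeomorphism_def by blast+

lemma chart_image_relopen:
  assumes "c \<in> A" "open U" "U \<subseteq> fst c"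
  shows "relopen (snd c ` U)"
proof -
  have "openin (top_of_set (fst c)) U"
    using assms by (simp add: open_subset)
  then have "openin (top_of_set (chart_image c)) (snd c ` U)"
    using chart_homeomorphism[OF assms(1)] homeomorphism_imp_open_map by blast
  then show ?thesis
    using chart_relopen[OF assms(1)] openin_trans by blast
qed

lemma overlap_relopen: "c \<in> A \<Longrightarrow> c' \<in> A \<Longrightarrow> relopen (overlap c c')"
  unfolding overlap_def by (rule chart_image_relopen) (auto intro: chart_open)

lemma overlap_subset: "overlap c c' \<subseteq> chart_image c"
  unfolding overlap_def by auto

lemma transition_chart: "c \<in> A \<Longrightarrow> p \<in> fst c \<Longrightarrow> transition c c' (snd c p) = snd c' p"
  using pt_chart unfolding transition_def pt_def by simp

lemma transition_inj: "c \<in> A \<Longrightarrow> c' \<in> A \<Longrightarrow> inj_on (transition c c') (overlap c c')"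
  unfolding overlap_def by (auto simp: inj_on_def transition_chart dest: inj_onD[OF chart_inj])

lemma transition_in_chart: "c \<in> A \<Longrightarrow> x \<in> overlap c c' \<Longrightarrow> transition c c' x \<in> chart_image c'"
  unfolding overlap_def by (auto simp: transition_chart)

lemma transition_smooth: "c \<in> A \<Longrightarrow> c' \<in> A \<Longrightarrow> smooth_on (overlap c c') (transition c c')"
  using smooth_atlas unfolding smooth_atlas_def by blast

lemma jac_linear: "c \<in> A \<Longrightarrow> c' \<in> A \<Longrightarrow> x \<in> overlap c c' \<Longrightarrow> linear (jac c c' x)"
  using linear_frechet_derivative smooth_on_differentiable[OF transition_smooth] by blast

lemma jac_matrix: "c \<in> A \<Longrightarrow> c' \<in> A \<Longrightarrow> x \<in> overlap c c' \<Longrightarrow> jac c c' x v = matrix (jac c c' x) *v v"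
  using jac_linear by (simp add: matrix_works)

lemma metric_symmetric: "c \<in> A \<Longrightarrow> x \<in> chart_image c \<Longrightarrow> transpose (g c x) = g c x"
  and metric_positive: "c \<in> A \<Longrightarrow> x \<in> chart_image c \<Longrightarrow> v \<noteq> 0 \<Longrightarrow> 0 < v \<bullet> (g c x *v v)"
  and metric_smooth: "c \<in> A \<Longrightarrow> smooth_on (chart_image c) (g c)"
  and metric_transition: "c \<in> A \<Longrightarrow> c' \<in> A \<Longrightarrow> x \<in> overlap c c' \<Longrightarrow>
        v \<bullet> (g c x *v w) = jac c c' x v \<bullet> (g c' (transition c c' x) *v jac c c' x w)"
  using riemannian_metric unfolding riemannian_metric_def by blast+

lemma metric_det_pos: "c \<in> A \<Longrightarrow> x \<in> chart_image c \<Longrightarrow> 0 < det (g c x)"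
  using positive_definite_det_pos metric_symmetric metric_positive by blast

lemma metric_transition_matrix:
  assumes "c \<in> A" "c' \<in> A" "x \<in> overlap c c'"
  shows "g c x = transpose (matrix (jac c c' x)) ** g c' (transition c c' x) ** matrix (jac c c' x)"
proof -
  let ?J = "matrix (jac c c' x)" and ?g' = "g c' (transition c c' x)"
  have "v \<bullet> (g c x *v w) = v \<bullet> ((transpose ?J ** ?g' ** ?J) *v w)" for v w
    using metric_transition[OF assms, of v w] jac_matrix[OF assms]
    by (simp only: matrix_vector_mul_assoc[symmetric] inner_matrix_vector_transpose)
  then have "g c x *v w = (transpose ?J ** ?g' ** ?J) *v w" for w
    by (metis vector_eq_rdot inner_commute)
  then show ?thesis
    by (simp add: matrix_eq)
qed

lemma det_transition:
  assumes "c \<in> A" "c' \<in> A" "x \<in> overlap c c'"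
  shows "det (g c x) = (det (matrix (jac c c' x)))\<^sup>2 * det (g c' (transition c c' x))"
  using arg_cong[OF metric_transition_matrix[OF assms], of det]
  by (simp add: det_mul det_transpose power2_eq_square)

text \<open>det g is positive in the first chart and contains the factor det(J)^2, so J is
  invertible without any reference to the inverse transition map.\<close>

lemma jac_det_nonzero:
  assumes "c \<in> A" "c' \<in> A" "x \<in> overlap c c'"
  shows "det (matrix (jac c c' x)) \<noteq> 0"
  using det_transition[OF assms] metric_det_pos[OF assms(1), of x] overlap_subset assms(3) by fastforce

lemma vol_factor_transition:
  assumes "c \<in> A" "c' \<in> A" "x \<in> overlap c c'"
  shows "vol_factor c x = \<bar>det (matrix (jac c c' x))\<bar> * vol_factor c' (transition c c' x)"
  by (simp add: det_transition[OF assms] real_sqrt_mult)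

lemma vol_factor_pos: "c \<in> A \<Longrightarrow> x \<in> chart_image c \<Longrightarrow> 0 < vol_factor c x"
  using metric_det_pos by simp

lemma metric_component_smooth: "c \<in> A \<Longrightarrow> smooth_on (chart_image c) (\<lambda>x. g c x $ i $ j)"
  by (intro smooth_on_bounded_linear[OF chart_relopen bounded_linear_vec_nth]) (auto intro: metric_smooth)

lemma metric_det_smooth: "c \<in> A \<Longrightarrow> smooth_on (chart_image c) (\<lambda>x. det (g c x))"
  unfolding det_3
  by (intro smooth_on_add smooth_on_diff smooth_on_mult metric_component_smooth chart_relopen)

lemma vol_factor_continuous: "c \<in> A \<Longrightarrow> continuous_on (chart_image c) (vol_factor c)"
  by (intro continuous_intros smooth_on_continuous metric_det_smooth)

lemma chart_image_borel: "c \<in> A \<Longrightarrow> chart_image c \<in> sets borel"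
proof -
  assume "c \<in> A"
  then obtain T where T: "open T" "chart_image c = half_space \<inter> T"
    using chart_relopen unfolding openin_open by blast
  have "closed half_space"
    unfolding half_space_def by (intro closed_Collect_le continuous_intros)
  with T show ?thesis by auto
qed

lemma chart_image_borel_subset:
  assumes c: "c \<in> A" and S: "S \<in> sets borel" "S \<subseteq> fst c"
  shows "snd c ` S \<in> sets borel"
proof -
  have "pt c \<in> borel_measurable (restrict_space borel (chart_image c))"
    by (rule borel_measurable_continuous_on_restrict[OF pt_continuous[OF c]])
  from measurable_sets[OF this S(1)]
  have "pt c -` S \<inter> chart_image c \<in> sets (restrict_space borel (chart_image c))"
    by (simp add: space_restrict_space)
  moreover have "pt c -` S \<inter> chart_image c = snd c ` S"
    using S(2) c by force
  ultimately show ?thesis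
    using chart_image_borel[OF c] by (simp add: sets_restrict_space_iff)
qed

lemma chart_sequence:
  obtains cs :: "nat \<Rightarrow> 'm chart" where "\<And>n. cs n \<in> A" "(\<Union>n. fst (cs n)) = UNIV"
proof -
  obtain \<F> where \<F>: "\<F> \<subseteq> fst ` A" "countable \<F>" "\<Union>\<F> = \<Union>(fst ` A)"
    using Lindelof[of "fst ` A"] chart_open by blast
  have U: "\<Union>\<F> = UNIV" using \<F>(3) chart_cover by auto
  then have ne: "\<F> \<noteq> {}" by auto
  define cs where "cs n = (SOME c. c \<in> A \<and> fst c = from_nat_into \<F> n)" for n
  have "cs n \<in> A \<and> fst (cs n) = from_nat_into \<F> n" for n
    unfolding cs_def by (rule someI_ex) (use from_nat_into[OF ne] \<F>(1) in \<open>metis imageE subsetD\<close>)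
  then show ?thesis
    using that[of cs] U range_from_nat_into[OF ne \<F>(2)] by auto
qed

text \<open>A countable Borel partition subordinate to charts reduces statements about measures on
  the manifold to single charts.\<close>

lemma chart_partition:
  obtains cs :: "nat \<Rightarrow> 'm chart" and P where "\<And>n. cs n \<in> A"
    "\<And>n. P n \<in> sets borel" "\<And>n. P n \<subseteq> fst (cs n)" "disjoint_family P" "(\<Union>n. P n) = UNIV"
proof -
  obtain cs :: "nat \<Rightarrow> 'm chart" where cs: "\<And>n. cs n \<in> A" "(\<Union>n. fst (cs n)) = UNIV"
    by (rule chart_sequence) (rule that)
  let ?P = "disjointed (\<lambda>n. fst (cs n))"
  have "range (\<lambda>n. fst (cs n)) \<subseteq> sets borel"
    using chart_open[OF cs(1)] borel_open by blast
  then have "range ?P \<subseteq> sets borel"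
    by (rule sets.range_disjointed_sets)
  then show ?thesis
    using that[of cs ?P] cs disjointed_subset[of "\<lambda>n. fst (cs n)"]
      disjoint_family_disjointed[of "\<lambda>n. fst (cs n)"] UN_disjointed_eq[of "\<lambda>n. fst (cs n)"] by auto
qed

section \<open>Construction of the Riemannian volume\<close>

definition chart_volume :: "'m chart \<Rightarrow> 'm set \<Rightarrow> ennreal"
  where "chart_volume c S = (\<integral>\<^sup>+x\<in>snd c ` S. ennreal (vol_factor c x) \<partial>lborel)"

text \<open>The density sqrt(det g) changes by |det J|, exactly the factor in the change of
  variables, so the local volumes are consistent.\<close>

lemma chart_volume_transition:
  assumes c: "c \<in> A" "c' \<in> A" and S: "S \<in> sets borel" "S \<subseteq> fst c \<inter> fst c'"
  shows "chart_volume c S = chart_volume c' S"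
proof -
  let ?T = "transition c c'" and ?S = "snd c ` S"
  have sub: "?S \<subseteq> overlap c c'"
    using S by (auto simp: overlap_def)
  have im: "?T ` ?S = snd c' ` S"
    unfolding image_image using S c by (intro image_cong) (auto simp: transition_chart)
  have eq: "\<bar>det (matrix (jac c c' x))\<bar> * vol_factor c' (?T x) = vol_factor c x" if "x \<in> ?S" for x
    using vol_factor_transition[OF c] sub that by auto
  have "(\<integral>\<^sup>+y\<in>?T ` ?S. ennreal (vol_factor c' y) \<partial>lborel) =
      (\<integral>\<^sup>+x\<in>?S. ennreal (\<bar>det (matrix (jac c c' x))\<bar> * vol_factor c' (?T x)) \<partial>lborel)"
  proof (rule nn_integral_change_of_variables)
    show "?S \<in> sets borel" "?T ` ?S \<in> sets borel"
      unfolding im using chart_image_borel_subset c S by auto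
    show "(?T has_derivative jac c c' x) (at x within ?S)" if "x \<in> ?S" for x
      using smooth_on_has_derivative[OF transition_smooth[OF c]] that sub
        overlap_relopen[OF c] relopen_subset has_derivative_subset by (meson subset_eq)
    show "inj_on ?T ?S"
      using transition_inj[OF c] sub inj_on_subset by blast
    show "continuous_on (?T ` ?S) (vol_factor c')"
      unfolding im using vol_factor_continuous[OF c(2)] S continuous_on_subset by (metis image_mono le_inf_iff)
    show "0 \<le> vol_factor c' y" if "y \<in> ?T ` ?S" for y
      using that vol_factor_pos[OF c(2), of y] S unfolding im by force
    have "continuous_on ?S (vol_factor c)"
      using vol_factor_continuous[OF c(1)] S continuous_on_subset by (metis image_mono le_inf_iff)
    then show "continuous_on ?S (\<lambda>x. \<bar>det (matrix (jac c c' x))\<bar> * vol_factor c' (?T x))"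
      using eq continuous_on_cong by force
  qed
  also have "\<dots> = (\<integral>\<^sup>+x\<in>?S. ennreal (vol_factor c x) \<partial>lborel)"
    by (intro nn_integral_cong) (simp add: eq indicator_def)
  finally show ?thesis
    unfolding chart_volume_def im ..
qed

lemma measurable_chart_density:
  assumes c: "c \<in> A" and U: "U \<in> sets borel" "U \<subseteq> chart_image c"
  shows "(\<lambda>x. ennreal (vol_factor c x) * indicator U x) \<in> borel_measurable lborel"
proof -
  have "(\<lambda>x. indicator U x *\<^sub>R vol_factor c x) \<in> borel_measurable borel"
    using vol_factor_continuous[OF c] U
    by (intro borel_measurable_continuous_on_indicator) (auto intro: continuous_on_subset)
  then have "(\<lambda>x. ennreal (indicator U x *\<^sub>R vol_factor c x)) \<in> borel_measurable lborel"
    by simp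
  also have "(\<lambda>x. ennreal (indicator U x *\<^sub>R vol_factor c x)) = (\<lambda>x. ennreal (vol_factor c x) * indicator U x)"
    by (auto simp: indicator_def fun_eq_iff)
  finally show ?thesis .
qed

lemma chart_volume_UN:
  assumes c: "c \<in> A" and S: "range S \<subseteq> sets borel" "disjoint_family S" "\<And>i::nat. S i \<subseteq> fst c"
  shows "chart_volume c (\<Union>i. S i) = (\<Sum>i. chart_volume c (S i))"
proof -
  have ind: "indicator (snd c ` (\<Union>i. S i)) x = (\<Sum>i. indicator (snd c ` S i) x :: ennreal)" for x
  proof -
    have "disjoint_family (\<lambda>i. snd c ` S i)"
      using S(2,3) inj_onD[OF chart_inj[OF c]] unfolding disjoint_family_on_def by fast
    then show ?thesis
      by (simp add: image_UN suminf_indicator)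
  qed
  have m: "snd c ` S i \<in> sets borel" for i
    using chart_image_borel_subset[OF c] S by auto
  have mv: "(\<lambda>x. ennreal (vol_factor c x) * indicator (snd c ` S i) x) \<in> borel_measurable lborel" for i
    using measurable_chart_density[OF c m] S(3) by (simp add: image_mono)
  have "chart_volume c (\<Union>i. S i) = (\<integral>\<^sup>+x. (\<Sum>i. ennreal (vol_factor c x) * indicator (snd c ` S i) x) \<partial>lborel)"
    unfolding chart_volume_def ind by simp
  also have "\<dots> = (\<Sum>i. chart_volume c (S i))"
    unfolding chart_volume_def by (rule nn_integral_suminf[OF mv])
  finally show ?thesis .
qed

abbreviation volume_spec :: "'m measure \<Rightarrow> bool"
  where "volume_spec \<mu> \<equiv> sets \<mu> = sets borel \<and>
     (\<forall>c\<in>A. \<forall>S\<in>sets borel. S \<subseteq> fst c \<longrightarrow> emeasure \<mu> S = chart_volume c S)"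

lemma ex_volume: "\<exists>\<mu>. volume_spec \<mu>"
proof -
  obtain cs P where cs: "\<And>n::nat. cs n \<in> A"
    and P: "\<And>n. P n \<in> sets borel" "\<And>n. P n \<subseteq> fst (cs n)"
    and Pd: "disjoint_family P" "(\<Union>n. P n) = UNIV"
    using chart_partition by metis
  \<comment> \<open>The sum over the pieces is written as an integral over counting measure, so that
    countable additivity is the exchange of a nonnegative sum with an integral.\<close>
  define \<mu>0 where "\<mu>0 S = (\<integral>\<^sup>+n. chart_volume (cs n) (S \<inter> P n) \<partial>count_space UNIV)" for S
  define \<mu> where "\<mu> = measure_of UNIV (sets borel) \<mu>0"
  have sets: "sets \<mu> = sets borel"
    unfolding \<mu>_def by (simp add: sigma_algebra.sigma_sets_eq[OF sets.sigma_algebra_axioms[of borel, simplified]])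
  have "countably_additive (sets borel) \<mu>0"
  proof (rule countably_additiveI)
    fix S :: "nat \<Rightarrow> 'm set" assume S: "range S \<subseteq> sets borel" "disjoint_family S"
    have "chart_volume (cs n) ((\<Union>i. S i) \<inter> P n) = (\<Sum>i. chart_volume (cs n) (S i \<inter> P n))" for n
      unfolding Int_UN_distrib2[of S UNIV, simplified] UN_extend_simps(4)
      by (rule chart_volume_UN[OF cs(1)]) (use S P in \<open>auto intro: disjoint_family_subset[of S] simp: subset_iff\<close>)
    then show "(\<Sum>i. \<mu>0 (S i)) = \<mu>0 (\<Union>i. S i)"
      unfolding \<mu>0_def by (simp add: nn_integral_suminf[symmetric])
  qed
  then have em: "emeasure \<mu> S = \<mu>0 S" if "S \<in> sets borel" for S
    unfolding \<mu>_def using that sets.sigma_algebra_axioms[of borel]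
    by (intro emeasure_measure_of_sigma) (auto simp: positive_def \<mu>0_def chart_volume_def)
  have "emeasure \<mu> S = chart_volume c S" if c: "c \<in> A" and S: "S \<in> sets borel" "S \<subseteq> fst c" for c S
  proof -
    have "chart_volume c S = chart_volume c (\<Union>n. S \<inter> P n)"
      using Pd(2) by (metis Int_UN_distrib Int_UNIV_right)
    also have "\<dots> = (\<Sum>n. chart_volume c (S \<inter> P n))"
      by (rule chart_volume_UN[OF c]) (use S P in \<open>auto intro: disjoint_family_subset[OF Pd(1)]\<close>)
    also have "\<dots> = (\<Sum>n. chart_volume (cs n) (S \<inter> P n))"
      by (intro suminf_cong chart_volume_transition) (use S P cs c in auto)
    finally show ?thesis
      by (simp add: em[OF S(1)] \<mu>0_def nn_integral_count_space_nat)
  qed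
  with sets show ?thesis by blast
qed

lemma volume_spec_unique:
  assumes "volume_spec \<mu>" "volume_spec \<nu>"
  shows "\<mu> = \<nu>"
proof (rule measure_eqI)
  show "sets \<mu> = sets \<nu>" using assms by simp
  fix S assume "S \<in> sets \<mu>"
  then have S: "S \<in> sets borel" using assms by simp
  obtain cs P where cs: "\<And>n::nat. cs n \<in> A"
    and P: "\<And>n. P n \<in> sets borel" "\<And>n. P n \<subseteq> fst (cs n)"
    and Pd: "disjoint_family P" "(\<Union>n. P n) = UNIV"
    using chart_partition by metis
  have "emeasure \<rho> S = (\<Sum>n. chart_volume (cs n) (S \<inter> P n))" if \<rho>: "volume_spec \<rho>" for \<rho>
  proof -
    have "emeasure \<rho> S = emeasure \<rho> (\<Union>n. S \<inter> P n)"
      using Pd(2) by (metis Int_UN_distrib Int_UNIV_right)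
    also have "\<dots> = (\<Sum>n. emeasure \<rho> (S \<inter> P n))"
      by (rule suminf_emeasure[symmetric]) (use S P \<rho> in \<open>auto intro: disjoint_family_subset[OF Pd(1)]\<close>)
    also have "\<dots> = (\<Sum>n. chart_volume (cs n) (S \<inter> P n))"
      using \<rho> S P cs by (intro suminf_cong) (auto simp: le_infI2)
    finally show ?thesis .
  qed
  with assms show "emeasure \<mu> S = emeasure \<nu> S" by simp
qed

abbreviation vol :: "'m measure" where "vol \<equiv> riemannian_volume A g"

text \<open>Resolves the definite description \<open>riemannian_volume\<close>; from here on only
  this specification is used.\<close>

lemma volume: "volume_spec vol"
proof -
  have "\<exists>!\<mu>. volume_spec \<mu>"
    by (rule ex_ex1I[OF ex_volume volume_spec_unique])
  from theI'[OF this] show ?thesis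
    unfolding riemannian_volume_def chart_volume_def .
qed

lemma sets_volume [simp]: "sets vol = sets borel"
  using volume by blast

lemma emeasure_volume: "c \<in> A \<Longrightarrow> S \<in> sets borel \<Longrightarrow> S \<subseteq> fst c \<Longrightarrow> emeasure vol S = chart_volume c S"
  using volume by blast

lemma emeasure_volume_compact:
  assumes c: "c \<in> A" and C: "compact C" "C \<subseteq> fst c"
  shows "emeasure vol C < \<infinity>"
proof -
  have K: "compact (snd c ` C)"
    using C chart_continuous[OF c] by (intro compact_continuous_image) (auto intro: continuous_on_subset)
  have "continuous_on (snd c ` C) (vol_factor c)"
    using C by (intro continuous_on_subset[OF vol_factor_continuous[OF c]]) auto
  then have "compact (vol_factor c ` (snd c ` C))"
    using K by (rule compact_continuous_image)
  then have "bdd_above (vol_factor c ` (snd c ` C))"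
    by (intro bounded_imp_bdd_above compact_imp_bounded)
  then obtain M where M0: "\<forall>y\<in>vol_factor c ` (snd c ` C). y \<le> M"
    unfolding bdd_above_def by (elim exE) (rule that)
  have M: "vol_factor c x \<le> M" if "x \<in> snd c ` C" for x
    using M0[rule_format, OF imageI[OF that]] .
  have "emeasure vol C = chart_volume c C"
    by (rule emeasure_volume[OF c borel_compact[OF C(1)] C(2)])
  also have "\<dots> \<le> (\<integral>\<^sup>+x. ennreal M * indicator (snd c ` C) x \<partial>lborel)"
    unfolding chart_volume_def using M by (intro nn_integral_mono) (auto simp: indicator_def ennreal_leI)
  also have "\<dots> = ennreal M * emeasure lborel (snd c ` C)"
    using K by (intro nn_integral_cmult_indicator) (simp add: borel_compact)
  also have "\<dots> < \<infinity>"
    using emeasure_compact_finite[OF K] by (simp add: ennreal_mult_less_top)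
  finally show ?thesis .
qed

text \<open>This is what turns vanishing almost everywhere into vanishing everywhere for continuous
  densities.\<close>

lemma emeasure_volume_open:
  assumes U: "open U" "U \<noteq> {}"
  shows "emeasure vol U \<noteq> 0"
proof
  assume zero: "emeasure vol U = 0"
  obtain p where "p \<in> U" using U(2) by blast
  obtain c where c: "c \<in> A" "p \<in> fst c" using chart_cover by blast
  let ?V = "U \<inter> fst c"
  have V: "open ?V" "p \<in> ?V" using U chart_open[OF c(1)] c \<open>p \<in> U\<close> by (auto intro: open_Int)
  have "emeasure vol ?V = 0"
    using zero U(1) emeasure_mono[of ?V U vol] by simp
  then have "(\<integral>\<^sup>+x\<in>snd c ` ?V. ennreal (vol_factor c x) \<partial>lborel) = 0"
    using emeasure_volume[OF c(1), of ?V] V(1) by (simp add: chart_volume_def)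
  moreover have m: "snd c ` ?V \<in> sets borel"
    using chart_image_borel_subset[OF c(1)] V(1) by auto
  moreover have "(\<lambda>x. ennreal (vol_factor c x) * indicator (snd c ` ?V) x) \<in> borel_measurable lborel"
    using measurable_chart_density[OF c(1) m] by auto
  ultimately have "AE x in lborel. ennreal (vol_factor c x) * indicator (snd c ` ?V) x = 0"
    using nn_integral_0_iff_AE by blast
  then have ae: "AE x in lborel. x \<notin> snd c ` ?V"
    by eventually_elim (use vol_factor_pos[OF c(1)] in \<open>force simp: indicator_def split: if_splits\<close>)
  obtain r where r: "0 < r" "\<And>y. y \<in> half_space \<Longrightarrow> dist y (snd c p) < r \<Longrightarrow> y \<in> snd c ` ?V"
    using relopen_ball[OF chart_image_relopen[OF c(1) V(1)], of "snd c p"] V(2) by blast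
  have hs: "snd c p \<in> half_space"
    using c relopen_subset[OF chart_relopen] by blast
  \<comment> \<open>At a boundary point no full ball around the point lies in the chart image. A
    ball of radius r/2 whose centre is moved inwards by r/2 does.\<close>
  define y where "y = snd c p + (r/2) *\<^sub>R axis 1 1"
  have "ball y (r/2) \<subseteq> snd c ` ?V"
  proof
    fix z assume z: "z \<in> ball y (r/2)"
    have "\<bar>(z - y) $ 1\<bar> \<le> norm (z - y)" by (rule component_le_norm_cart)
    then have "0 \<le> z $ 1"
      using hs z by (simp add: y_def half_space_def dist_norm norm_minus_commute)
    moreover have "dist z (snd c p) < r"
      using dist_triangle[of z "snd c p" y] z r(1)
      by (simp add: y_def dist_norm norm_minus_commute)
    ultimately show "z \<in> snd c ` ?V" using r(2) by (simp add: half_space_def)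
  qed
  then have "AE x in lborel. x \<notin> ball y (r/2)"
    by (intro eventually_mono[OF ae]) blast
  from emeasure_eq_0_AE[OF this] have "emeasure lborel (ball y (r/2)) = 0"
    by (simp del: mem_ball)
  then show False
    using content_ball_pos[of "r/2" y] r(1) by (simp add: measure_def)
qed

end

section \<open>Coordinate vectors of 1-forms and 2-forms\<close>

lemma sum_permutes_lessThan_2:
  "(\<Sum>\<sigma> | \<sigma> permutes {..<2::nat}. of_int (sign \<sigma>) * F (\<sigma> 0) (\<sigma> 1)) = (F 0 1 - F 1 0 :: real)"
proof -
  have U: "{..<2::nat} = {1, 0}" by auto
  show ?thesis
    unfolding U
    by (subst sum_over_permutations_insert; simp?)+
      (simp add: sign_compose permutation_swap_id sign_swap_id permutes_empty transpose_def)
qed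

lemma sum_permutes_lessThan_3:
  "(\<Sum>\<sigma> | \<sigma> permutes {..<3::nat}. of_int (sign \<sigma>) * F (\<sigma> 0) (\<sigma> 1) (\<sigma> 2)) =
    (F 0 1 2 + F 1 2 0 + F 2 0 1 - F 0 2 1 - F 1 0 2 - F 2 1 0 :: real)"
proof -
  have U: "{..<3::nat} = {2, 1, 0}" by auto
  show ?thesis
    unfolding U
    by (subst sum_over_permutations_insert; simp?)+
      (simp add: sign_compose permutation_swap_id sign_swap_id permutes_empty transpose_def permutation_compose)
qed

abbreviation basis_frame :: "(real^3) list"
  where "basis_frame \<equiv> [axis 1 1, axis 2 1, axis 3 1]"

definition covec :: "'m form \<Rightarrow> 'm chart \<Rightarrow> real^3 \<Rightarrow> real^3"
  where "covec \<omega> c x = (\<chi> i. \<omega> c x [axis i 1])"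

text \<open>The index order 23, 31, 12 is cyclic, as for a cross product, so that no signs appear
  when it is paired with a covector.\<close>

definition bivec :: "'m form \<Rightarrow> 'm chart \<Rightarrow> real^3 \<Rightarrow> real^3"
  where "bivec \<omega> c x = vector [\<omega> c x [axis 2 1, axis 3 1], \<omega> c x [axis 3 1, axis 1 1], \<omega> c x [axis 1 1, axis 2 1]]"

definition form1 :: "'m chart set \<Rightarrow> ('m chart \<Rightarrow> real^3 \<Rightarrow> real^3) \<Rightarrow> 'm form"
  where "form1 A a = (\<lambda>c x vs. if c \<in> A \<and> x \<in> chart_image c \<and> length vs = 1 then a c x \<bullet> vs ! 0 else 0)"

definition form2 :: "'m chart set \<Rightarrow> ('m chart \<Rightarrow> real^3 \<Rightarrow> real^3) \<Rightarrow> 'm form"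
  where "form2 A b = (\<lambda>c x vs. if c \<in> A \<and> x \<in> chart_image c \<and> length vs = 2 then b c x \<bullet> cross3 (vs ! 0) (vs ! 1) else 0)"

lemma length_1_conv: "length vs = 1 \<longleftrightarrow> (\<exists>v. vs = [v])"
  by (auto simp: length_Suc_conv)

lemma length_2_conv: "length vs = 2 \<longleftrightarrow> (\<exists>v w. vs = [v, w])"
  by (auto simp: length_Suc_conv numeral_2_eq_2)

lemma all_length_1: "(\<forall>vs. length vs = 1 \<longrightarrow> P vs) \<longleftrightarrow> (\<forall>v. P [v])"
  by (metis length_1_conv)

lemma all_length_2: "(\<forall>vs. length vs = 2 \<longrightarrow> P vs) \<longleftrightarrow> (\<forall>v w. P [v, w])"
  by (auto simp: length_2_conv)

lemma alternating_multilinear_1: "alternating_multilinear 1 \<alpha> \<longleftrightarrow> linear (\<lambda>v. \<alpha> [v])"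
  unfolding alternating_multilinear_def by (auto simp: length_Suc_conv)

lemma alternating_multilinear_2:
  "alternating_multilinear 2 \<alpha> \<longleftrightarrow>
    (\<forall>w. linear (\<lambda>v. \<alpha> [v, w])) \<and> (\<forall>v. linear (\<lambda>w. \<alpha> [v, w])) \<and> (\<forall>v. \<alpha> [v, v] = 0)" (is "?L \<longleftrightarrow> ?R")
proof
  assume L: ?L
  then have lin: "linear (\<lambda>v. \<alpha> (vs[i := v]))" if "length vs = 2" "i < 2" for vs i
    using that unfolding alternating_multilinear_def by blast
  have alt: "\<alpha> [v, v] = 0" for v
    using L unfolding alternating_multilinear_def by (metis One_nat_def length_Cons list.size(3) nth_Cons_0 nth_Cons_Suc numeral_2_eq_2 lessI zero_less_one)
  show ?R
    using lin[of "[0, w]" 0 for w] lin[of "[v, 0]" 1 for v] alt by simp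
next
  assume ?R
  then show ?L
    unfolding alternating_multilinear_def
    by (auto simp: length_2_conv less_2_cases_iff)
qed

lemma linear_inner_expand:
  fixes f :: "real^3 \<Rightarrow> real"
  assumes "linear f" shows "f v = (\<chi> i. f (axis i 1)) \<bullet> v"
proof -
  have "f v = f (\<Sum>i\<in>UNIV. v $ i *\<^sub>R axis i 1)"
    by (simp add: basis_expansion scalar_mult_eq_scaleR[symmetric])
  also have "\<dots> = (\<Sum>i\<in>UNIV. v $ i * f (axis i 1))"
    by (simp add: linear_sum[OF assms] linear_scale[OF assms])
  finally show ?thesis
    by (simp add: inner_vec_def mult.commute)
qed

lemma alternating_bilinear_cross:
  fixes B :: "real^3 \<Rightarrow> real^3 \<Rightarrow> real"
  assumes l: "\<And>w. linear (\<lambda>v. B v w)" and r: "\<And>v. linear (B v)" and alt: "\<And>v. B v v = 0"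
  shows "B v w = vector [B (axis 2 1) (axis 3 1), B (axis 3 1) (axis 1 1), B (axis 1 1) (axis 2 1)] \<bullet> cross3 v w"
proof -
  have anti: "B u w = - B w u" for u w
  proof -
    \<comment> \<open>Polarisation: an alternating bilinear map is antisymmetric.\<close>
    have "0 = B (u + w) (u + w)" using alt by simp
    also have "\<dots> = B u u + B u w + (B w u + B w w)"
      using linear_add[OF l, of u w "u + w"] linear_add[OF r[of u]] linear_add[OF r[of w]] by simp
    finally show ?thesis using alt by simp
  qed
  have "B v w = (\<Sum>i\<in>UNIV. \<Sum>j\<in>UNIV. B (axis i 1) (axis j 1) * v $ i * w $ j)"
    using linear_inner_expand[OF l, of v w] linear_inner_expand[OF r, of "axis _ 1" w]
    by (simp add: inner_vec_def sum_distrib_right sum_distrib_left mult_ac)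
  then show ?thesis
    using alt anti[of "axis 3 1" "axis 2 1"] anti[of "axis 1 1" "axis 3 1"] anti[of "axis 2 1" "axis 1 1"]
    by (simp add: sum_3 inner_vec_def cross3_def algebra_simps)
qed

context riemannian_3_manifold
begin

lemma overlap_in_chart: "x \<in> overlap c c' \<Longrightarrow> x \<in> chart_image c"
  using overlap_subset by blast

lemma smooth_form1_eq: "smooth_form A tw 1 \<omega> \<Longrightarrow> \<omega> = form1 A (covec \<omega>)"
proof (intro ext)
  fix c x vs assume \<omega>: "smooth_form A tw 1 \<omega>"
  show "\<omega> c x vs = form1 A (covec \<omega>) c x vs"
  proof (cases "c \<in> A \<and> x \<in> chart_image c \<and> length vs = 1")
    case True
    then have "length vs = 1" by simp
    then obtain v where v: "vs = [v]" unfolding length_1_conv ..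
    have "linear (\<lambda>v. \<omega> c x [v])"
      using \<omega> True unfolding smooth_form_def alternating_multilinear_1[symmetric] by blast
    from linear_inner_expand[OF this, of v] True v show ?thesis
      by (simp add: form1_def covec_def)
  next
    case False
    then have "\<omega> c x vs = 0" using \<omega> unfolding smooth_form_def by blast
    then show ?thesis using False by (auto simp: form1_def)
  qed
qed

lemma smooth_form2_eq: "smooth_form A tw 2 \<omega> \<Longrightarrow> \<omega> = form2 A (bivec \<omega>)"
proof (intro ext)
  fix c x vs assume \<omega>: "smooth_form A tw 2 \<omega>"
  show "\<omega> c x vs = form2 A (bivec \<omega>) c x vs"
  proof (cases "c \<in> A \<and> x \<in> chart_image c \<and> length vs = 2")
    case True
    then obtain v w where v: "vs = [v, w]" by (auto simp: length_2_conv)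
    have "alternating_multilinear 2 (\<omega> c x)"
      using \<omega> True unfolding smooth_form_def by blast
    then show ?thesis
      using alternating_bilinear_cross[of "\<lambda>v w. \<omega> c x [v, w]" v w] True v
      unfolding alternating_multilinear_2 by (simp add: form2_def bivec_def)
  next
    case False
    then have "\<omega> c x vs = 0" using \<omega> unfolding smooth_form_def by blast
    then show ?thesis using False by (auto simp: form2_def)
  qed
qed

lemma smooth_form1_apply:
  assumes "smooth_form A tw 1 \<omega>" shows "\<omega> c x [v] = covec \<omega> c x \<bullet> v"
proof (cases "c \<in> A \<and> x \<in> chart_image c")
  case True
  then show ?thesis
    by (subst smooth_form1_eq[OF assms]) (simp add: form1_def)
next
  case False
  then have "\<omega> c x vs = 0" for vs using assms unfolding smooth_form_def by blast
  then show ?thesis by (simp add: covec_def inner_vec_def)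
qed

lemma smooth_form2_apply:
  assumes "smooth_form A tw 2 \<omega>" shows "\<omega> c x [v, w] = bivec \<omega> c x \<bullet> cross3 v w"
proof (cases "c \<in> A \<and> x \<in> chart_image c")
  case True
  then show ?thesis
    by (subst smooth_form2_eq[OF assms]) (simp add: form2_def)
next
  case False
  then have "\<omega> c x vs = 0" for vs using assms unfolding smooth_form_def by blast
  then show ?thesis by (simp add: bivec_def inner_vec_def sum_3)
qed

lemma covec_form1: "c \<in> A \<Longrightarrow> x \<in> chart_image c \<Longrightarrow> covec (form1 A a) c x = a c x"
  by (simp add: covec_def form1_def vec_eq_iff inner_axis)

lemma bivec_form2: "c \<in> A \<Longrightarrow> x \<in> chart_image c \<Longrightarrow> bivec (form2 A b) c x = b c x"
  by (simp add: bivec_def form2_def vec_eq_iff forall_3 cross_basis inner_axis)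

lemma smooth_form_component:
  "smooth_form A tw k \<omega> \<Longrightarrow> c \<in> A \<Longrightarrow> length vs = k \<Longrightarrow> smooth_on (chart_image c) (\<lambda>x. \<omega> c x vs)"
  unfolding smooth_form_def by blast

lemma smooth_form_transition:
  "smooth_form A tw k \<omega> \<Longrightarrow> c \<in> A \<Longrightarrow> c' \<in> A \<Longrightarrow> x \<in> overlap c c' \<Longrightarrow> length vs = k \<Longrightarrow>
    \<omega> c x vs = twist_sign tw (jac c c' x) * \<omega> c' (transition c c' x) (map (jac c c' x) vs)"
  unfolding smooth_form_def by blast

lemma covec_smooth: "smooth_form A tw 1 \<omega> \<Longrightarrow> c \<in> A \<Longrightarrow> smooth_on (chart_image c) (\<lambda>x. covec \<omega> c x $ i)"
  using smooth_form_component[of tw 1 \<omega> c "[axis i 1]"] by (simp add: covec_def)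

lemma bivec_smooth: "smooth_form A tw 2 \<omega> \<Longrightarrow> c \<in> A \<Longrightarrow> smooth_on (chart_image c) (\<lambda>x. bivec \<omega> c x $ i)"
  using smooth_form_component[of tw 2 \<omega> c] exhaust_3[of i] by (auto simp: bivec_def)

lemma covec_transition:
  assumes \<omega>: "smooth_form A tw 1 \<omega>" and c: "c \<in> A" "c' \<in> A" and x: "x \<in> overlap c c'"
  shows "covec \<omega> c x = twist_sign tw (jac c c' x) *\<^sub>R
    (transpose (matrix (jac c c' x)) *v covec \<omega> c' (transition c c' x))"
proof -
  let ?J = "jac c c' x" and ?T = "transition c c' x"
  have x': "x \<in> chart_image c" "?T \<in> chart_image c'"
    by (rule overlap_in_chart[OF x], rule transition_in_chart[OF c(1) x])
  have "\<omega> c x [v] = twist_sign tw ?J * \<omega> c' ?T (map ?J [v])" for v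
    by (rule smooth_form_transition[OF \<omega> c x]) simp
  then have "covec \<omega> c x \<bullet> v = twist_sign tw ?J * (covec \<omega> c' ?T \<bullet> ?J v)" for v
    by (simp add: smooth_form1_apply[OF \<omega>])
  moreover have "covec \<omega> c' ?T \<bullet> ?J v = (transpose (matrix ?J) *v covec \<omega> c' ?T) \<bullet> v" for v
    unfolding jac_matrix[OF c x, of v] inner_commute[of "covec \<omega> c' ?T"] inner_matrix_vector_transpose
    by simp
  ultimately have "covec \<omega> c x \<bullet> v = (twist_sign tw ?J *\<^sub>R (transpose (matrix ?J) *v covec \<omega> c' ?T)) \<bullet> v" for v
    by (simp only: inner_scaleR_left)
  then show ?thesis by (rule iffD1[OF vector_eq_rdot, OF allI])
qed

lemma inner_cross_eq:
  fixes a b :: "real^3"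
  assumes "\<And>v w. a \<bullet> cross3 v w = b \<bullet> cross3 v w" shows "a = b"
  using assms[of "axis 2 1" "axis 3 1"] assms[of "axis 3 1" "axis 1 1"] assms[of "axis 1 1" "axis 2 1"]
  by (simp add: cross_basis inner_axis vec_eq_iff forall_3)

text \<open>A triple product scales by det M when M is applied to all three vectors, and all vectors
  are images under the invertible M. Multiplying by M on the left keeps the law free of inverse
  matrices.\<close>

lemma bivec_transition_iff:
  fixes M :: "real^3^3"
  assumes M: "det M \<noteq> 0"
  shows "(\<forall>v w. b \<bullet> cross3 v w = s * (b' \<bullet> cross3 (M *v v) (M *v w))) \<longleftrightarrow> M *v b = (s * det M) *\<^sub>R b'"
    (is "?L \<longleftrightarrow> ?R")
proof -
  have *: "(M *v b) \<bullet> cross3 (M *v v) (M *v w) = det M * (b \<bullet> cross3 v w)" for v w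
    unfolding inner_matrix_vector_transpose cross_matrix_mult by simp
  show ?thesis
  proof
    assume ?L
    have "(M *v b) \<bullet> cross3 p q = ((s * det M) *\<^sub>R b') \<bullet> cross3 p q" for p q
    proof -
      have "invertible M" using M by (simp add: invertible_det_nz)
      then obtain v w where "p = M *v v" "q = M *v w"
        unfolding invertible_def by (metis matrix_vector_mul_assoc matrix_vector_mul_lid)
      then show ?thesis using * \<open>?L\<close> by simp
    qed
    then show ?R by (rule inner_cross_eq)
  next
    assume ?R
    then have "det M * (b \<bullet> cross3 v w) = det M * (s * (b' \<bullet> cross3 (M *v v) (M *v w)))" for v w
      unfolding *[symmetric] by simp
    then show ?L using M by simp
  qed
qed

lemma bivec_transition:
  assumes \<omega>: "smooth_form A tw 2 \<omega>" and c: "c \<in> A" "c' \<in> A" and x: "x \<in> overlap c c'"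
  shows "matrix (jac c c' x) *v bivec \<omega> c x =
    (twist_sign tw (jac c c' x) * det (matrix (jac c c' x))) *\<^sub>R bivec \<omega> c' (transition c c' x)"
proof -
  let ?J = "jac c c' x" and ?T = "transition c c' x"
  have x': "x \<in> chart_image c" "?T \<in> chart_image c'"
    by (rule overlap_in_chart[OF x], rule transition_in_chart[OF c(1) x])
  have "\<omega> c x [v, w] = twist_sign tw ?J * \<omega> c' ?T (map ?J [v, w])" for v w
    by (rule smooth_form_transition[OF \<omega> c x]) simp
  then have "bivec \<omega> c x \<bullet> cross3 v w = twist_sign tw ?J * (bivec \<omega> c' ?T \<bullet> cross3 (matrix ?J *v v) (matrix ?J *v w))" for v w
    using jac_matrix[OF c x] by (simp add: smooth_form2_apply[OF \<omega>])
  then show ?thesis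
    using bivec_transition_iff[OF jac_det_nonzero[OF c x]] by blast
qed

lemma smooth_on_inner_const:
  assumes "c \<in> A" "\<And>i. smooth_on (chart_image c) (\<lambda>x. a x $ i)"
  shows "smooth_on (chart_image c) (\<lambda>x. a x \<bullet> (v::real^3))"
  unfolding inner_vec_def sum_3
  by (simp, intro smooth_on_add smooth_on_mult smooth_on_const chart_relopen assms)

text \<open>Converse of \<open>covec_transition\<close>: it builds a form from coordinate vectors,
  and is how the star of a 2-form is obtained.\<close>

lemma smooth_form1I:
  assumes s: "\<And>c i. c \<in> A \<Longrightarrow> smooth_on (chart_image c) (\<lambda>x. a c x $ i)"
    and t: "\<And>c c' x. c \<in> A \<Longrightarrow> c' \<in> A \<Longrightarrow> x \<in> overlap c c' \<Longrightarrow>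
      a c x = twist_sign tw (jac c c' x) *\<^sub>R (transpose (matrix (jac c c' x)) *v a c' (transition c c' x))"
  shows "smooth_form A tw 1 (form1 A a)"
  unfolding smooth_form_def all_length_1
proof (intro conjI ballI allI impI)
  fix c x vs assume "c \<notin> A \<or> x \<notin> chart_image c \<or> length (vs :: (real^3) list) \<noteq> 1"
  then show "form1 A a c x vs = 0" by (auto simp: form1_def)
next
  fix c x assume "c \<in> A" "x \<in> chart_image c"
  then show "alternating_multilinear 1 (form1 A a c x)"
    unfolding alternating_multilinear_1 form1_def
    by (simp add: bounded_linear.linear[OF bounded_linear_inner_right])
next
  fix c v assume c: "c \<in> A"
  have "smooth_on (chart_image c) (\<lambda>x. a c x \<bullet> v)"
    by (rule smooth_on_inner_const[OF c s[OF c]])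
  then show "smooth_on (chart_image c) (\<lambda>x. form1 A a c x [v])"
    by (rule iffD1[OF smooth_on_cong[OF chart_relopen[OF c]], rotated]) (simp add: form1_def c)
next
  fix c c' x v assume *: "c \<in> A" "c' \<in> A" "x \<in> overlap c c'"
  have x': "x \<in> chart_image c" "transition c c' x \<in> chart_image c'"
    by (rule overlap_in_chart[OF *(3)], rule transition_in_chart[OF *(1,3)])
  show "form1 A a c x [v] = twist_sign tw (jac c c' x) * form1 A a c' (transition c c' x) (map (jac c c' x) [v])"
    using * x' t[OF *] inner_matrix_vector_transpose[of "matrix (jac c c' x)" v "a c' (transition c c' x)"]
    by (simp add: form1_def jac_matrix[OF *] inner_commute)
qed

text \<open>Converse of \<open>bivec_transition\<close>, used for the star of a 1-form.\<close>

lemma smooth_form2I: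
  assumes s: "\<And>c i. c \<in> A \<Longrightarrow> smooth_on (chart_image c) (\<lambda>x. b c x $ i)"
    and t: "\<And>c c' x. c \<in> A \<Longrightarrow> c' \<in> A \<Longrightarrow> x \<in> overlap c c' \<Longrightarrow>
      matrix (jac c c' x) *v b c x =
        (twist_sign tw (jac c c' x) * det (matrix (jac c c' x))) *\<^sub>R b c' (transition c c' x)"
  shows "smooth_form A tw 2 (form2 A b)"
  unfolding smooth_form_def all_length_2
proof (intro conjI ballI allI impI)
  fix c x vs assume "c \<notin> A \<or> x \<notin> chart_image c \<or> length (vs :: (real^3) list) \<noteq> 2"
  then show "form2 A b c x vs = 0" by (auto simp: form2_def)
next
  fix c x assume "c \<in> A" "x \<in> chart_image c"
  then show "alternating_multilinear 2 (form2 A b c x)"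
    unfolding alternating_multilinear_2 form2_def
    using bilinear_cross unfolding bilinear_def
    by (simp add: linear_compose[unfolded o_def, OF _ bounded_linear.linear[OF bounded_linear_inner_right]])
next
  fix c v w assume c: "c \<in> A"
  have "smooth_on (chart_image c) (\<lambda>x. b c x \<bullet> cross3 v w)"
    by (rule smooth_on_inner_const[OF c s[OF c]])
  then show "smooth_on (chart_image c) (\<lambda>x. form2 A b c x [v, w])"
    by (rule iffD1[OF smooth_on_cong[OF chart_relopen[OF c]], rotated]) (simp add: form2_def c)
next
  fix c c' x v w assume *: "c \<in> A" "c' \<in> A" "x \<in> overlap c c'"
  have x': "x \<in> chart_image c" "transition c c' x \<in> chart_image c'"
    by (rule overlap_in_chart[OF *(3)], rule transition_in_chart[OF *(1,3)])
  show "form2 A b c x [v, w] = twist_sign tw (jac c c' x) * form2 A b c' (transition c c' x) (map (jac c c' x) [v, w])"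
    using * x' t[OF *, folded bivec_transition_iff[OF jac_det_nonzero[OF *]]]
    by (simp add: form2_def jac_matrix[OF *])
qed

section \<open>Wedge products and the density of the pairing\<close>

lemma inner_covec: "covec \<omega> c x \<bullet> b = (\<Sum>i\<in>UNIV. \<omega> c x [axis i 1] * b $ i)"
  by (simp add: covec_def inner_vec_def)

text \<open>Antisymmetry of \<eta> makes the six permutations agree in pairs; the division by
  \<open>fact 1 * fact 2\<close> removes the double count.\<close>

lemma wedge_1_2_basis:
  assumes "smooth_form A tw 2 \<eta>"
  shows "wedge 1 2 \<omega> \<eta> c x basis_frame = covec \<omega> c x \<bullet> bivec \<eta> c x"
proof -
  let ?F = "\<lambda>i j k. \<omega> c x [basis_frame ! i] * \<eta> c x [basis_frame ! j, basis_frame ! k]"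
  have "wedge 1 2 \<omega> \<eta> c x basis_frame = (\<Sum>\<sigma> | \<sigma> permutes {..<3}. of_int (sign \<sigma>) * ?F (\<sigma> 0) (\<sigma> 1) (\<sigma> 2)) / 2"
    unfolding wedge_def by (simp add: upt_rec mult.assoc numeral_3_eq_3 numeral_2_eq_2)
  also have "\<dots> = covec \<omega> c x \<bullet> bivec \<eta> c x"
    unfolding sum_permutes_lessThan_3[of ?F]
    by (simp add: smooth_form2_apply[OF assms] cross_basis inner_axis inner_covec sum_3)
  finally show ?thesis .
qed

text \<open>Moving a 1-form past a 2-form costs no sign, so the density is the same in either order
  and one \<open>pair_density\<close> serves both pairings.\<close>

lemma wedge_2_1_basis:
  assumes "smooth_form A tw 2 \<omega>"
  shows "wedge 2 1 \<omega> \<eta> c x basis_frame = covec \<eta> c x \<bullet> bivec \<omega> c x"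
proof -
  let ?F = "\<lambda>i j k. \<omega> c x [basis_frame ! i, basis_frame ! j] * \<eta> c x [basis_frame ! k]"
  have "wedge 2 1 \<omega> \<eta> c x basis_frame = (\<Sum>\<sigma> | \<sigma> permutes {..<3}. of_int (sign \<sigma>) * ?F (\<sigma> 0) (\<sigma> 1) (\<sigma> 2)) / 2"
    unfolding wedge_def by (simp add: upt_rec mult.assoc numeral_3_eq_3 numeral_2_eq_2)
  also have "\<dots> = covec \<eta> c x \<bullet> bivec \<omega> c x"
    unfolding sum_permutes_lessThan_3[of ?F]
    by (simp add: smooth_form2_apply[OF assms] cross_basis inner_axis inner_covec sum_3)
  finally show ?thesis .
qed

lemma wedge_1_1: "wedge 1 1 \<omega> \<eta> c x [v, w] = \<omega> c x [v] * \<eta> c x [w] - \<omega> c x [w] * \<eta> c x [v]"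
proof -
  let ?F = "\<lambda>i j. \<omega> c x [[v, w] ! i] * \<eta> c x [[v, w] ! j]"
  have "wedge 1 1 \<omega> \<eta> c x [v, w] = (\<Sum>\<sigma> | \<sigma> permutes {..<2}. of_int (sign \<sigma>) * ?F (\<sigma> 0) (\<sigma> 1))"
    unfolding wedge_def by (simp add: upt_rec mult.assoc numeral_2_eq_2)
  then show ?thesis
    unfolding sum_permutes_lessThan_2[of ?F] by simp
qed

text \<open>The density of \<open>\<omega> \<and> \<eta>\<close> for a 1-form \<open>\<omega>\<close> and a 2-form \<open>\<eta>\<close> of opposite twist.\<close>

definition pair_density_in :: "'m chart \<Rightarrow> 'm form \<Rightarrow> 'm form \<Rightarrow> 'm \<Rightarrow> real"
  where "pair_density_in c \<omega> \<eta> p =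
    covec \<omega> c (snd c p) \<bullet> bivec \<eta> c (snd c p) / vol_factor c (snd c p)"

abbreviation pair_density :: "'m form \<Rightarrow> 'm form \<Rightarrow> 'm \<Rightarrow> real"
  where "pair_density \<omega> \<eta> p \<equiv> pair_density_in (chart_at A p) \<omega> \<eta> p"

lemma volume_density_wedge_1_2:
  assumes "smooth_form A tw 2 \<eta>"
  shows "volume_density A g (wedge 1 2 \<omega> \<eta>) = pair_density \<omega> \<eta>"
  unfolding volume_density_def Let_def pair_density_in_def wedge_1_2_basis[OF assms] ..

lemma volume_density_wedge_2_1:
  assumes "smooth_form A tw 2 \<eta>"
  shows "volume_density A g (wedge 2 1 \<eta> \<omega>) = pair_density \<omega> \<eta>"
  unfolding volume_density_def Let_def pair_density_in_def wedge_2_1_basis[OF assms] ..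

lemma pairing_1_2:
  assumes "smooth_form A tw 2 \<eta>"
  shows "poincare_pairing A g 1 \<omega> \<eta> = (\<integral>p. pair_density \<omega> \<eta> p \<partial>vol)"
  using volume_density_wedge_1_2[OF assms, of \<omega>]
  by (simp add: poincare_pairing_def form_integral_def)

lemma pairing_2_1:
  assumes "smooth_form A tw 2 \<eta>"
  shows "poincare_pairing A g 2 \<eta> \<omega> = (\<integral>p. pair_density \<omega> \<eta> p \<partial>vol)"
  using volume_density_wedge_2_1[OF assms, of \<omega>]
  by (simp add: poincare_pairing_def form_integral_def)

lemma twist_sign_mult: "twist_sign tw J * twist_sign (\<not> tw) J = sgn (det (matrix J))"
  by (auto simp: twist_sign_def)

text \<open>The covector transforms by the transposed Jacobian and the bivector inversely up to det
  J, so J cancels in the inner product. The two twist signs multiply to sgn(det J), which leaves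
  |det J|, the factor by which the volume density changes.\<close>

lemma pair_density_chart_independent:
  assumes \<omega>: "smooth_form A tw 1 \<omega>" and \<eta>: "smooth_form A (\<not> tw) 2 \<eta>"
    and c: "c \<in> A" "c' \<in> A" and p: "p \<in> fst c" "p \<in> fst c'"
  shows "pair_density_in c \<omega> \<eta> p = pair_density_in c' \<omega> \<eta> p"
proof -
  define x where "x = snd c p"
  let ?x' = "snd c' p"
  have x: "x \<in> overlap c c'" using p by (auto simp: x_def overlap_def)
  have x': "transition c c' x = ?x'" using p c by (simp add: x_def transition_chart)
  define J where "J = jac c c' x"
  let ?M = "matrix J" and ?s = "twist_sign tw J" and ?s' = "twist_sign (\<not> tw) J"
  have "covec \<omega> c x \<bullet> bivec \<eta> c x = ?s * ((transpose ?M *v covec \<omega> c' ?x') \<bullet> bivec \<eta> c x)"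
    using covec_transition[OF \<omega> c x] by (simp add: x' J_def)
  also have "\<dots> = ?s * (covec \<omega> c' ?x' \<bullet> (?M *v bivec \<eta> c x))"
    using inner_matrix_vector_transpose[of ?M "bivec \<eta> c x" "covec \<omega> c' ?x'"] by (simp add: inner_commute)
  also have "\<dots> = (?s * ?s') * det ?M * (covec \<omega> c' ?x' \<bullet> bivec \<eta> c' ?x')"
    using bivec_transition[OF \<eta> c x] by (simp add: x' J_def)
  also have "\<dots> = \<bar>det ?M\<bar> * (covec \<omega> c' ?x' \<bullet> bivec \<eta> c' ?x')"
    unfolding twist_sign_mult by (simp add: abs_sgn mult.commute)
  finally have "covec \<omega> c x \<bullet> bivec \<eta> c x = \<bar>det ?M\<bar> * (covec \<omega> c' ?x' \<bullet> bivec \<eta> c' ?x')" .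
  moreover have "vol_factor c x = \<bar>det ?M\<bar> * vol_factor c' ?x'"
    using vol_factor_transition[OF c x] by (simp add: x' J_def)
  moreover have "det ?M \<noteq> 0" using jac_det_nonzero[OF c x] by (simp add: J_def)
  ultimately show ?thesis
    unfolding pair_density_in_def x_def by simp
qed

lemma pair_density_eq:
  assumes "smooth_form A tw 1 \<omega>" "smooth_form A (\<not> tw) 2 \<eta>" "c \<in> A" "p \<in> fst c"
  shows "pair_density \<omega> \<eta> p = pair_density_in c \<omega> \<eta> p"
  using pair_density_chart_independent[OF assms(1,2) chart_at(1) assms(3) chart_at(2) assms(4)] .

lemma covec_continuous: "smooth_form A tw 1 \<omega> \<Longrightarrow> c \<in> A \<Longrightarrow> continuous_on (chart_image c) (covec \<omega> c)"
  using smooth_on_continuous[OF covec_smooth] by (intro continuous_on_vec_lambda[of _ "\<lambda>i x. covec \<omega> c x $ i", simplified])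

lemma bivec_continuous: "smooth_form A tw 2 \<omega> \<Longrightarrow> c \<in> A \<Longrightarrow> continuous_on (chart_image c) (bivec \<omega> c)"
  using smooth_on_continuous[OF bivec_smooth] by (intro continuous_on_vec_lambda[of _ "\<lambda>i x. bivec \<omega> c x $ i", simplified])

text \<open>\<open>chart_at\<close> may jump from point to point, so continuity is checked in each
  fixed chart, where independence of the chart gives a single formula.\<close>

lemma pair_density_continuous:
  assumes \<omega>: "smooth_form A tw 1 \<omega>" and \<eta>: "smooth_form A (\<not> tw) 2 \<eta>"
  shows "continuous_on UNIV (pair_density \<omega> \<eta>)"
proof -
  have "continuous_on (fst c) (pair_density \<omega> \<eta>)" if c: "c \<in> A" for c
  proof -
    have "continuous_on (chart_image c) (\<lambda>x. covec \<omega> c x \<bullet> bivec \<eta> c x / vol_factor c x)"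
    proof (intro continuous_on_divide continuous_on_inner ballI)
      show "vol_factor c x \<noteq> 0" if "x \<in> chart_image c" for x
        using vol_factor_pos[OF c that] by simp
    qed (use covec_continuous[OF \<omega> c] bivec_continuous[OF \<eta> c] vol_factor_continuous[OF c] in simp_all)
    from continuous_on_compose2[OF this chart_continuous[OF c] order_refl]
    show ?thesis
      by (rule continuous_on_eq) (subst pair_density_eq[OF \<omega> \<eta> c], simp_all add: pair_density_in_def)
  qed
  then have "continuous_on (\<Union>c\<in>A. fst c) (pair_density \<omega> \<eta>)"
    by (intro continuous_on_open_UN) (auto intro: chart_open)
  then show ?thesis
    using smooth_atlas unfolding smooth_atlas_def by simp
qed

end

section \<open>Exterior derivative and integration by parts\<close>

lemma hderiv_eqI:
  "relopen S \<Longrightarrow> x \<in> S \<Longrightarrow> (f has_derivative f') (at x within half_space) \<Longrightarrow> hderiv f x v = f' v"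
  using hderiv_unique relopen_subset by (metis subsetD)

lemma hderiv_mult:
  fixes f h :: "real^3 \<Rightarrow> real"
  assumes S: "relopen S" "x \<in> S" and f: "smooth_on S f" and h: "smooth_on S h"
  shows "hderiv (\<lambda>y. f y * h y) x v = f x * hderiv h x v + hderiv f x v * h x"
  by (rule hderiv_eqI[OF S]) (rule has_derivative_mult[OF smooth_on_has_derivative[OF f S(2)] smooth_on_has_derivative[OF h S(2)]])

lemma hderiv_diff:
  fixes f h :: "real^3 \<Rightarrow> real"
  assumes S: "relopen S" "x \<in> S" and f: "smooth_on S f" and h: "smooth_on S h"
  shows "hderiv (\<lambda>y. f y - h y) x v = hderiv f x v - hderiv h x v"
  by (rule hderiv_eqI[OF S]) (rule has_derivative_diff[OF smooth_on_has_derivative[OF f S(2)] smooth_on_has_derivative[OF h S(2)]])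

lemma hderiv_linear: "smooth_on S f \<Longrightarrow> x \<in> S \<Longrightarrow> linear (hderiv f x)"
  using smooth_on_differentiable linear_frechet_derivative by blast

context riemannian_3_manifold
begin

lemma smooth_form_outside:
  "smooth_form A tw k \<omega> \<Longrightarrow> c \<notin> A \<or> x \<notin> chart_image c \<or> length vs \<noteq> k \<Longrightarrow> \<omega> c x vs = 0"
  unfolding smooth_form_def by blast

lemma smooth_form_alternating:
  "smooth_form A tw k \<omega> \<Longrightarrow> c \<in> A \<Longrightarrow> x \<in> chart_image c \<Longrightarrow> alternating_multilinear k (\<omega> c x)"
  unfolding smooth_form_def by blast

lemma ext_d_1_apply:
  assumes "c \<in> A" "x \<in> chart_image c"
  shows "ext_d A 1 \<omega> c x [v, w] = hderiv (\<lambda>y. \<omega> c y [w]) x v - hderiv (\<lambda>y. \<omega> c y [v]) x w"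
  using assms by (simp add: ext_d_def)

lemma hderiv_form1:
  assumes \<omega>: "smooth_form A tw 1 \<omega>" and c: "c \<in> A" and x: "x \<in> chart_image c"
  shows "hderiv (\<lambda>y. \<omega> c y [w]) x v = (\<Sum>i\<in>UNIV. hderiv (\<lambda>y. covec \<omega> c y $ i) x v * w $ i)"
proof (rule hderiv_eqI[OF chart_relopen[OF c] x])
  have "((\<lambda>y. \<Sum>i\<in>UNIV. covec \<omega> c y $ i * w $ i) has_derivative
      (\<lambda>v. \<Sum>i\<in>UNIV. hderiv (\<lambda>y. covec \<omega> c y $ i) x v * w $ i)) (at x within half_space)"
    by (intro has_derivative_sum has_derivative_mult_left smooth_on_has_derivative[OF covec_smooth[OF \<omega> c] x])
  then show "((\<lambda>y. \<omega> c y [w]) has_derivative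
      (\<lambda>v. \<Sum>i\<in>UNIV. hderiv (\<lambda>y. covec \<omega> c y $ i) x v * w $ i)) (at x within half_space)"
    by (simp add: smooth_form1_apply[OF \<omega>] inner_vec_def)
qed

text \<open>The sign has to be constant near x to be pulled out of the derivative of a twisted form.
  \<open>N\<close> consists of the points where det J has the same sign as at x.\<close>

lemma twist_sign_locally_constant:
  assumes c: "c \<in> A" "c' \<in> A" and x: "x \<in> overlap c c'"
  obtains N where "relopen N" "x \<in> N" "N \<subseteq> overlap c c'"
    "\<And>y. y \<in> N \<Longrightarrow> twist_sign tw (jac c c' y) = twist_sign tw (jac c c' x)"
proof -
  let ?d = "\<lambda>y. det (matrix (jac c c' y))"
  define N where "N = overlap c c' \<inter> (\<lambda>y. ?d x * ?d y) -` {0<..}"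
  have "continuous_on (overlap c c') (\<lambda>y. jac c c' y (axis j 1) $ i)" for i j
    by (intro smooth_on_continuous smooth_on_bounded_linear[OF overlap_relopen[OF c] bounded_linear_vec_nth]
        smooth_on_hderiv transition_smooth c)
  then have m: "continuous_on (overlap c c') (\<lambda>y. matrix (jac c c' y) $ i $ j)" for i j
    by (simp add: matrix_def)
  have "continuous_on (overlap c c') (\<lambda>y. ?d x * ?d y)"
    unfolding det_3 by (intro continuous_on_mult continuous_on_add continuous_on_diff m continuous_on_const)
  then have "openin (top_of_set (overlap c c')) N"
    unfolding N_def by (rule continuous_openin_preimage_gen) simp
  then have N: "relopen N"
    using openin_trans[OF _ overlap_relopen[OF c]] by blast
  have pos: "0 < ?d x * ?d x"
    using jac_det_nonzero[OF c x] not_real_square_gt_zero by blast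
  have sgn: "twist_sign tw (jac c c' y) = twist_sign tw (jac c c' x)" if "y \<in> N" for y
    using that unfolding N_def twist_sign_def by (auto simp: zero_less_mult_iff)
  show ?thesis
    by (rule that[OF N _ _ sgn]) (use x pos in \<open>auto simp: N_def\<close>)
qed

lemma jac_component:
  assumes c: "c \<in> A" "c' \<in> A" and y: "y \<in> overlap c c'"
  shows "jac c c' y w $ i = hderiv (\<lambda>z. transition c c' z $ i) y w"
  by (rule hderiv_eqI[OF overlap_relopen[OF c] y, symmetric])
    (rule bounded_linear.has_derivative[OF bounded_linear_vec_nth smooth_on_has_derivative[OF transition_smooth[OF c] y]])

lemma transition_component_smooth:
  assumes c: "c \<in> A" "c' \<in> A"
  shows "smooth_on (overlap c c') (\<lambda>z. transition c c' z $ i)"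
  by (rule smooth_on_bounded_linear[OF overlap_relopen[OF c] bounded_linear_vec_nth transition_smooth[OF c]])

text \<open>Second derivatives of the transition map appear here and cancel, by symmetry, in the
  antisymmetrisation that forms the exterior derivative.\<close>

lemma hderiv_form1_transition:
  assumes \<omega>: "smooth_form A tw 1 \<omega>" and c: "c \<in> A" "c' \<in> A" and x: "x \<in> overlap c c'"
  shows "hderiv (\<lambda>y. \<omega> c y [w]) x v = twist_sign tw (jac c c' x) *
    (\<Sum>i\<in>UNIV. covec \<omega> c' (transition c c' x) $ i * hderiv (\<lambda>y. hderiv (\<lambda>z. transition c c' z $ i) y w) x v +
       hderiv (\<lambda>y. covec \<omega> c' y $ i) (transition c c' x) (jac c c' x v) * jac c c' x w $ i)"
proof -
  let ?T = "transition c c'"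
  obtain N where N: "relopen N" "x \<in> N" "N \<subseteq> overlap c c'"
    "\<And>y. y \<in> N \<Longrightarrow> twist_sign tw (jac c c' y) = twist_sign tw (jac c c' x)"
    using twist_sign_locally_constant[OF c x] by metis
  let ?s = "twist_sign tw (jac c c' x)"
  let ?F = "\<lambda>y. ?s * (\<Sum>i\<in>UNIV. covec \<omega> c' (?T y) $ i * hderiv (\<lambda>z. ?T z $ i) y w)"
  have "\<omega> c y [w] = ?F y" if "y \<in> N" for y
  proof -
    have y: "y \<in> overlap c c'" using that N by blast
    have "\<omega> c y [w] = ?s * \<omega> c' (?T y) [jac c c' y w]"
      using smooth_form_transition[OF \<omega> c y, of "[w]"] N(4)[OF that] by simp
    then show ?thesis
      by (simp add: smooth_form1_apply[OF \<omega>] inner_vec_def jac_component[OF c y])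
  qed
  then have "hderiv (\<lambda>y. \<omega> c y [w]) x = hderiv ?F x"
    by (rule hderiv_cong[OF N(1,2)])
  then have "hderiv (\<lambda>y. \<omega> c y [w]) x v = hderiv ?F x v"
    by simp
  also have "\<dots> = ?s *
    (\<Sum>i\<in>UNIV. covec \<omega> c' (?T x) $ i * hderiv (\<lambda>y. hderiv (\<lambda>z. ?T z $ i) y w) x v +
       hderiv (\<lambda>y. covec \<omega> c' y $ i) (?T x) (jac c c' x v) * hderiv (\<lambda>z. ?T z $ i) x w)"
  proof (rule hderiv_eqI[OF N(1,2)], intro has_derivative_mult_right has_derivative_sum has_derivative_mult)
    fix i
    show "((\<lambda>y. hderiv (\<lambda>z. ?T z $ i) y w) has_derivative hderiv (\<lambda>y. hderiv (\<lambda>z. ?T z $ i) y w) x) (at x within half_space)"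
      by (rule smooth_on_has_derivative[OF smooth_on_hderiv[OF transition_component_smooth[OF c]] x])
    have "?T ` overlap c c' \<subseteq> half_space"
      using transition_in_chart[OF c(1)] relopen_subset[OF chart_relopen[OF c(2)]] by blast
    then show "((\<lambda>y. covec \<omega> c' (?T y) $ i) has_derivative
        (\<lambda>v. hderiv (\<lambda>y. covec \<omega> c' y $ i) (?T x) (jac c c' x v))) (at x within half_space)"
      by (rule has_derivative_compose_relopen[OF overlap_relopen[OF c] x _
            smooth_on_has_derivative[OF transition_smooth[OF c] x]
            smooth_on_has_derivative[OF covec_smooth[OF \<omega> c(2)] transition_in_chart[OF c(1) x]]])
  qed
  finally show ?thesis
    by (simp add: jac_component[OF c x])
qed

lemma ext_d_1_smooth_form:
  assumes \<omega>: "smooth_form A tw 1 \<omega>"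
  shows "smooth_form A tw 2 (ext_d A 1 \<omega>)"
  unfolding smooth_form_def all_length_2
proof (intro conjI ballI allI impI)
  fix c x vs assume "c \<notin> A \<or> x \<notin> chart_image c \<or> length (vs :: (real^3) list) \<noteq> 2"
  then show "ext_d A 1 \<omega> c x vs = 0" unfolding ext_d_def by (auto simp: numeral_2_eq_2)
next
  fix c x assume c: "c \<in> A" and x: "x \<in> chart_image c"
  let ?D = "\<lambda>i. hderiv (\<lambda>y. covec \<omega> c y $ i) x"
  have D: "linear (?D i)" for i
    by (rule hderiv_linear[OF covec_smooth[OF \<omega> c] x])
  have "linear (\<lambda>v. (\<Sum>i\<in>UNIV. ?D i v * w $ i) - (\<Sum>i\<in>UNIV. ?D i w * v $ i))"
    "linear (\<lambda>v. (\<Sum>i\<in>UNIV. ?D i w * v $ i) - (\<Sum>i\<in>UNIV. ?D i v * w $ i))" for w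
    by (rule linearI; simp add: linear_add[OF D] linear_scale[OF D] sum.distrib sum_distrib_left algebra_simps)+
  then show "alternating_multilinear 2 (ext_d A 1 \<omega> c x)"
    unfolding alternating_multilinear_2 ext_d_1_apply[OF c x] hderiv_form1[OF \<omega> c x] by simp
next
  fix c v w assume c: "c \<in> A"
  have "smooth_on (chart_image c) (\<lambda>x. hderiv (\<lambda>y. \<omega> c y [w]) x v - hderiv (\<lambda>y. \<omega> c y [v]) x w)"
    by (intro smooth_on_diff smooth_on_hderiv chart_relopen c smooth_form_component[OF \<omega> c]) simp_all
  then show "smooth_on (chart_image c) (\<lambda>x. ext_d A 1 \<omega> c x [v, w])"
    by (rule iffD1[OF smooth_on_cong[OF chart_relopen[OF c]], rotated]) (rule ext_d_1_apply[OF c, symmetric])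
next
  fix c c' x v w assume c: "c \<in> A" "c' \<in> A" and x: "x \<in> overlap c c'"
  let ?T = "transition c c'" and ?J = "jac c c' x"
  have sym: "hderiv (\<lambda>y. hderiv (\<lambda>z. ?T z $ i) y w) x v = hderiv (\<lambda>y. hderiv (\<lambda>z. ?T z $ i) y v) x w" for i
    by (rule hderiv_symmetric[OF overlap_relopen[OF c] transition_component_smooth[OF c] x])
  show "ext_d A 1 \<omega> c x [v, w] = twist_sign tw ?J * ext_d A 1 \<omega> c' (?T x) (map ?J [v, w])"
    unfolding list.map ext_d_1_apply[OF c(1) overlap_in_chart[OF x]]
      ext_d_1_apply[OF c(2) transition_in_chart[OF c(1) x]]
      hderiv_form1[OF \<omega> c(2) transition_in_chart[OF c(1) x]]
      hderiv_form1_transition[OF \<omega> c x] sym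
    by (simp add: sum.distrib algebra_simps)
qed

text \<open>Graded Leibniz rule, with a minus sign because \<omega> has odd degree. It is stated on
  the coordinate frame because \<open>volume_density\<close> evaluates a 3-form there and nowhere
  else.\<close>

lemma ext_d_wedge_1_1:
  assumes \<omega>: "smooth_form A tw 1 \<omega>" and \<eta>: "smooth_form A tw' 1 \<eta>"
  shows "ext_d A 2 (wedge 1 1 \<omega> \<eta>) c x basis_frame =
    wedge 2 1 (ext_d A 1 \<omega>) \<eta> c x basis_frame - wedge 1 2 \<omega> (ext_d A 1 \<eta>) c x basis_frame"
proof (cases "c \<in> A \<and> x \<in> chart_image c")
  case True
  then have c: "c \<in> A" and x: "x \<in> chart_image c" by auto
  note S = chart_relopen[OF c]
  have sm: "smooth_on (chart_image c) (\<lambda>x. \<omega> c x [v])" "smooth_on (chart_image c) (\<lambda>x. \<eta> c x [v])" for v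
    using smooth_form_component[OF \<omega> c] smooth_form_component[OF \<eta> c] by simp_all
  have d: "ext_d A 2 (wedge 1 1 \<omega> \<eta>) c x basis_frame =
      hderiv (\<lambda>y. wedge 1 1 \<omega> \<eta> c y [axis 2 1, axis 3 1]) x (axis 1 1)
      - hderiv (\<lambda>y. wedge 1 1 \<omega> \<eta> c y [axis 1 1, axis 3 1]) x (axis 2 1)
      + hderiv (\<lambda>y. wedge 1 1 \<omega> \<eta> c y [axis 1 1, axis 2 1]) x (axis 3 1)"
    using c x by (simp add: ext_d_def numeral_2_eq_2)
  have "hderiv (\<lambda>y. wedge 1 1 \<omega> \<eta> c y [v, w]) x u =
      \<omega> c x [v] * hderiv (\<lambda>y. \<eta> c y [w]) x u + hderiv (\<lambda>y. \<omega> c y [v]) x u * \<eta> c x [w]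
      - (\<omega> c x [w] * hderiv (\<lambda>y. \<eta> c y [v]) x u + hderiv (\<lambda>y. \<omega> c y [w]) x u * \<eta> c x [v])" for u v w
    unfolding wedge_1_1 hderiv_diff[OF S x smooth_on_mult[OF S sm(1) sm(2)] smooth_on_mult[OF S sm(1) sm(2)]]
      hderiv_mult[OF S x sm(1) sm(2)] ..
  then show ?thesis
    unfolding wedge_2_1_basis[OF ext_d_1_smooth_form[OF \<omega>]] wedge_1_2_basis[OF ext_d_1_smooth_form[OF \<eta>]] d
    by (simp only: inner_covec sum_3 bivec_def ext_d_1_apply[OF c x] vector_3) (simp add: algebra_simps)
next
  case False
  then have "\<omega> c x vs = 0" "\<eta> c x vs = 0" for vs
    using smooth_form_outside[OF \<omega>] smooth_form_outside[OF \<eta>] by blast+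
  then show ?thesis using False by (auto simp: ext_d_def wedge_def)
qed

lemma volume_density_diff:
  assumes "\<And>c x. \<alpha> c x basis_frame = \<beta> c x basis_frame - \<gamma> c x basis_frame"
  shows "volume_density A g \<alpha> p = volume_density A g \<beta> p - volume_density A g \<gamma> p"
  unfolding volume_density_def Let_def assms by (rule diff_divide_distrib)

text \<open>The integral of d(\<omega> \<and> \<eta>) vanishes by hypothesis, in place of Stokes'
  theorem. Both terms of the Leibniz rule are integrable, so this integral splits into their
  difference.\<close>

lemma integration_by_parts:
  assumes \<omega>: "smooth_form A tw 1 \<omega>" and \<eta>: "smooth_form A tw' 1 \<eta>"
    and int: "form_integrable A g (wedge 2 1 (ext_d A 1 \<omega>) \<eta>)" "form_integrable A g (wedge 1 2 \<omega> (ext_d A 1 \<eta>))"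
    and "form_integral A g (ext_d A 2 (wedge 1 1 \<omega> \<eta>)) = 0"
  shows "poincare_pairing A g 2 (ext_d A 1 \<omega>) \<eta> = poincare_pairing A g 1 \<omega> (ext_d A 1 \<eta>)"
proof -
  have "form_integral A g (ext_d A 2 (wedge 1 1 \<omega> \<eta>)) =
    form_integral A g (wedge 2 1 (ext_d A 1 \<omega>) \<eta>) - form_integral A g (wedge 1 2 \<omega> (ext_d A 1 \<eta>))"
  proof -
    have "volume_density A g (ext_d A 2 (wedge 1 1 \<omega> \<eta>)) =
      (\<lambda>p. volume_density A g (wedge 2 1 (ext_d A 1 \<omega>) \<eta>) p - volume_density A g (wedge 1 2 \<omega> (ext_d A 1 \<eta>)) p)"
      by (intro ext volume_density_diff ext_d_wedge_1_1[OF \<omega> \<eta>])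
    then show ?thesis
      unfolding form_integral_def
      using Bochner_Integration.integral_diff[OF int[unfolded form_integrable_def]] by (simp only:)
  qed
  with assms show ?thesis by (simp add: poincare_pairing_def)
qed

end

section \<open>Bump functions\<close>

lemma smooth_on_id: "relopen S \<Longrightarrow> smooth_on S (\<lambda>x. x)"
proof -
  assume S: "relopen S"
  have "C_k_on n S (\<lambda>x. x)" for n
  proof (cases n)
    case (Suc m)
    show ?thesis
      unfolding Suc by (rule C_k_on_Suc_intro[OF S has_derivative_ident C_k_on_const[OF S]])
  qed simp
  then show ?thesis unfolding smooth_on_def by blast
qed

text \<open>Test forms with interior support see only points off the bounding plane. A boundary
  point is a limit of such points, reached by moving along the first axis.\<close>

lemma zero_on_interior_imp_zero:
  fixes a :: "real^3 \<Rightarrow> 'b::real_normed_vector"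
  assumes S: "relopen S" and cont: "continuous_on S a"
    and zero: "\<And>y. y \<in> S \<Longrightarrow> 0 < y $ 1 \<Longrightarrow> a y = 0" and x: "x \<in> S"
  shows "a x = 0"
proof (rule ccontr)
  assume "a x \<noteq> 0"
  then have "0 < norm (a x)" by simp
  then obtain r where r: "0 < r" "\<And>y. y \<in> S \<Longrightarrow> dist y x < r \<Longrightarrow> dist (a y) (a x) < norm (a x)"
    using cont x unfolding continuous_on_iff by meson
  obtain r0 where r0: "0 < r0" "\<And>y. y \<in> half_space \<Longrightarrow> dist y x < r0 \<Longrightarrow> y \<in> S"
    using relopen_ball[OF S x] by blast
  define y where "y = x + (min r r0 / 2) *\<^sub>R axis 1 1"
  have "x \<in> half_space" using x relopen_subset[OF S] by blast
  then have y1: "0 < y $ 1" using r(1) r0(1) by (simp add: y_def half_space_def)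
  have d: "dist y x = min r r0 / 2" using r(1) r0(1) by (simp add: y_def dist_norm)
  have "y \<in> S" by (rule r0(2)) (use y1 d r(1) r0(1) in \<open>auto simp: half_space_def\<close>)
  moreover have "dist y x < r" using d r(1) r0(1) by simp
  ultimately have "dist 0 (a x) < norm (a x)" using r(2) zero y1 by metis
  then show False by simp
qed

context riemannian_3_manifold
begin

section \<open>Multiplication of forms by smooth functions\<close>

definition smooth_function :: "('m \<Rightarrow> real) \<Rightarrow> bool"
  where "smooth_function f \<longleftrightarrow> (\<forall>c\<in>A. smooth_on (chart_image c) (\<lambda>x. f (pt c x)))"

definition scale_form :: "('m \<Rightarrow> real) \<Rightarrow> 'm form \<Rightarrow> 'm form"
  where "scale_form f \<omega> = (\<lambda>c x vs. f (pt c x) * \<omega> c x vs)"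

lemma pt_transition:
  assumes "c \<in> A" "c' \<in> A" "x \<in> overlap c c'"
  shows "pt c' (transition c c' x) = pt c x"
proof -
  obtain p where "p \<in> fst c" "p \<in> fst c'" "x = snd c p"
    using assms(3) unfolding overlap_def by blast
  then show ?thesis using assms by (simp add: transition_chart)
qed

lemma smooth_form_scale:
  assumes f: "smooth_function f" and \<omega>: "smooth_form A tw k \<omega>"
  shows "smooth_form A tw k (scale_form f \<omega>)"
  unfolding smooth_form_def scale_form_def
proof (intro conjI ballI allI impI)
  fix c x vs assume "c \<notin> A \<or> x \<notin> chart_image c \<or> length (vs :: (real^3) list) \<noteq> k"
  then have "\<omega> c x vs = 0" by (rule smooth_form_outside[OF \<omega>])
  then show "f (pt c x) * \<omega> c x vs = 0" by simp
next
  fix c x assume "c \<in> A" "x \<in> chart_image c"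
  then have "alternating_multilinear k (\<omega> c x)" by (rule smooth_form_alternating[OF \<omega>])
  then show "alternating_multilinear k (\<lambda>vs. f (pt c x) * \<omega> c x vs)"
    unfolding alternating_multilinear_def
    by (simp add: linear_compose[unfolded o_def, OF _ linear_times])
next
  fix c vs assume c: "c \<in> A" and l: "length (vs :: (real^3) list) = k"
  show "smooth_on (chart_image c) (\<lambda>x. f (pt c x) * \<omega> c x vs)"
    using f c unfolding smooth_function_def
    by (intro smooth_on_mult[OF chart_relopen[OF c] _ smooth_form_component[OF \<omega> c l]]) blast
next
  fix c c' x vs assume c: "c \<in> A" "c' \<in> A" "x \<in> overlap c c'" and l: "length (vs :: (real^3) list) = k"
  show "f (pt c x) * \<omega> c x vs = twist_sign tw (jac c c' x) *
      (f (pt c' (transition c c' x)) * \<omega> c' (transition c c' x) (map (jac c c' x) vs))"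
    using smooth_form_transition[OF \<omega> c l] pt_transition[OF c] by simp
qed

lemma smooth_function_continuous:
  assumes "smooth_function f" shows "continuous_on UNIV f"
proof -
  have "continuous_on (fst c) f" if c: "c \<in> A" for c
  proof -
    have "continuous_on (chart_image c) (\<lambda>x. f (pt c x))"
      using assms c smooth_on_continuous unfolding smooth_function_def by blast
    from continuous_on_compose2[OF this chart_continuous[OF c] order_refl]
    show ?thesis
      by (rule continuous_on_eq) (simp add: c)
  qed
  then have "continuous_on (\<Union>c\<in>A. fst c) f"
    by (intro continuous_on_open_UN) (auto intro: chart_open)
  then show ?thesis
    using smooth_atlas unfolding smooth_atlas_def by simp
qed

lemma ex_bump_function:
  assumes "p \<in> manifold_interior A"
  obtains f c C where "smooth_function f" "c \<in> A" "compact C" "C \<subseteq> fst c" "C \<subseteq> manifold_interior A"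
    "\<And>q. 0 \<le> f q" "0 < f p" "\<And>q. q \<notin> C \<Longrightarrow> f q = 0"
proof -
  obtain c where c: "c \<in> A" and p: "p \<in> fst c" "0 < snd c p $ 1"
    using assms unfolding manifold_interior_def by blast
  define x0 where "x0 = snd c p"
  have x0: "x0 \<in> chart_image c" "0 < x0 $ 1" using p by (auto simp: x0_def)
  obtain r0 where r0: "0 < r0" "\<And>y. y \<in> half_space \<Longrightarrow> dist y x0 < r0 \<Longrightarrow> y \<in> chart_image c"
    using relopen_ball[OF chart_relopen[OF c] x0(1)] by blast
  \<comment> \<open>Half the smaller bound: the closed ball of radius r lies in the chart image and
    off the bounding plane.\<close>
  define r where "r = min r0 (x0 $ 1) / 2"
  have r: "0 < r" "r < r0" "r < x0 $ 1" using r0(1) x0(2) by (auto simp: r_def)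
  have ball1: "0 < y $ 1" if "y \<in> cball x0 r" for y
  proof -
    have "\<bar>(x0 - y) $ 1\<bar> \<le> dist x0 y" unfolding dist_norm by (rule component_le_norm_cart)
    then show ?thesis using that r(3) by simp
  qed
  have ball: "y \<in> chart_image c" if "y \<in> cball x0 r" for y
    by (rule r0(2)) (use ball1[OF that] that r(2) in \<open>auto simp: half_space_def dist_commute\<close>)
  \<comment> \<open>\<open>flat_exp 1\<close> is exp(-1/t) for t > 0. The squared distance is a
    polynomial in the coordinates, which avoids the singularity of the norm at the centre.\<close>
  define \<phi> where "\<phi> x = flat_exp 1 (r\<^sup>2 - (x - x0) \<bullet> (x - x0))" for x :: "real^3"
  have \<phi>_smooth: "smooth_on S \<phi>" if "relopen S" for S
  proof -
    have d: "smooth_on S (\<lambda>x. x $ i - x0 $ i)" for i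
      by (intro smooth_on_diff smooth_on_const that smooth_on_bounded_linear[OF that bounded_linear_vec_nth] smooth_on_id)
    then have "smooth_on S (\<lambda>x. r\<^sup>2 - ((x $ 1 - x0 $ 1) * (x $ 1 - x0 $ 1) + (x $ 2 - x0 $ 2) * (x $ 2 - x0 $ 2) + (x $ 3 - x0 $ 3) * (x $ 3 - x0 $ 3)))"
      by (intro d smooth_on_diff smooth_on_const smooth_on_add smooth_on_mult that)
    from smooth_on_flat_exp[OF that this, of 1] show ?thesis
      by (simp add: \<phi>_def[abs_def] inner_vec_def sum_3)
  qed
  have \<phi>0: "0 \<le> \<phi> x" for x by (simp add: \<phi>_def flat_exp_def)
  have \<phi>x0: "0 < \<phi> x0" using r(1) by (simp add: \<phi>_def flat_exp_def)
  have \<phi>_out: "\<phi> x = 0" if "x \<notin> cball x0 r" for x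
  proof -
    have "r < norm (x - x0)" using that by (simp add: dist_norm norm_minus_commute)
    then have "r\<^sup>2 \<le> (norm (x - x0))\<^sup>2" using r(1) by (intro power_mono) auto
    then show ?thesis by (simp add: \<phi>_def flat_exp_def power2_norm_eq_inner)
  qed
  define C where "C = pt c ` cball x0 r"
  define f where "f q = (if q \<in> fst c then \<phi> (snd c q) else 0)" for q
  have C: "compact C"
    unfolding C_def
    by (intro compact_continuous_image continuous_on_subset[OF pt_continuous[OF c]] compact_cball subsetI ball)
  have Cc: "C \<subseteq> fst c" unfolding C_def using pt_in_chart[OF c ball] by blast
  have Ci: "C \<subseteq> manifold_interior A"
  proof
    fix q assume "q \<in> C"
    then obtain y where y: "y \<in> cball x0 r" "q = pt c y" unfolding C_def by blast
    then have "q \<in> fst c" "0 < snd c q $ 1"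
      using pt_in_chart[OF c ball[OF y(1)]] chart_pt[OF c ball[OF y(1)]] ball1[OF y(1)] by simp_all
    then show "q \<in> manifold_interior A" using c unfolding manifold_interior_def by blast
  qed
  have out: "f q = 0" if "q \<notin> C" for q
  proof (cases "q \<in> fst c")
    case True
    then have "snd c q \<notin> cball x0 r"
      using that pt_chart[OF c True] unfolding C_def by (metis image_eqI)
    then show ?thesis using True \<phi>_out by (simp add: f_def)
  qed (simp add: f_def)
  have "smooth_on (chart_image c') (\<lambda>x. f (pt c' x))" if c': "c' \<in> A" for c'
  proof -
    let ?U = "fst c' - C"
    \<comment> \<open>Compact sets are closed in a Hausdorff space. So the overlap with
      \<open>c\<close>, where \<open>f\<close> is \<phi> in coordinates, and the part outside
      \<open>C\<close>, where \<open>f\<close> is 0, are relatively open pieces that cover the image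
      of \<open>c'\<close>.\<close>
    have "closed C" using C by (rule compact_imp_closed)
    then have U: "relopen (snd c' ` ?U)"
      using chart_open[OF c'] by (intro chart_image_relopen[OF c'] open_Diff) auto
    have im: "chart_image c' = overlap c' c \<union> snd c' ` ?U"
      unfolding overlap_def using Cc by blast
    have sT: "smooth_on (overlap c' c) (\<lambda>x. \<phi> (transition c' c x))"
      by (rule smooth_on_compose[OF overlap_relopen[OF c' c] chart_relopen[OF c] transition_smooth[OF c' c] _ \<phi>_smooth[OF chart_relopen[OF c]]])
        (use transition_in_chart[OF c'] in blast)
    have eqT: "\<phi> (transition c' c x) = f (pt c' x)" if "x \<in> overlap c' c" for x
      using that c' by (auto simp: overlap_def f_def transition_chart)
    have 1: "smooth_on (overlap c' c) (\<lambda>x. f (pt c' x))"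
      by (rule iffD1[OF smooth_on_cong[OF overlap_relopen[OF c' c] eqT] sT])
    have eq0: "0 = f (pt c' x)" if "x \<in> snd c' ` ?U" for x
      using that c' out by auto
    have 2: "smooth_on (snd c' ` ?U) (\<lambda>x. f (pt c' x))"
      by (rule iffD1[OF smooth_on_cong[OF U eq0] smooth_on_const[OF U]])
    show ?thesis
      unfolding im by (rule smooth_on_Un[OF overlap_relopen[OF c' c] U 1 2])
  qed
  then have "smooth_function f" unfolding smooth_function_def by blast
  then show ?thesis
    by (rule that[OF _ c C Cc Ci]) (use \<phi>0 \<phi>x0 p out in \<open>auto simp: f_def x0_def\<close>)
qed

lemma measurable_volume_continuous:
  fixes F :: "'m \<Rightarrow> real"
  assumes "continuous_on UNIV F" shows "F \<in> borel_measurable vol"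
  using borel_measurable_continuous_onI[OF assms] measurable_cong_sets[OF sets_volume refl] by blast

text \<open>A continuous function is bounded on \<open>C\<close>, and \<open>C\<close> has finite
  volume because it lies in one chart.\<close>

lemma integrable_compact_support:
  fixes F :: "'m \<Rightarrow> real"
  assumes F: "continuous_on UNIV F"
    and C: "c \<in> A" "compact C" "C \<subseteq> fst c" "\<And>p. p \<notin> C \<Longrightarrow> F p = 0"
  shows "integrable vol F"
proof -
  have "compact (F ` C)"
    by (intro compact_continuous_image continuous_on_subset[OF F] C) simp
  then have "bounded (F ` C)" by (rule compact_imp_bounded)
  then obtain B where B0: "\<forall>y\<in>F ` C. norm y \<le> B"
    unfolding bounded_iff by (elim exE) (rule that)
  have B: "norm (F q) \<le> B" if "q \<in> C" for q using B0[rule_format, OF imageI[OF that]] .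
  show ?thesis
  proof (rule integrableI_bounded_set[where A = C and B = B])
    show "C \<in> sets vol" using borel_compact[OF C(2)] by simp
    show "emeasure vol C < \<infinity>" by (rule emeasure_volume_compact[OF C(1-3)])
  qed (use measurable_volume_continuous[OF F] B C(4) in auto)
qed

text \<open>The set where \<open>F\<close> is nonzero is open by continuity and null by the
  integral, and nonempty open sets have positive volume.\<close>

lemma integral_nonneg_compact_support_zero:
  assumes F: "continuous_on UNIV F" "\<And>p. 0 \<le> F p"
    and C: "c \<in> A" "compact C" "C \<subseteq> fst c" "\<And>p. p \<notin> C \<Longrightarrow> F p = 0"
    and zero: "(\<integral>p. F p \<partial>vol) = 0"
  shows "F p = (0::real)"
proof (rule ccontr)
  assume "F p \<noteq> 0"
  then have p: "0 < F p" using F(2)[of p] by simp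
  note int = integrable_compact_support[OF F(1) C]
  have "AE q in vol. F q = 0"
    using integral_nonneg_eq_0_iff_AE[OF int] F(2) zero by simp
  then have "emeasure vol {q \<in> space vol. F q \<noteq> 0} = 0"
    by (intro emeasure_eq_0_AE) simp
  moreover have "{q \<in> space vol. F q \<noteq> 0} = F -` (- {0})"
    using sets_eq_imp_space_eq[OF sets_volume] by auto
  moreover have "open (F -` (- {0}))"
    using F(1) by (intro open_vimage) auto
  moreover have "p \<in> F -` (- {0})"
    using p by simp
  then have "F -` (- {0}) \<noteq> {}"
    by blast
  ultimately show False
    using emeasure_volume_open[of "F -` (- {0})"] by simp
qed

lemma compact_interior_support_scale:
  assumes "compact C" "C \<subseteq> manifold_interior A" "\<And>q. q \<notin> C \<Longrightarrow> f q = 0"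
  shows "compact_interior_support A (scale_form f \<omega>)"
  unfolding compact_interior_support_def scale_form_def
  using assms by (intro exI[of _ C]) (auto simp: pt_chart[simplified])

lemma covec_scale: "covec (scale_form f \<omega>) c x = f (pt c x) *\<^sub>R covec \<omega> c x"
  by (simp add: covec_def scale_form_def vec_eq_iff)

lemma bivec_scale: "bivec (scale_form f \<omega>) c x = f (pt c x) *\<^sub>R bivec \<omega> c x"
  by (simp add: bivec_def scale_form_def vec_eq_iff forall_3)

lemma pair_density_scale_left: "pair_density (scale_form f \<omega>) \<eta> p = f p * pair_density \<omega> \<eta> p"
  using chart_at[of p] by (simp add: pair_density_in_def covec_scale)

lemma pair_density_scale_right: "pair_density \<omega> (scale_form f \<eta>) p = f p * pair_density \<omega> \<eta> p"
  using chart_at[of p] by (simp add: pair_density_in_def bivec_scale)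

text \<open>The density need not be integrable, so it is tested against bump functions;
  nonnegativity then makes it vanish where the bump is positive.\<close>

lemma pair_density_zero_interior:
  assumes \<omega>: "smooth_form A tw 1 \<omega>" and \<eta>: "smooth_form A (\<not> tw) 2 \<eta>"
    and nonneg: "\<And>p. 0 \<le> pair_density \<omega> \<eta> p"
    and zero: "\<And>f c C. smooth_function f \<Longrightarrow> c \<in> A \<Longrightarrow> compact C \<Longrightarrow> C \<subseteq> fst c \<Longrightarrow> C \<subseteq> manifold_interior A \<Longrightarrow>
      (\<And>q. q \<notin> C \<Longrightarrow> f q = 0) \<Longrightarrow> (\<integral>p. f p * pair_density \<omega> \<eta> p \<partial>vol) = 0"
    and p: "p \<in> manifold_interior A"
  shows "pair_density \<omega> \<eta> p = 0"
proof -
  obtain f c C where f: "smooth_function f" "c \<in> A" "compact C" "C \<subseteq> fst c" "C \<subseteq> manifold_interior A"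
    "\<And>q. 0 \<le> f q" "0 < f p" "\<And>q. q \<notin> C \<Longrightarrow> f q = 0"
    using ex_bump_function[OF p] by blast
  have "f p * pair_density \<omega> \<eta> p = 0"
    by (rule integral_nonneg_compact_support_zero[OF _ _ f(2-4)])
      (use f nonneg zero[OF f(1-5,8)] smooth_function_continuous[OF f(1)] pair_density_continuous[OF \<omega> \<eta>]
        in \<open>auto intro: continuous_on_mult\<close>)
  then show ?thesis using f(7) by simp
qed

end

section \<open>Hodge star and nondegeneracy of the pairing\<close>

text \<open>The adjugate of G applied to a. Being polynomial in the entries, it makes the smoothness
  of the star evident, which \<open>matrix_inv\<close> would not.\<close>

definition adj3 :: "real^3^3 \<Rightarrow> real^3 \<Rightarrow> real^3"
  where "adj3 G a = a $ 1 *\<^sub>R cross3 (G $ 2) (G $ 3) + a $ 2 *\<^sub>R cross3 (G $ 3) (G $ 1) + a $ 3 *\<^sub>R cross3 (G $ 1) (G $ 2)"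

lemma matrix_mult_adj3: "G *v adj3 G a = det G *\<^sub>R a"
  by (simp add: adj3_def matrix_vector_mult_def cross3_def det_3 sum_3 vec_eq_iff forall_3 algebra_simps)

lemma matrix_inv_works:
  fixes G :: "real^'n^'n"
  assumes "det G \<noteq> 0"
  shows "G ** matrix_inv G = mat 1" "matrix_inv G ** G = mat 1"
proof -
  have "\<exists>G'. G ** G' = mat 1 \<and> G' ** G = mat 1"
    using assms invertible_det_nz unfolding invertible_def by blast
  then show "G ** matrix_inv G = mat 1" "matrix_inv G ** G = mat 1"
    unfolding matrix_inv_def by (metis (mono_tags, lifting) someI_ex)+
qed

lemma sum_lists_length_1: "(\<Sum>is | length is = 1. f is) = (\<Sum>i\<in>UNIV. f [i])" for f :: "'a::finite list \<Rightarrow> real"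
  by (rule sum.reindex_bij_witness[where i = "\<lambda>i. [i]" and j = hd]) (auto simp: length_Suc_conv)

lemma sum_lists_length_2: "(\<Sum>is | length is = 2. f is) = (\<Sum>i\<in>UNIV. \<Sum>j\<in>UNIV. f [i, j])" for f :: "'a::finite list \<Rightarrow> real"
proof -
  have "(\<Sum>is | length is = 2. f is) = (\<Sum>(i, j)\<in>UNIV \<times> UNIV. f [i, j])"
    by (rule sum.reindex_bij_witness[where i = "\<lambda>(i, j). [i, j]" and j = "\<lambda>is. (is ! 0, is ! 1)"])
      (auto simp: length_Suc_conv numeral_2_eq_2)
  then show ?thesis by (simp add: sum.cartesian_product)
qed

lemma covector_inner_1:
  "covector_inner 1 G \<alpha> \<beta> = (\<chi> i. \<alpha> [axis i 1]) \<bullet> (matrix_inv G *v (\<chi> i. \<beta> [axis i 1]))"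
  unfolding covector_inner_def sum_lists_length_1
  by (simp add: inner_vec_def matrix_vector_mult_def sum_distrib_left mult_ac)

lemma matrix_vector_axis: "(N *v axis i 1) $ k = (N :: real^'n^'m) $ k $ i"
  by (simp add: matrix_vector_mult_basis column_def)

text \<open>With N the inverse of G, the identity N^T (N v \<times> N w) = det N (v \<times> w)
  turns the double contraction with N into G / det G acting on bivectors. The sum over ordered index
  pairs counts each pair twice, which \<open>fact 2\<close> corrects.\<close>

lemma covector_inner_2:
  fixes G :: "real^3^3"
  assumes sym: "transpose G = G" and G: "det G \<noteq> 0"
    and \<alpha>: "\<And>v w. \<alpha> [v, w] = a \<bullet> cross3 v w" and \<beta>: "\<And>v w. \<beta> [v, w] = b \<bullet> cross3 v w"
  shows "covector_inner 2 G \<alpha> \<beta> = a \<bullet> (G *v b) / det G"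
proof -
  let ?N = "matrix_inv G" and ?e = "\<lambda>i. axis i (1::real) :: real^3"
  note inv = matrix_inv_works[OF G]
  have detN: "det ?N = 1 / det G"
    using arg_cong[OF inv(1), of det] G by (simp add: det_mul field_simps)
  have "transpose ?N ** G = mat 1"
    using arg_cong[OF inv(1), of transpose] by (simp add: matrix_transpose_mul sym transpose_mat)
  then have symN: "transpose ?N = ?N"
    by (metis inv(1) matrix_mul_assoc matrix_mul_lid matrix_mul_rid)
  have row: "?N $ i = ?N *v ?e i" for i
    using symN by (simp add: vec_eq_iff matrix_vector_axis transpose_def)
  have inner: "(\<Sum>j\<in>UNIV. \<Sum>l\<in>UNIV. ?N $ i $ j * ?N $ k $ l * (b \<bullet> cross3 (?e j) (?e l))) =
      ((G *v b) \<bullet> cross3 (?e i) (?e k)) / det G" for i k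
  proof -
    have "(\<Sum>j\<in>UNIV. \<Sum>l\<in>UNIV. ?N $ i $ j * ?N $ k $ l * (b \<bullet> cross3 (?e j) (?e l))) = b \<bullet> cross3 (?N $ i) (?N $ k)"
      by (simp add: sum_3 cross_basis inner_vec_def cross3_def axis_def algebra_simps)
    also have "\<dots> = b \<bullet> cross3 (?N *v ?e i) (?N *v ?e k)"
      by (simp only: row)
    also have "b \<bullet> cross3 (?N *v ?e i) (?N *v ?e k) = (G *v b) \<bullet> (?N *v cross3 (?N *v ?e i) (?N *v ?e k))"
    proof -
      have "(G *v b) \<bullet> (?N *v u) = b \<bullet> u" for u
        unfolding inner_matrix_vector_transpose sym matrix_vector_mul_assoc inv(1) by simp
      then show ?thesis by simp
    qed
    also have "?N *v cross3 (?N *v ?e i) (?N *v ?e k) = det ?N *\<^sub>R cross3 (?e i) (?e k)"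
      using cross_matrix_mult[of ?N] unfolding symN by simp
    finally show ?thesis by (simp add: detN)
  qed
  have "covector_inner 2 G \<alpha> \<beta> = (\<Sum>i\<in>UNIV. \<Sum>k\<in>UNIV. (a \<bullet> cross3 (?e i) (?e k)) *
      (\<Sum>j\<in>UNIV. \<Sum>l\<in>UNIV. ?N $ i $ j * ?N $ k $ l * (b \<bullet> cross3 (?e j) (?e l)))) / 2"
    unfolding covector_inner_def sum_lists_length_2
    by (simp add: \<alpha> \<beta> numeral_2_eq_2 prod.lessThan_Suc sum_distrib_left mult_ac lessThan_Suc)
  also have "\<dots> = a \<bullet> (G *v b) / det G"
  proof -
    have "a \<bullet> (G *v b) = a $ 1 * (G *v b) $ 1 + a $ 2 * (G *v b) $ 2 + a $ 3 * (G *v b) $ 3"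
      by (simp add: inner_vec_def sum_3)
    then show ?thesis
      unfolding inner by (simp add: sum_3 cross_basis inner_axis add_divide_distrib)
  qed
  finally show ?thesis .
qed

text \<open>Here \<open>r\<close> is \<open>sqrt (det G)\<close>, so \<open>rel\<close> says that \<open>a\<close> and \<open>b\<close> are related by the Hodge star: the
  transformation law of a 1-form and that of its star, of opposite twist, are equivalent.\<close>

lemma star_relation_transition:
  fixes G G' M :: "real^3^3"
  assumes G: "G = transpose M ** G' ** M" and M: "det M \<noteq> 0" and G': "det G' \<noteq> 0"
    and r: "r = \<bar>det M\<bar> * r'" "0 < r'"
    and rel: "G *v b = r *\<^sub>R a" "G' *v b' = r' *\<^sub>R a'"
  shows "a = s *\<^sub>R (transpose M *v a') \<longleftrightarrow> M *v b = (s * sgn (det M) * det M) *\<^sub>R b'"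
proof -
  have inj: "u = v" if "N *v u = N *v v" "det N \<noteq> 0" for N :: "real^3^3" and u v
    using that by (metis inj_matrix_vector_mult invertible_det_nz injD)
  have Mt: "det (transpose M) \<noteq> 0" using M by simp
  have sgn: "sgn (det M) * det M = \<bar>det M\<bar>" by (simp add: abs_sgn mult.commute)
  have r0: "r \<noteq> 0" using r M by simp
  have "a = s *\<^sub>R (transpose M *v a') \<longleftrightarrow> r *\<^sub>R a = r *\<^sub>R (s *\<^sub>R (transpose M *v a'))"
    using r0 by (metis scaleR_cancel_left)
  also have "r *\<^sub>R a = transpose M *v (G' *v (M *v b))"
    unfolding rel(1)[symmetric] G by (simp only: matrix_vector_mul_assoc matrix_mul_assoc)
  also have "r *\<^sub>R (s *\<^sub>R (transpose M *v a')) = transpose M *v (G' *v ((s * \<bar>det M\<bar>) *\<^sub>R b'))"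
    unfolding matrix_vector_mult_scaleR rel(2) r(1) by (simp add: mult_ac)
  also have "transpose M *v (G' *v (M *v b)) = transpose M *v (G' *v ((s * \<bar>det M\<bar>) *\<^sub>R b')) \<longleftrightarrow> M *v b = (s * \<bar>det M\<bar>) *\<^sub>R b'"
    using inj[OF _ Mt] inj[OF _ G'] by metis
  finally show ?thesis unfolding mult.assoc sgn .
qed

context riemannian_3_manifold
begin

text \<open>Solution of the star relation for b: the inverse of g is its adjugate over det g, and
  det g is the square of \<open>vol_factor\<close>.\<close>

definition star1 :: "'m form \<Rightarrow> 'm form"
  where "star1 \<omega> = form2 A (\<lambda>c x. (1 / vol_factor c x) *\<^sub>R adj3 (g c x) (covec \<omega> c x))"

definition star2 :: "'m form \<Rightarrow> 'm form"
  where "star2 \<eta> = form1 A (\<lambda>c x. (1 / vol_factor c x) *\<^sub>R (g c x *v bivec \<eta> c x))"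

lemma star1_relation:
  assumes "c \<in> A" "x \<in> chart_image c"
  shows "g c x *v bivec (star1 \<omega>) c x = vol_factor c x *\<^sub>R covec \<omega> c x"
proof -
  have "det (g c x) / vol_factor c x = vol_factor c x"
    using metric_det_pos[OF assms] by (simp add: real_div_sqrt)
  then show ?thesis
    by (simp add: star1_def bivec_form2[OF assms] matrix_vector_mult_scaleR matrix_mult_adj3)
qed

lemma star2_relation:
  assumes "c \<in> A" "x \<in> chart_image c"
  shows "g c x *v bivec \<eta> c x = vol_factor c x *\<^sub>R covec (star2 \<eta>) c x"
  using vol_factor_pos[OF assms] by (simp add: star2_def covec_form1[OF assms])

lemma inverse_vol_factor_smooth:
  assumes c: "c \<in> A" shows "smooth_on (chart_image c) (\<lambda>x. 1 / vol_factor c x)"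
proof -
  have "smooth_on (chart_image c) (\<lambda>x. det (g c x) powr (-1/2))"
    by (rule smooth_on_powr[OF chart_relopen[OF c] metric_det_smooth[OF c] metric_det_pos[OF c]])
  moreover have "det (g c x) powr (-1/2) = 1 / vol_factor c x" if "x \<in> chart_image c" for x
    using metric_det_pos[OF c that] by (simp add: powr_minus_divide powr_half_sqrt)
  ultimately show ?thesis
    using smooth_on_cong[OF chart_relopen[OF c], of "\<lambda>x. det (g c x) powr (-1/2)" "\<lambda>x. 1 / vol_factor c x"] by simp
qed

lemma twist_sign_not: "twist_sign (\<not> tw) J = twist_sign tw J * sgn (det (matrix J))" if "det (matrix J) \<noteq> 0"
  using that by (auto simp: twist_sign_def sgn_if)

lemma star1_smooth_form:
  assumes \<omega>: "smooth_form A tw 1 \<omega>"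
  shows "smooth_form A (\<not> tw) 2 (star1 \<omega>)"
  unfolding star1_def
proof (rule smooth_form2I)
  fix c i assume c: "c \<in> A"
  note sm = smooth_on_add smooth_on_diff smooth_on_mult metric_component_smooth covec_smooth[OF \<omega> c] chart_relopen c
  show "smooth_on (chart_image c) (\<lambda>x. ((1 / vol_factor c x) *\<^sub>R adj3 (g c x) (covec \<omega> c x)) $ i)"
    unfolding vector_scaleR_component adj3_def vector_add_component real_scaleR_def
    by (intro inverse_vol_factor_smooth sm, insert exhaust_3[of i])
      (auto simp: cross3_def intro!: sm)
next
  fix c c' x assume c: "c \<in> A" "c' \<in> A" "x \<in> overlap c c'"
  note x = overlap_in_chart[OF c(3)] transition_in_chart[OF c(1,3)]
  have *: "twist_sign (\<not> tw) (jac c c' x) = twist_sign tw (jac c c' x) * sgn (det (matrix (jac c c' x)))"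
    by (rule twist_sign_not[OF jac_det_nonzero[OF c]])
  have "matrix (jac c c' x) *v bivec (star1 \<omega>) c x = (twist_sign (\<not> tw) (jac c c' x) * det (matrix (jac c c' x))) *\<^sub>R
      bivec (star1 \<omega>) c' (transition c c' x)"
    \<comment> \<open>Rewrites the goal into the transformation law of \<omega> itself;
      \<open>*\<close> has split off the additional sign carried by the opposite twist.\<close>
    unfolding * star_relation_transition[OF metric_transition_matrix[OF c] jac_det_nonzero[OF c]
      metric_det_pos[OF c(2) x(2), THEN less_imp_neq, symmetric] vol_factor_transition[OF c]
      vol_factor_pos[OF c(2) x(2)] star1_relation[OF c(1) x(1)] star1_relation[OF c(2) x(2)], symmetric]
    by (rule covec_transition[OF \<omega> c])
  then show "matrix (jac c c' x) *v ((1 / vol_factor c x) *\<^sub>R adj3 (g c x) (covec \<omega> c x)) =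
      (twist_sign (\<not> tw) (jac c c' x) * det (matrix (jac c c' x))) *\<^sub>R
      ((1 / vol_factor c' (transition c c' x)) *\<^sub>R adj3 (g c' (transition c c' x)) (covec \<omega> c' (transition c c' x)))"
    by (simp only: star1_def bivec_form2[OF c(1) x(1)] bivec_form2[OF c(2) x(2)])
qed

lemma star2_smooth_form:
  assumes \<eta>: "smooth_form A tw 2 \<eta>"
  shows "smooth_form A (\<not> tw) 1 (star2 \<eta>)"
  unfolding star2_def
proof (rule smooth_form1I)
  fix c i assume c: "c \<in> A"
  note sm = smooth_on_add smooth_on_mult metric_component_smooth bivec_smooth[OF \<eta> c] chart_relopen c
  show "smooth_on (chart_image c) (\<lambda>x. ((1 / vol_factor c x) *\<^sub>R (g c x *v bivec \<eta> c x)) $ i)"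
    by (simp add: matrix_vector_mult_def sum_3 del: times_divide_eq_left)
      (intro inverse_vol_factor_smooth sm)
next
  fix c c' x assume c: "c \<in> A" "c' \<in> A" "x \<in> overlap c c'"
  note x = overlap_in_chart[OF c(3)] transition_in_chart[OF c(1,3)]
  have *: "twist_sign tw (jac c c' x) = twist_sign (\<not> tw) (jac c c' x) * sgn (det (matrix (jac c c' x)))"
    using twist_sign_not[OF jac_det_nonzero[OF c], of "\<not> tw"] by simp
  have "covec (star2 \<eta>) c x = twist_sign (\<not> tw) (jac c c' x) *\<^sub>R
      (transpose (matrix (jac c c' x)) *v covec (star2 \<eta>) c' (transition c c' x))"
    unfolding star_relation_transition[OF metric_transition_matrix[OF c] jac_det_nonzero[OF c]
      metric_det_pos[OF c(2) x(2), THEN less_imp_neq, symmetric] vol_factor_transition[OF c]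
      vol_factor_pos[OF c(2) x(2)] star2_relation[OF c(1) x(1)] star2_relation[OF c(2) x(2)]]
    using bivec_transition[OF \<eta> c] unfolding * .
  then show "(1 / vol_factor c x) *\<^sub>R (g c x *v bivec \<eta> c x) = twist_sign (\<not> tw) (jac c c' x) *\<^sub>R
      (transpose (matrix (jac c c' x)) *v ((1 / vol_factor c' (transition c c' x)) *\<^sub>R (g c' (transition c c' x) *v bivec \<eta> c' (transition c c' x))))"
    by (simp only: star2_def covec_form1[OF c(1) x(1)] covec_form1[OF c(2) x(2)])
qed

text \<open>If b is the star of a, the inverse metric applied to a is b / sqrt(det g). The two
  integrands therefore agree at every point, and no integrability is involved.\<close>

lemma l2_inner_1:
  assumes \<omega>: "smooth_form A tw 1 \<omega>" and \<eta>: "smooth_form A tw' 1 \<eta>"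
  shows "l2_inner A g 1 \<omega> \<eta> = poincare_pairing A g 1 \<omega> (star1 \<eta>)"
proof -
  have "form_inner A g 1 \<omega> \<eta> p = pair_density \<omega> (star1 \<eta>) p" for p
  proof -
    define c x where "c = chart_at A p" and "x = snd c p"
    have c: "c \<in> A" "x \<in> chart_image c" using chart_at[of p] by (auto simp: c_def x_def)
    have "matrix_inv (g c x) *v covec \<eta> c x = (1 / vol_factor c x) *\<^sub>R bivec (star1 \<eta>) c x"
    proof -
      have "(1 / vol_factor c x) *\<^sub>R bivec (star1 \<eta>) c x = (1 / vol_factor c x) *\<^sub>R (matrix_inv (g c x) *v (g c x *v bivec (star1 \<eta>) c x))"
        using matrix_inv_works(2)[of "g c x"] metric_det_pos[OF c] by (simp add: matrix_vector_mul_assoc)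
      also have "\<dots> = matrix_inv (g c x) *v covec \<eta> c x"
        unfolding star1_relation[OF c] matrix_vector_mult_scaleR using vol_factor_pos[OF c] by simp
      finally show ?thesis by simp
    qed
    then have "covector_inner 1 (g c x) (\<omega> c x) (\<eta> c x) = covec \<omega> c x \<bullet> bivec (star1 \<eta>) c x / vol_factor c x"
      unfolding covector_inner_1 by (simp add: covec_def)
    then show ?thesis
      by (simp add: form_inner_def pair_density_in_def c_def x_def Let_def)
  qed
  then show ?thesis
    using pairing_1_2[OF star1_smooth_form[OF \<eta>], of \<omega>] by (simp add: l2_inner_def)
qed

text \<open>The star relation replaces g times a bivector by sqrt(det g) times a covector; together
  with the factor 1 / det g from the contraction this is again pointwise the density of the
  pairing.\<close>

lemma l2_inner_2:
  assumes \<omega>: "smooth_form A tw 2 \<omega>" and \<eta>: "smooth_form A tw' 2 \<eta>"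
  shows "l2_inner A g 2 \<omega> \<eta> = poincare_pairing A g 2 \<omega> (star2 \<eta>)"
proof -
  have "form_inner A g 2 \<omega> \<eta> p = pair_density (star2 \<eta>) \<omega> p" for p
  proof -
    define c x where "c = chart_at A p" and "x = snd c p"
    have c: "c \<in> A" "x \<in> chart_image c" using chart_at[of p] by (auto simp: c_def x_def)
    have "covector_inner 2 (g c x) (\<omega> c x) (\<eta> c x) = bivec \<omega> c x \<bullet> (g c x *v bivec \<eta> c x) / det (g c x)"
      by (rule covector_inner_2)
        (use metric_symmetric[OF c] metric_det_pos[OF c] smooth_form2_apply[OF \<omega>] smooth_form2_apply[OF \<eta>] in auto)
    also have "\<dots> = (vol_factor c x / det (g c x)) * (covec (star2 \<eta>) c x \<bullet> bivec \<omega> c x)"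
      unfolding star2_relation[OF c] by (simp add: inner_commute)
    also have "vol_factor c x / det (g c x) = 1 / vol_factor c x"
      using metric_det_pos[OF c] by (simp add: field_simps)
    finally show ?thesis
      by (simp add: form_inner_def pair_density_in_def c_def x_def Let_def)
  qed
  then show ?thesis
    using pairing_2_1[OF \<omega>, of "star2 \<eta>"] by (simp add: l2_inner_def)
qed

section \<open>Forms are determined by their pairings\<close>

lemma smooth_form_combination:
  assumes \<alpha>: "smooth_form A tw k \<alpha>" and \<beta>: "smooth_form A tw k \<beta>"
  shows "smooth_form A tw k (\<lambda>c x vs. u * \<alpha> c x vs + v * \<beta> c x vs)"
  unfolding smooth_form_def
proof (intro conjI ballI allI impI)
  fix c x vs assume "c \<notin> A \<or> x \<notin> chart_image c \<or> length (vs :: (real^3) list) \<noteq> k"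
  then show "u * \<alpha> c x vs + v * \<beta> c x vs = 0"
    using smooth_form_outside[OF \<alpha>] smooth_form_outside[OF \<beta>] by simp
next
  fix c x assume "c \<in> A" "x \<in> chart_image c"
  then have "alternating_multilinear k (\<alpha> c x)" "alternating_multilinear k (\<beta> c x)"
    by (rule smooth_form_alternating[OF \<alpha>], rule smooth_form_alternating[OF \<beta>])
  then show "alternating_multilinear k (\<lambda>vs. u * \<alpha> c x vs + v * \<beta> c x vs)"
    unfolding alternating_multilinear_def
    by (simp add: linear_compose_add linear_compose[unfolded o_def, OF _ linear_times])
next
  fix c vs assume c: "c \<in> A" and l: "length (vs :: (real^3) list) = k"
  show "smooth_on (chart_image c) (\<lambda>x. u * \<alpha> c x vs + v * \<beta> c x vs)"
    by (intro smooth_on_add smooth_on_mult smooth_on_const chart_relopen[OF c]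
        smooth_form_component[OF \<alpha> c l] smooth_form_component[OF \<beta> c l])
next
  fix c c' x vs assume c: "c \<in> A" "c' \<in> A" "x \<in> overlap c c'" and l: "length (vs :: (real^3) list) = k"
  show "u * \<alpha> c x vs + v * \<beta> c x vs = twist_sign tw (jac c c' x) *
      (u * \<alpha> c' (transition c c' x) (map (jac c c' x) vs) + v * \<beta> c' (transition c c' x) (map (jac c c' x) vs))"
    using smooth_form_transition[OF \<alpha> c l] smooth_form_transition[OF \<beta> c l] by (simp add: algebra_simps)
qed

lemma metric_quadratic:
  assumes "c \<in> A" "x \<in> chart_image c"
  shows "0 \<le> v \<bullet> (g c x *v v)" "v \<bullet> (g c x *v v) = 0 \<Longrightarrow> v = 0"
  using metric_positive[OF assms, of v] by (cases "v = 0"; simp)+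

lemma zero_in_interior_charts:
  assumes c: "c \<in> A" and cont: "continuous_on (chart_image c) a"
    and zero: "\<And>p. p \<in> manifold_interior A \<Longrightarrow> p \<in> fst c \<Longrightarrow> a (snd c p) = (0::real^3)"
    and x: "x \<in> chart_image c"
  shows "a x = 0"
proof (rule zero_on_interior_imp_zero[OF chart_relopen[OF c] cont _ x])
  fix y assume y: "y \<in> chart_image c" "0 < y $ 1"
  note p = pt_in_chart[OF c y(1)] chart_pt[OF c y(1)]
  have "pt c y \<in> manifold_interior A"
    unfolding manifold_interior_def using p y(2) c by auto
  from zero[OF this p(1)] show "a y = 0" using p(2) by simp
qed

lemma smooth_form1_eqI:
  assumes \<alpha>: "smooth_form A tw 1 \<alpha>" and \<beta>: "smooth_form A tw 1 \<beta>"
    and eq: "\<And>c x. c \<in> A \<Longrightarrow> x \<in> chart_image c \<Longrightarrow> covec \<alpha> c x = covec \<beta> c x"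
  shows "\<alpha> = \<beta>"
proof -
  have "form1 A (covec \<alpha>) = form1 A (covec \<beta>)"
    unfolding form1_def using eq by (intro ext) simp
  then show ?thesis
    using smooth_form1_eq[OF \<alpha>] smooth_form1_eq[OF \<beta>] by simp
qed

lemma smooth_form2_eqI:
  assumes \<alpha>: "smooth_form A tw 2 \<alpha>" and \<beta>: "smooth_form A tw 2 \<beta>"
    and eq: "\<And>c x. c \<in> A \<Longrightarrow> x \<in> chart_image c \<Longrightarrow> bivec \<alpha> c x = bivec \<beta> c x"
  shows "\<alpha> = \<beta>"
proof -
  have "form2 A (bivec \<alpha>) = form2 A (bivec \<beta>)"
    unfolding form2_def using eq by (intro ext) simp
  then show ?thesis
    using smooth_form2_eq[OF \<alpha>] smooth_form2_eq[OF \<beta>] by simp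
qed

lemma two_form_determined_by_pairing:
  assumes \<alpha>: "smooth_form A (\<not> tw) 2 \<alpha>" and \<beta>: "smooth_form A (\<not> tw) 2 \<beta>"
    and eq: "\<And>\<omega>. smooth_form A tw 1 \<omega> \<Longrightarrow> compact_interior_support A \<omega> \<Longrightarrow>
      (\<integral>p. pair_density \<omega> \<alpha> p \<partial>vol) = (\<integral>p. pair_density \<omega> \<beta> p \<partial>vol)"
  shows "\<alpha> = \<beta>"
proof -
  define \<theta> where "\<theta> = (\<lambda>c x vs. 1 * \<alpha> c x vs + (- 1) * \<beta> c x vs)"
  have \<theta>: "smooth_form A (\<not> tw) 2 \<theta>"
    unfolding \<theta>_def by (rule smooth_form_combination[OF \<alpha> \<beta>])
  have \<theta>_bivec: "bivec \<theta> c x = bivec \<alpha> c x - bivec \<beta> c x" for c x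
    by (simp add: \<theta>_def bivec_def vec_eq_iff forall_3)
  define \<omega> where "\<omega> = star2 \<theta>"
  have \<omega>: "smooth_form A tw 1 \<omega>"
    using star2_smooth_form[OF \<theta>] by (simp add: \<omega>_def)
  have density: "pair_density_in c \<omega> \<theta> p = bivec \<theta> c (snd c p) \<bullet> (g c (snd c p) *v bivec \<theta> c (snd c p)) / det (g c (snd c p))"
    if c: "c \<in> A" "p \<in> fst c" for c p
  proof -
    have x: "snd c p \<in> chart_image c" using c by blast
    show ?thesis
      unfolding star2_relation[OF c(1) x, of \<theta>, folded \<omega>_def] pair_density_in_def
      using metric_det_pos[OF c(1) x] by (simp add: inner_commute field_simps)
  qed
  have nonneg: "0 \<le> pair_density \<omega> \<theta> p" for p
  proof -
    have x: "snd (chart_at A p) p \<in> chart_image (chart_at A p)" using chart_at by blast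
    show ?thesis
      unfolding density[OF chart_at]
      using metric_quadratic(1)[OF chart_at(1) x] metric_det_pos[OF chart_at(1) x] by simp
  qed
  have zero: "pair_density \<omega> \<theta> p = 0" if p: "p \<in> manifold_interior A" for p
  proof (rule pair_density_zero_interior[OF \<omega> \<theta> nonneg _ p])
    fix f c C assume f: "smooth_function f" and c: "c \<in> A" and C: "compact C" "C \<subseteq> fst c" "C \<subseteq> manifold_interior A"
      "\<And>q. q \<notin> C \<Longrightarrow> f q = 0"
    let ?f\<omega> = "scale_form f \<omega>"
    have f\<omega>: "smooth_form A tw 1 ?f\<omega>" by (rule smooth_form_scale[OF f \<omega>])
    \<comment> \<open>Integrability is available only after localisation, so the pairing with the
      difference \<theta> is split into those with \<alpha> and \<beta> for the scaled test
      form.\<close>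
    have int: "integrable vol (pair_density ?f\<omega> \<gamma>)" if "smooth_form A (\<not> tw) 2 \<gamma>" for \<gamma>
      by (rule integrable_compact_support[OF pair_density_continuous[OF f\<omega> that] c C(1,2)])
        (simp add: pair_density_scale_left C(4))
    have "f p * pair_density \<omega> \<theta> p = pair_density ?f\<omega> \<alpha> p - pair_density ?f\<omega> \<beta> p" for p
      unfolding pair_density_scale_left
      by (simp add: pair_density_in_def \<theta>_bivec inner_diff_right diff_divide_distrib algebra_simps)
    then have "(\<integral>p. f p * pair_density \<omega> \<theta> p \<partial>vol) = (\<integral>p. pair_density ?f\<omega> \<alpha> p \<partial>vol) - (\<integral>p. pair_density ?f\<omega> \<beta> p \<partial>vol)"
      using Bochner_Integration.integral_diff[OF int[OF \<alpha>] int[OF \<beta>]] by (simp only:)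
    also have "\<dots> = 0"
      using eq[OF f\<omega> compact_interior_support_scale[OF C(1,3,4)]] by simp
    finally show "(\<integral>p. f p * pair_density \<omega> \<theta> p \<partial>vol) = 0" .
  qed
  \<comment> \<open>Positive definiteness gives 0 at interior points; continuity extends this to the
    boundary.\<close>
  have "bivec \<theta> c x = 0" if c: "c \<in> A" and x: "x \<in> chart_image c" for c x
  proof (rule zero_in_interior_charts[OF c bivec_continuous[OF \<theta> c] _ x])
    fix p assume p: "p \<in> manifold_interior A" "p \<in> fst c"
    have y: "snd c p \<in> chart_image c" using p by blast
    show "bivec \<theta> c (snd c p) = 0"
      using zero[OF p(1)] metric_det_pos[OF c y] metric_quadratic(2)[OF c y]
      unfolding pair_density_eq[OF \<omega> \<theta> c p(2)] density[OF c p(2)] by simp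
  qed
  then show ?thesis
    by (intro smooth_form2_eqI[OF \<alpha> \<beta>]) (simp add: \<theta>_bivec)
qed

lemma one_form_determined_by_pairing:
  assumes \<alpha>: "smooth_form A tw 1 \<alpha>" and \<beta>: "smooth_form A tw 1 \<beta>"
    and eq: "\<And>\<omega>. smooth_form A (\<not> tw) 2 \<omega> \<Longrightarrow> compact_interior_support A \<omega> \<Longrightarrow>
      (\<integral>p. pair_density \<alpha> \<omega> p \<partial>vol) = (\<integral>p. pair_density \<beta> \<omega> p \<partial>vol)"
  shows "\<alpha> = \<beta>"
proof -
  define \<theta> where "\<theta> = (\<lambda>c x vs. 1 * \<alpha> c x vs + (- 1) * \<beta> c x vs)"
  have \<theta>: "smooth_form A tw 1 \<theta>"
    unfolding \<theta>_def by (rule smooth_form_combination[OF \<alpha> \<beta>])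
  have \<theta>_covec: "covec \<theta> c x = covec \<alpha> c x - covec \<beta> c x" for c x
    by (simp add: \<theta>_def covec_def vec_eq_iff)
  define \<omega> where "\<omega> = star1 \<theta>"
  have \<omega>: "smooth_form A (\<not> tw) 2 \<omega>"
    using star1_smooth_form[OF \<theta>] by (simp add: \<omega>_def)
  \<comment> \<open>The density is expressed through the star of \<theta>, so that the quadratic
    form is again that of the metric and not of its inverse; \<open>star1_relation\<close> carries
    the vanishing back to \<theta>.\<close>
  have density: "pair_density_in c \<theta> \<omega> p = bivec \<omega> c (snd c p) \<bullet> (g c (snd c p) *v bivec \<omega> c (snd c p)) / det (g c (snd c p))"
    if c: "c \<in> A" "p \<in> fst c" for c p
  proof -
    have x: "snd c p \<in> chart_image c" using c by blast
    show ?thesis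
      unfolding star1_relation[OF c(1) x, of \<theta>, folded \<omega>_def] pair_density_in_def
      using metric_det_pos[OF c(1) x] by (simp add: inner_commute field_simps)
  qed
  have nonneg: "0 \<le> pair_density \<theta> \<omega> p" for p
  proof -
    have x: "snd (chart_at A p) p \<in> chart_image (chart_at A p)" using chart_at by blast
    show ?thesis
      unfolding density[OF chart_at]
      using metric_quadratic(1)[OF chart_at(1) x] metric_det_pos[OF chart_at(1) x] by simp
  qed
  have zero: "pair_density \<theta> \<omega> p = 0" if p: "p \<in> manifold_interior A" for p
  proof (rule pair_density_zero_interior[OF \<theta> \<omega> nonneg _ p])
    fix f c C assume f: "smooth_function f" and c: "c \<in> A" and C: "compact C" "C \<subseteq> fst c" "C \<subseteq> manifold_interior A"
      "\<And>q. q \<notin> C \<Longrightarrow> f q = 0"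
    let ?f\<omega> = "scale_form f \<omega>"
    have f\<omega>: "smooth_form A (\<not> tw) 2 ?f\<omega>" by (rule smooth_form_scale[OF f \<omega>])
    have int: "integrable vol (pair_density \<gamma> ?f\<omega>)" if "smooth_form A tw 1 \<gamma>" for \<gamma>
      by (rule integrable_compact_support[OF pair_density_continuous[OF that f\<omega>] c C(1,2)])
        (simp add: pair_density_scale_right C(4))
    have "f p * pair_density \<theta> \<omega> p = pair_density \<alpha> ?f\<omega> p - pair_density \<beta> ?f\<omega> p" for p
      unfolding pair_density_scale_right
      by (simp add: pair_density_in_def \<theta>_covec inner_diff_left diff_divide_distrib algebra_simps)
    then have "(\<integral>p. f p * pair_density \<theta> \<omega> p \<partial>vol) = (\<integral>p. pair_density \<alpha> ?f\<omega> p \<partial>vol) - (\<integral>p. pair_density \<beta> ?f\<omega> p \<partial>vol)"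
      using Bochner_Integration.integral_diff[OF int[OF \<alpha>] int[OF \<beta>]] by (simp only:)
    also have "\<dots> = 0"
      using eq[OF f\<omega> compact_interior_support_scale[OF C(1,3,4)]] by simp
    finally show "(\<integral>p. f p * pair_density \<theta> \<omega> p \<partial>vol) = 0" .
  qed
  have "covec \<theta> c x = 0" if c: "c \<in> A" and x: "x \<in> chart_image c" for c x
  proof (rule zero_in_interior_charts[OF c covec_continuous[OF \<theta> c] _ x])
    fix p assume p: "p \<in> manifold_interior A" "p \<in> fst c"
    have y: "snd c p \<in> chart_image c" using p by blast
    have "bivec \<omega> c (snd c p) = 0"
      using zero[OF p(1)] metric_det_pos[OF c y] metric_quadratic(2)[OF c y]
      unfolding pair_density_eq[OF \<theta> \<omega> c p(2)] density[OF c p(2)] by simp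
    then show "covec \<theta> c (snd c p) = 0"
      using star1_relation[OF c y, of \<theta>] vol_factor_pos[OF c y] by (simp add: \<omega>_def)
  qed
  then show ?thesis
    by (intro smooth_form1_eqI[OF \<alpha> \<beta>]) (simp add: \<theta>_covec)
qed

section \<open>Evaluation of the Hodge star\<close>

lemma hodge_star_1:
  assumes \<eta>: "straight_form A 1 \<eta>"
  shows "hodge_star A g 1 \<eta> = star1 \<eta>"
proof -
  have s: "twisted_form A 2 (star1 \<eta>)" using star1_smooth_form[OF \<eta>] by simp
  have "(THE \<theta>. twisted_form A 2 \<theta> \<and> (\<forall>\<omega>. straight_form A 1 \<omega> \<and> compact_interior_support A \<omega> \<longrightarrow>
      l2_inner A g 1 \<omega> \<eta> = poincare_pairing A g 1 \<omega> \<theta>)) = star1 \<eta>"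
  proof (rule the_equality, intro conjI allI impI s)
    show "l2_inner A g 1 \<omega> \<eta> = poincare_pairing A g 1 \<omega> (star1 \<eta>)"
      if "straight_form A 1 \<omega> \<and> compact_interior_support A \<omega>" for \<omega>
      using l2_inner_1[OF _ \<eta>] that by blast
    fix \<theta> assume \<theta>: "twisted_form A 2 \<theta> \<and> (\<forall>\<omega>. straight_form A 1 \<omega> \<and> compact_interior_support A \<omega> \<longrightarrow>
      l2_inner A g 1 \<omega> \<eta> = poincare_pairing A g 1 \<omega> \<theta>)"
    show "\<theta> = star1 \<eta>"
    proof (rule two_form_determined_by_pairing[of False])
      fix \<omega> assume \<omega>: "straight_form A 1 \<omega>" "compact_interior_support A \<omega>"
      have "poincare_pairing A g 1 \<omega> \<theta> = poincare_pairing A g 1 \<omega> (star1 \<eta>)"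
        using \<theta> \<omega> l2_inner_1[OF \<omega>(1) \<eta>] by metis
      then show "(\<integral>p. pair_density \<omega> \<theta> p \<partial>vol) = (\<integral>p. pair_density \<omega> (star1 \<eta>) p \<partial>vol)"
        using pairing_1_2[OF conjunct1[OF \<theta>], of \<omega>] pairing_1_2[OF s, of \<omega>] by simp
    qed (use \<theta> s in auto)
  qed
  then show ?thesis
    unfolding hodge_star_def by simp
qed

lemma hodge_star_2:
  assumes \<eta>: "straight_form A 2 \<eta>"
  shows "hodge_star A g 2 \<eta> = star2 \<eta>"
proof -
  have s: "twisted_form A 1 (star2 \<eta>)" using star2_smooth_form[OF \<eta>] by simp
  have "(THE \<theta>. twisted_form A 1 \<theta> \<and> (\<forall>\<omega>. straight_form A 2 \<omega> \<and> compact_interior_support A \<omega> \<longrightarrow>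
      l2_inner A g 2 \<omega> \<eta> = poincare_pairing A g 2 \<omega> \<theta>)) = star2 \<eta>"
  proof (rule the_equality, intro conjI allI impI s)
    show "l2_inner A g 2 \<omega> \<eta> = poincare_pairing A g 2 \<omega> (star2 \<eta>)"
      if "straight_form A 2 \<omega> \<and> compact_interior_support A \<omega>" for \<omega>
      using l2_inner_2[OF _ \<eta>] that by blast
    fix \<theta> assume \<theta>: "twisted_form A 1 \<theta> \<and> (\<forall>\<omega>. straight_form A 2 \<omega> \<and> compact_interior_support A \<omega> \<longrightarrow>
      l2_inner A g 2 \<omega> \<eta> = poincare_pairing A g 2 \<omega> \<theta>)"
    show "\<theta> = star2 \<eta>"
    proof (rule one_form_determined_by_pairing[of True])
      fix \<omega> assume \<omega>: "smooth_form A (\<not> True) 2 \<omega>" "compact_interior_support A \<omega>"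
      then have \<omega>1: "straight_form A 2 \<omega>" by simp
      have "poincare_pairing A g 2 \<omega> \<theta> = poincare_pairing A g 2 \<omega> (star2 \<eta>)"
        using \<theta> \<omega>1 \<omega>(2) l2_inner_2[OF \<omega>1 \<eta>] by metis
      then show "(\<integral>p. pair_density \<theta> \<omega> p \<partial>vol) = (\<integral>p. pair_density (star2 \<eta>) \<omega> p \<partial>vol)"
        using pairing_2_1[OF \<omega>1] by simp
    qed (use \<theta> s in auto)
  qed
  then show ?thesis
    unfolding hodge_star_def by simp
qed

end

section \<open>Functional derivatives and Maxwell's equations\<close>

lemma partial_derivative_fst:
  assumes "F differentiable (at z)"
  shows "frechet_derivative (\<lambda>x. F (x, snd z)) (at (fst z)) = (\<lambda>\<eta>. frechet_derivative F (at z) (\<eta>, 0))"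
proof -
  have "(F has_derivative frechet_derivative F (at z)) (at (fst z, snd z))"
    using assms frechet_derivative_works by fastforce
  moreover have "((\<lambda>x. (x, snd z)) has_derivative (\<lambda>\<eta>. (\<eta>, 0))) (at (fst z))"
    by (auto intro!: derivative_eq_intros)
  ultimately have "((\<lambda>x. F (x, snd z)) has_derivative (\<lambda>\<eta>. frechet_derivative F (at z) (\<eta>, 0))) (at (fst z))"
    using has_derivative_compose by fast
  then show ?thesis using frechet_derivative_at by metis
qed

lemma partial_derivative_snd:
  assumes "F differentiable (at z)"
  shows "frechet_derivative (\<lambda>y. F (fst z, y)) (at (snd z)) = (\<lambda>\<eta>. frechet_derivative F (at z) (0, \<eta>))"
proof -
  have "(F has_derivative frechet_derivative F (at z)) (at (fst z, snd z))"
    using assms frechet_derivative_works by fastforce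
  moreover have "((\<lambda>y. (fst z, y)) has_derivative (\<lambda>\<eta>. (0, \<eta>))) (at (snd z))"
    by (auto intro!: derivative_eq_intros)
  ultimately have "((\<lambda>y. F (fst z, y)) has_derivative (\<lambda>\<eta>. frechet_derivative F (at z) (0, \<eta>))) (at (snd z))"
    using has_derivative_compose by fast
  then show ?thesis using frechet_derivative_at by metis
qed

context riemannian_3_manifold
begin

section \<open>Symmetry and homogeneity of inner products and pairings\<close>

lemma star1_inject:
  assumes \<omega>: "smooth_form A tw 1 \<omega>" and \<eta>: "smooth_form A tw 1 \<eta>" and eq: "star1 \<omega> = star1 \<eta>"
  shows "\<omega> = \<eta>"
proof (rule smooth_form1_eqI[OF \<omega> \<eta>])
  fix c x assume c: "c \<in> A" "x \<in> chart_image c"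
  show "covec \<omega> c x = covec \<eta> c x"
    using star1_relation[OF c, of \<omega>] star1_relation[OF c, of \<eta>] eq vol_factor_pos[OF c] by simp
qed

text \<open>Symmetry of the metric moves it from one star to the other. This is what merges the two
  terms in the derivative of (e, e).\<close>

lemma l2_inner_1_commute:
  assumes \<omega>: "smooth_form A tw 1 \<omega>" and \<eta>: "smooth_form A tw' 1 \<eta>"
  shows "l2_inner A g 1 \<omega> \<eta> = l2_inner A g 1 \<eta> \<omega>"
proof -
  have "pair_density \<omega> (star1 \<eta>) p = pair_density \<eta> (star1 \<omega>) p" for p
  proof -
    define c x where "c = chart_at A p" and "x = snd c p"
    have c: "c \<in> A" "x \<in> chart_image c" using chart_at[of p] by (auto simp: c_def x_def)
    have "vol_factor c x * (covec \<omega> c x \<bullet> bivec (star1 \<eta>) c x) = (g c x *v bivec (star1 \<omega>) c x) \<bullet> bivec (star1 \<eta>) c x"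
      unfolding star1_relation[OF c] by simp
    also have "\<dots> = vol_factor c x * (covec \<eta> c x \<bullet> bivec (star1 \<omega>) c x)"
      unfolding inner_matrix_vector_transpose metric_symmetric[OF c] unfolding star1_relation[OF c] by (simp add: inner_commute)
    finally have "covec \<omega> c x \<bullet> bivec (star1 \<eta>) c x = covec \<eta> c x \<bullet> bivec (star1 \<omega>) c x"
      using vol_factor_pos[OF c] by (metis less_irrefl mult_left_cancel)
    then show ?thesis
      by (simp add: pair_density_in_def c_def x_def)
  qed
  then show ?thesis
    unfolding l2_inner_1[OF \<omega> \<eta>] l2_inner_1[OF \<eta> \<omega>]
      pairing_1_2[OF star1_smooth_form[OF \<eta>]] pairing_1_2[OF star1_smooth_form[OF \<omega>]] by simp
qed

lemma l2_inner_2_commute: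
  assumes \<omega>: "smooth_form A tw 2 \<omega>" and \<eta>: "smooth_form A tw' 2 \<eta>"
  shows "l2_inner A g 2 \<omega> \<eta> = l2_inner A g 2 \<eta> \<omega>"
proof -
  have "pair_density (star2 \<eta>) \<omega> p = pair_density (star2 \<omega>) \<eta> p" for p
  proof -
    define c x where "c = chart_at A p" and "x = snd c p"
    have c: "c \<in> A" "x \<in> chart_image c" using chart_at[of p] by (auto simp: c_def x_def)
    have "vol_factor c x * (covec (star2 \<eta>) c x \<bullet> bivec \<omega> c x) = (g c x *v bivec \<eta> c x) \<bullet> bivec \<omega> c x"
      unfolding star2_relation[OF c] by simp
    also have "\<dots> = vol_factor c x * (covec (star2 \<omega>) c x \<bullet> bivec \<eta> c x)"
      unfolding inner_matrix_vector_transpose metric_symmetric[OF c] unfolding star2_relation[OF c] by (simp add: inner_commute)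
    finally have "covec (star2 \<eta>) c x \<bullet> bivec \<omega> c x = covec (star2 \<omega>) c x \<bullet> bivec \<eta> c x"
      using vol_factor_pos[OF c] by (metis less_irrefl mult_left_cancel)
    then show ?thesis
      by (simp add: pair_density_in_def c_def x_def)
  qed
  then show ?thesis
    unfolding l2_inner_2[OF \<omega> \<eta>] l2_inner_2[OF \<eta> \<omega>] pairing_2_1[OF \<omega>] pairing_2_1[OF \<eta>] by simp
qed

lemma scaleR_form_apply: "(u *\<^sub>R \<omega>) c x vs = u * (\<omega> :: 'm form) c x vs"
  by (simp add: scaleR_fun_def)

lemma smooth_form_scaleR:
  assumes "smooth_form A tw k \<omega>" shows "smooth_form A tw k (u *\<^sub>R \<omega>)"
proof -
  have "u *\<^sub>R \<omega> = (\<lambda>c x vs. u * \<omega> c x vs + 0 * \<omega> c x vs)"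
    by (intro ext) (simp add: scaleR_form_apply)
  then show ?thesis using smooth_form_combination[OF assms assms, of u 0] by simp
qed

lemma pairing_scaleR_left_1:
  assumes "smooth_form A tw 2 \<eta>"
  shows "poincare_pairing A g 1 (u *\<^sub>R \<omega>) \<eta> = u * poincare_pairing A g 1 \<omega> \<eta>"
proof -
  have "pair_density (u *\<^sub>R \<omega>) \<eta> p = u * pair_density \<omega> \<eta> p" for p
    by (simp add: pair_density_in_def inner_covec scaleR_form_apply sum_distrib_left mult.assoc)
  then show ?thesis unfolding pairing_1_2[OF assms] by simp
qed

lemma bivec_scaleR: "bivec (u *\<^sub>R (\<eta> :: 'm form)) c x = u *\<^sub>R bivec \<eta> c x"
  by (simp add: bivec_def scaleR_form_apply vec_eq_iff forall_3)

lemma pairing_scaleR_right_1: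
  assumes "smooth_form A tw 2 \<eta>"
  shows "poincare_pairing A g 1 \<omega> (u *\<^sub>R \<eta>) = u * poincare_pairing A g 1 \<omega> \<eta>"
proof -
  have "pair_density \<omega> (u *\<^sub>R \<eta>) p = u * pair_density \<omega> \<eta> p" for p
    by (simp add: pair_density_in_def bivec_scaleR)
  then show ?thesis
    unfolding pairing_1_2[OF assms] pairing_1_2[OF smooth_form_scaleR[OF assms]] by simp
qed

lemma pairing_scaleR_left_2:
  assumes "smooth_form A tw 2 \<eta>"
  shows "poincare_pairing A g 2 (u *\<^sub>R \<eta>) \<omega> = u * poincare_pairing A g 2 \<eta> \<omega>"
proof -
  have "pair_density \<omega> (u *\<^sub>R \<eta>) p = u * pair_density \<omega> \<eta> p" for p
    by (simp add: pair_density_in_def bivec_scaleR)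
  then show ?thesis
    unfolding pairing_2_1[OF assms] pairing_2_1[OF smooth_form_scaleR[OF assms]] by simp
qed

lemma ext_d_scaleR:
  assumes \<omega>: "smooth_form A tw 1 \<omega>"
  shows "ext_d A 1 (u *\<^sub>R \<omega>) = u *\<^sub>R ext_d A 1 \<omega>"
proof (rule smooth_form2_eqI)
  show "smooth_form A tw 2 (ext_d A 1 (u *\<^sub>R \<omega>))" "smooth_form A tw 2 (u *\<^sub>R ext_d A 1 \<omega>)"
    by (intro ext_d_1_smooth_form smooth_form_scaleR \<omega>)+
  fix c x assume c: "c \<in> A" "x \<in> chart_image c"
  have "hderiv (\<lambda>y. (u *\<^sub>R \<omega>) c y [w]) x v = u * hderiv (\<lambda>y. \<omega> c y [w]) x v" for v w
    unfolding scaleR_form_apply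
    by (rule hderiv_eqI[OF chart_relopen[OF c(1)] c(2)], rule has_derivative_mult_right,
        rule smooth_on_has_derivative[OF smooth_form_component[OF \<omega> c(1)] c(2)]) simp
  then show "bivec (ext_d A 1 (u *\<^sub>R \<omega>)) c x = bivec (u *\<^sub>R ext_d A 1 \<omega>) c x"
    unfolding bivec_scaleR unfolding bivec_def ext_d_1_apply[OF c] by (simp add: vec_eq_iff forall_3 right_diff_distrib')
qed

end

context em_field_spaces
begin

section \<open>Uniqueness of representing fields\<close>

lemma E1_linear: "linear E1" and E1_inj: "inj E1" and E1_smooth: "straight_form A 1 (E1 e)"
    and E1_range: "straight_form A 1 \<omega> \<Longrightarrow> compact_interior_support A \<omega> \<Longrightarrow> \<omega> \<in> range E1"
  using E1 unfolding form_space_def by blast+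

lemma B2_smooth: "straight_form A 2 (B2 b)"
    and B2_range: "straight_form A 2 \<omega> \<Longrightarrow> compact_interior_support A \<omega> \<Longrightarrow> \<omega> \<in> range B2"
  using B2 unfolding form_space_def by blast+

lemma D2_linear: "linear D2" and D2_inj: "inj D2" and D2_smooth: "twisted_form A 2 (D2 d)"
    and D2_range: "twisted_form A 2 \<omega> \<Longrightarrow> compact_interior_support A \<omega> \<Longrightarrow> \<omega> \<in> range D2"
  using D2 unfolding form_space_def by blast+

lemma H1_linear: "linear H1" and H1_inj: "inj H1" and H1_smooth: "twisted_form A 1 (H1 h)"
    and H1_range: "twisted_form A 1 \<omega> \<Longrightarrow> compact_interior_support A \<omega> \<Longrightarrow> \<omega> \<in> range H1"
  using H1 unfolding form_space_def by blast+

text \<open>Boundary conditions exclude no form with compact support in the interior, so the fields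
  of \<open>E1\<close> include all needed test forms. The two forms are arbitrary twisted forms,
  because an exterior derivative need not lie in the range of \<open>D2\<close>.\<close>

lemma two_form_eq_by_E:
  assumes "twisted_form A 2 \<alpha>" "twisted_form A 2 \<beta>"
    and "\<And>e. poincare_pairing A g 1 (E1 e) \<alpha> = poincare_pairing A g 1 (E1 e) \<beta>"
  shows "\<alpha> = \<beta>"
proof (rule two_form_determined_by_pairing[of False])
  fix \<omega> assume "straight_form A 1 \<omega>" "compact_interior_support A \<omega>"
  then obtain e where "\<omega> = E1 e" using E1_range by blast
  then show "(\<integral>p. pair_density \<omega> \<alpha> p \<partial>vol) = (\<integral>p. pair_density \<omega> \<beta> p \<partial>vol)"
    using assms(3)[of e] unfolding pairing_1_2[OF assms(1)] pairing_1_2[OF assms(2)] by simp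
qed (use assms in auto)

lemma two_form_eq_by_H:
  assumes "straight_form A 2 \<alpha>" "straight_form A 2 \<beta>"
    and "\<And>h. poincare_pairing A g 2 \<alpha> (H1 h) = poincare_pairing A g 2 \<beta> (H1 h)"
  shows "\<alpha> = \<beta>"
proof (rule two_form_determined_by_pairing[of True])
  fix \<omega> assume "twisted_form A 1 \<omega>" "compact_interior_support A \<omega>"
  then obtain h where "\<omega> = H1 h" using H1_range by blast
  then show "(\<integral>p. pair_density \<omega> \<alpha> p \<partial>vol) = (\<integral>p. pair_density \<omega> \<beta> p \<partial>vol)"
    using assms(3)[of h] unfolding pairing_2_1[OF assms(1)] pairing_2_1[OF assms(2)] by simp
qed (use assms in auto)

lemma D_eq_by_pairing: "(\<And>e. pairing_ED e d = pairing_ED e d') \<Longrightarrow> d = d'"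
  using two_form_eq_by_E[OF D2_smooth D2_smooth] injD[OF D2_inj] by blast

lemma E_eq_by_pairing:
  assumes "\<And>d. pairing_ED e d = pairing_ED e' d" shows "e = e'"
proof -
  have "E1 e = E1 e'"
  proof (rule one_form_determined_by_pairing[OF E1_smooth E1_smooth])
    fix \<omega> assume \<omega>: "smooth_form A (\<not> False) 2 \<omega>" "compact_interior_support A \<omega>"
    then obtain d where "\<omega> = D2 d" using D2_range by auto
    then show "(\<integral>p. pair_density (E1 e) \<omega> p \<partial>vol) = (\<integral>p. pair_density (E1 e') \<omega> p \<partial>vol)"
      using assms[of d] unfolding pairing_1_2[OF D2_smooth] by simp
  qed
  then show ?thesis using injD[OF E1_inj] by blast
qed

lemma H_eq_by_pairing:
  assumes "\<And>b. pairing_BH b h = pairing_BH b h'" shows "h = h'"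
proof -
  have "H1 h = H1 h'"
  proof (rule one_form_determined_by_pairing[OF H1_smooth H1_smooth])
    fix \<omega> assume \<omega>: "smooth_form A (\<not> True) 2 \<omega>" "compact_interior_support A \<omega>"
    then obtain b where "\<omega> = B2 b" using B2_range by auto
    then show "(\<integral>p. pair_density (H1 h) \<omega> p \<partial>vol) = (\<integral>p. pair_density (H1 h') \<omega> p \<partial>vol)"
      using assms[of b] unfolding pairing_2_1[OF B2_smooth] by simp
  qed
  then show ?thesis using injD[OF H1_inj] by blast
qed

text \<open>\<open>star_E1\<close> places the star in the space of fields, so the inner product
  becomes a pairing with an element of that space.\<close>

lemma ex_starE: "\<exists>d. D2 d = hodge_star A g 1 (E1 e) \<and> (\<forall>e'. inner_E e' e = pairing_ED e' d)"
proof -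
  obtain d where d: "D2 d = hodge_star A g 1 (E1 e)" using star_E1[of e] by (metis rangeE)
  then have "inner_E e' e = pairing_ED e' d" for e'
    unfolding l2_inner_1[OF E1_smooth E1_smooth] hodge_star_1[OF E1_smooth] by simp
  with d show ?thesis by blast
qed

lemma ex_starB: "\<exists>h. H1 h = hodge_star A g 2 (B2 b) \<and> (\<forall>b'. inner_B b' b = pairing_BH b' h)"
proof -
  obtain h where h: "H1 h = hodge_star A g 2 (B2 b)" using star_B2[of b] by (metis rangeE)
  then have "inner_B b' b = pairing_BH b' h" for b'
    unfolding l2_inner_2[OF B2_smooth B2_smooth] hodge_star_2[OF B2_smooth] by simp
  with h show ?thesis by blast
qed

text \<open>Equal inner products mean that the stars have equal pairings, and \<open>star1\<close>
  is injective.\<close>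

lemma E_eq_by_inner:
  assumes "\<And>e. inner_E e v = inner_E e v'" shows "v = v'"
proof -
  have "star1 (E1 v) = star1 (E1 v')"
  proof (rule two_form_eq_by_E)
    show "twisted_form A 2 (star1 (E1 v))" "twisted_form A 2 (star1 (E1 v'))"
      using star1_smooth_form[OF E1_smooth] by simp_all
    show "poincare_pairing A g 1 (E1 e) (star1 (E1 v)) = poincare_pairing A g 1 (E1 e) (star1 (E1 v'))" for e
      using assms[of e] unfolding l2_inner_1[OF E1_smooth E1_smooth] .
  qed
  then have "E1 v = E1 v'" by (rule star1_inject[OF E1_smooth E1_smooth])
  then show ?thesis using injD[OF E1_inj] by blast
qed

lemma delta_e_represents:
  assumes "regular_K K" shows "represents_fst inner_E K z (delta_e K z)"
proof -
  have "\<exists>!v. represents_fst inner_E K z v"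
    using assms E_eq_by_inner unfolding regular_K_def represents_fst_def by metis
  then show ?thesis unfolding delta_e_def by (rule theI')
qed

lemma tdelta_e_represents:
  assumes "regular_K K" shows "represents_fst pairing_ED K z (tdelta_e K z)"
proof -
  have "\<exists>!v. represents_fst pairing_ED K z v"
    using assms D_eq_by_pairing unfolding regular_K_def represents_fst_def by metis
  then show ?thesis unfolding tdelta_e_def by (rule theI')
qed

lemma tdelta_b_equality:
  fixes F :: "'x::real_normed_vector \<times> 'b \<Rightarrow> real"
  assumes "represents_snd pairing_BH F z v" shows "tdelta_b F z = v"
  unfolding tdelta_b_def
  by (rule the_equality[where P = "represents_snd pairing_BH F z", OF assms])
    (rule H_eq_by_pairing, use assms in \<open>simp add: represents_snd_def\<close>)

lemma tdelta_d_equality: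
  assumes "represents_fst (\<lambda>\<eta> v. pairing_ED v \<eta>) F z v" shows "tdelta_d F z = v"
  unfolding tdelta_d_def
  by (rule the_equality[where P = "represents_fst (\<lambda>\<eta> v. pairing_ED v \<eta>) F z", OF assms])
    (rule E_eq_by_pairing, use assms in \<open>simp add: represents_fst_def\<close>)

lemma tdelta_b_represents:
  assumes "regular_K K" shows "represents_snd pairing_BH K z (tdelta_b K z)"
  using assms tdelta_b_equality unfolding regular_K_def by metis

text \<open>The Legendre transform: in the variables \<open>(d, b)\<close> the differential of \<open>Hbar\<close> is
  \<open>(\<langle>e, \<delta>d\<rangle> + \<langle>\<delta>b, h\<rangle>) / 4\<pi>\<close>, since the \<open>\<delta>e\<close> terms cancel.\<close>

lemma Hbar_has_derivative:
  assumes K: "regular_K K"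
    and d: "\<And>e b. D2 (d (e, b)) = hodge_star A g 1 (E1 e) - (4 * pi) *\<^sub>R D2 (tdelta_e K (e, b))"
    and h: "\<And>e b. H1 (h (e, b)) = hodge_star A g 2 (B2 b) + (4 * pi) *\<^sub>R H1 (tdelta_b K (e, b))"
    and diffeo: "diffeomorphism (\<lambda>(e, b). (d (e, b), b))"
    and Hbar: "\<And>e b. Hbar (d (e, b), b) = K (e, b) - inner_E e (delta_e K (e, b))
        + 1 / (8 * pi) * (inner_E e e + inner_B b b)"
  shows "(Hbar has_derivative (\<lambda>(\<delta>, \<beta>). (pairing_ED e \<delta> + pairing_BH \<beta> (h (e, b))) / (4 * pi))) (at (d (e, b), b))"
proof -
  define \<Phi> where "\<Phi> = (\<lambda>(e, b). (d (e, b), b))"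
  have bij: "bij \<Phi>" and \<Phi>_diff: "\<Phi> differentiable (at z)" and inv_diff: "inv \<Phi> differentiable (at y)" for z y
    using diffeo unfolding diffeomorphism_def \<Phi>_def by blast+
  have K_diff: "K differentiable (at z)" for z
    using K unfolding regular_K_def twice_differentiable_def differentiable_def by blast
  define K' where "K' z = frechet_derivative K (at z)" for z
  have K': "(K has_derivative K' z) (at z)" for z
    using K_diff frechet_derivative_works unfolding K'_def by blast
  have K'e: "K' z (\<eta>, 0) = pairing_ED \<eta> (tdelta_e K z)" "K' z (\<eta>, 0) = inner_E \<eta> (delta_e K z)" for z \<eta>
    using tdelta_e_represents[OF K, of z] delta_e_represents[OF K, of z]
    unfolding represents_fst_def partial_derivative_fst[OF K_diff] K'_def by simp_all
  have K'b: "K' z (0, \<beta>) = pairing_BH \<beta> (tdelta_b K z)" for z \<beta>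
    using tdelta_b_represents[OF K, of z]
    unfolding represents_snd_def partial_derivative_snd[OF K_diff] K'_def by simp
  have K'split: "K' z u = pairing_ED (fst u) (tdelta_e K z) + pairing_BH (snd u) (tdelta_b K z)" for z u
    using linear_add[OF has_derivative_linear[OF K'], of z "(fst u, 0)" "(0, snd u)"] K'e(1) K'b by simp
  note biED = bounded_pairing_ED and biBH = bounded_pairing_BH
  \<comment> \<open>The constitutive relation is an equation between forms; injectivity of
    \<open>D2\<close> lifts it to the normed space, where the pairing is bilinear.\<close>
  have pd: "pairing_ED \<eta> (d (e, b)) = inner_E \<eta> e - 4 * pi * pairing_ED \<eta> (tdelta_e K (e, b))" for \<eta> e b
  proof -
    obtain s where s: "D2 s = hodge_star A g 1 (E1 e)" "\<And>e'. inner_E e' e = pairing_ED e' s"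
      using ex_starE by blast
    have "D2 (d (e, b)) = D2 (s - (4 * pi) *\<^sub>R tdelta_e K (e, b))"
      unfolding d s(1)[symmetric] by (simp add: linear_diff[OF D2_linear] linear_scale[OF D2_linear])
    then have "d (e, b) = s - (4 * pi) *\<^sub>R tdelta_e K (e, b)"
      by (rule injD[OF D2_inj])
    then show ?thesis
      using bounded_bilinear.diff_right[OF biED] bounded_bilinear.scaleR_right[OF biED] s(2) by simp
  qed
  have ph: "pairing_BH \<beta> (h (e, b)) = inner_B \<beta> b + 4 * pi * pairing_BH \<beta> (tdelta_b K (e, b))" for \<beta> e b
  proof -
    obtain s where s: "H1 s = hodge_star A g 2 (B2 b)" "\<And>b'. inner_B b' b = pairing_BH b' s"
      using ex_starB by blast
    have "H1 (h (e, b)) = H1 (s + (4 * pi) *\<^sub>R tdelta_b K (e, b))"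
      unfolding h s(1)[symmetric] by (simp add: linear_add[OF H1_linear] linear_scale[OF H1_linear])
    then have "h (e, b) = s + (4 * pi) *\<^sub>R tdelta_b K (e, b)"
      by (rule injD[OF H1_inj])
    then show ?thesis
      using bounded_bilinear.add_right[OF biBH] bounded_bilinear.scaleR_right[OF biBH] s(2) by simp
  qed
  have d_diff: "d differentiable (at z)" for z
  proof -
    have "d = fst \<circ> \<Phi>" by (auto simp: \<Phi>_def fun_eq_iff)
    then show ?thesis
      using \<Phi>_diff[of z] by (metis bounded_linear_fst bounded_linear_imp_differentiable differentiable_chain_at)
  qed
  define d' where "d' z = frechet_derivative d (at z)" for z
  have d': "(d has_derivative d' z) (at z)" for z
    using d_diff frechet_derivative_works unfolding d'_def by blast
  \<comment> \<open>\<open>Hbar\<close> in the variables \<open>(e, b)\<close>, with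
    \<open>delta_e\<close> eliminated: by \<open>pd\<close> the inner product of e with
    \<open>delta_e K\<close> is ((e,e) - <e,d>) / 4pi, and -1/(4 pi) + 1/(8 pi) = -1/(8 pi). What
    remains is differentiable because \<open>K\<close> and \<open>d\<close> are.\<close>
  define N where "N z = K z + 1 / (4 * pi) * pairing_ED (fst z) (d z)
      - 1 / (8 * pi) * inner_E (fst z) (fst z) + 1 / (8 * pi) * inner_B (snd z) (snd z)" for z
  have N: "Hbar (\<Phi> z) = N z" for z
  proof (cases z)
    case (Pair e b)
    have delta: "inner_E e (delta_e K (e, b)) = pairing_ED e (tdelta_e K (e, b))"
      using K'e by metis
    have inner: "inner_E e e = pairing_ED e (d (e, b)) + 4 * pi * pairing_ED e (tdelta_e K (e, b))"
      using pd[of e e b] by simp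
    show ?thesis
      unfolding N_def Pair \<Phi>_def prod.case Hbar fst_conv snd_conv delta inner
      by (simp add: field_simps)
  qed
  let ?z = "(e, b)"
  have N': "(N has_derivative (\<lambda>u. (pairing_ED e (d' ?z u) + pairing_BH (snd u) (h ?z)) / (4 * pi))) (at ?z)"
  proof -
    have "(N has_derivative (\<lambda>u. K' ?z u + 1 / (4 * pi) * (pairing_ED (fst ?z) (d' ?z u) + pairing_ED (fst u) (d ?z))
      - 1 / (8 * pi) * (inner_E (fst ?z) (fst u) + inner_E (fst u) (fst ?z))
      + 1 / (8 * pi) * (inner_B (snd ?z) (snd u) + inner_B (snd u) (snd ?z)))) (at ?z)"
      unfolding N_def[abs_def]
      by (intro has_derivative_add has_derivative_diff has_derivative_mult_right K'
          bounded_bilinear.FDERIV[OF biED] bounded_bilinear.FDERIV[OF bounded_inner_E]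
          bounded_bilinear.FDERIV[OF bounded_inner_B] has_derivative_fst has_derivative_snd has_derivative_ident d')
    \<comment> \<open>By \<open>pd\<close>, <\<delta>e, d> / 4pi is (\<delta>e, e) / 4pi minus the
      pairing of \<delta>e with \<open>tdelta_e K\<close>. The first cancels the derivative of the
      quadratic term in e, the second the e-part of the derivative of \<open>K\<close>.\<close>
    moreover have "K' ?z u + 1 / (4 * pi) * (pairing_ED (fst ?z) (d' ?z u) + pairing_ED (fst u) (d ?z))
      - 1 / (8 * pi) * (inner_E (fst ?z) (fst u) + inner_E (fst u) (fst ?z))
      + 1 / (8 * pi) * (inner_B (snd ?z) (snd u) + inner_B (snd u) (snd ?z)) =
      (pairing_ED e (d' ?z u) + pairing_BH (snd u) (h ?z)) / (4 * pi)" for u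
      unfolding ph pd K'split fst_conv snd_conv
        l2_inner_1_commute[OF E1_smooth E1_smooth, of e] l2_inner_2_commute[OF B2_smooth B2_smooth, of b]
      by (simp add: field_simps)
    ultimately show ?thesis by simp
  qed
  let ?y = "\<Phi> ?z"
  define \<Psi>' where "\<Psi>' = frechet_derivative (inv \<Phi>) (at ?y)"
  have inv: "inv \<Phi> ?y = ?z" using bij by (simp add: bij_is_inj)
  have \<Psi>': "(inv \<Phi> has_derivative \<Psi>') (at ?y)"
    using inv_diff frechet_derivative_works unfolding \<Psi>'_def by blast
  have \<Phi>': "(\<Phi> has_derivative (\<lambda>u. (d' ?z u, snd u))) (at ?z)"
  proof -
    have "\<Phi> = (\<lambda>z. (d z, snd z))" by (auto simp: \<Phi>_def fun_eq_iff)
    then show ?thesis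
      using has_derivative_Pair[OF d'[of ?z] has_derivative_snd[OF has_derivative_ident]] by simp
  qed
  \<comment> \<open>The chain rule for \<Phi> after its inverse identifies the two components of the
    derivative of \<Phi> at \<open>\<Psi>' v\<close>. The derivative of \<open>N\<close> depends on
    its argument only through these components, so \<Psi>' is not computed.\<close>
  have "((\<lambda>y. \<Phi> (inv \<Phi> y)) has_derivative (\<lambda>v. (d' ?z (\<Psi>' v), snd (\<Psi>' v)))) (at ?y)"
    using has_derivative_compose[OF \<Psi>', of \<Phi> "\<lambda>u. (d' ?z u, snd u)"] \<Phi>' unfolding inv by simp
  moreover have "(\<lambda>y. \<Phi> (inv \<Phi> y)) = (\<lambda>y. y)"
    using bij by (simp add: bij_is_surj surj_f_inv_f)
  ultimately have "((\<lambda>y. y) has_derivative (\<lambda>v. (d' ?z (\<Psi>' v), snd (\<Psi>' v)))) (at ?y)"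
    by (simp only:)
  then have "(\<lambda>v. (d' ?z (\<Psi>' v), snd (\<Psi>' v))) = (\<lambda>v. v)"
    by (rule has_derivative_unique[OF _ has_derivative_ident])
  then have id: "(d' ?z (\<Psi>' v), snd (\<Psi>' v)) = v" for v
    by (rule fun_cong)
  have "((\<lambda>y. N (inv \<Phi> y)) has_derivative (\<lambda>v. (pairing_ED e (d' ?z (\<Psi>' v)) + pairing_BH (snd (\<Psi>' v)) (h ?z)) / (4 * pi))) (at ?y)"
    using has_derivative_compose[OF \<Psi>', of N] N' unfolding inv by simp
  moreover have "(\<lambda>y. N (inv \<Phi> y)) = Hbar"
    by (intro ext) (simp add: N[symmetric] surj_f_inv_f[OF bij_is_surj[OF bij]])
  moreover have "(pairing_ED e (d' ?z (\<Psi>' v)) + pairing_BH (snd (\<Psi>' v)) (h ?z)) / (4 * pi) =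
      (\<lambda>(\<delta>, \<beta>). (pairing_ED e \<delta> + pairing_BH \<beta> (h (e, b))) / (4 * pi)) v" for v
    using id[of v] by (cases v) simp
  ultimately show ?thesis by (simp add: \<Phi>_def)
qed

text \<open>A total derivative written as a sum of pairings exhibits both representing fields;
  uniqueness identifies them with the definite descriptions.\<close>

lemma tdelta_of_derivative:
  assumes F: "(F has_derivative (\<lambda>(\<delta>, \<beta>). pairing_ED e \<delta> + pairing_BH \<beta> h)) (at z)"
  shows "represents_fst (\<lambda>\<eta> v. pairing_ED v \<eta>) F z e" "represents_snd pairing_BH F z h"
    "tdelta_d F z = e" "tdelta_b F z = h"
proof -
  have diff: "F differentiable (at z)"
    using F unfolding differentiable_def by blast
  have F': "frechet_derivative F (at z) = (\<lambda>(\<delta>, \<beta>). pairing_ED e \<delta> + pairing_BH \<beta> h)"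
    using frechet_derivative_at[OF F] by simp
  show 1: "represents_fst (\<lambda>\<eta> v. pairing_ED v \<eta>) F z e"
    unfolding represents_fst_def partial_derivative_fst[OF diff] F'
    using bounded_bilinear.zero_left[OF bounded_pairing_BH] by simp
  show 2: "represents_snd pairing_BH F z h"
    unfolding represents_snd_def partial_derivative_snd[OF diff] F'
    using bounded_bilinear.zero_right[OF bounded_pairing_ED] by simp
  show "tdelta_d F z = e" by (rule tdelta_d_equality[OF 1])
  show "tdelta_b F z = h" by (rule tdelta_b_equality[OF 2])
qed

section \<open>Bracket with the Hamiltonian and evolution equations\<close>

lemma pairing_E_dH_scaleR:
  "poincare_pairing A g 1 (E1 (u *\<^sub>R e)) (ext_d A 1 (H1 h)) = u * poincare_pairing A g 1 (E1 e) (ext_d A 1 (H1 h))"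
  "poincare_pairing A g 1 (E1 e) (ext_d A 1 (H1 (u *\<^sub>R h))) = u * poincare_pairing A g 1 (E1 e) (ext_d A 1 (H1 h))"
  unfolding linear_scale[OF E1_linear] linear_scale[OF H1_linear] ext_d_scaleR[OF H1_smooth]
  by (rule pairing_scaleR_left_1[OF ext_d_1_smooth_form[OF H1_smooth]],
      rule pairing_scaleR_right_1[OF ext_d_1_smooth_form[OF H1_smooth]])

lemma pairing_E_dH_zero:
  "poincare_pairing A g 1 (E1 0) (ext_d A 1 (H1 h)) = 0"
  "poincare_pairing A g 1 (E1 e) (ext_d A 1 (H1 0)) = 0"
  using pairing_E_dH_scaleR(1)[where u = 0] pairing_E_dH_scaleR(2)[where u = 0] by simp_all

lemma bracket_Hbar:
  assumes "(Hbar has_derivative (\<lambda>(\<delta>, \<beta>). (pairing_ED e \<delta> + pairing_BH \<beta> h) / (4 * pi))) (at z)"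
  shows "bracket c F Hbar z =
    c * (poincare_pairing A g 1 (E1 (tdelta_d F z)) (ext_d A 1 (H1 h))
      - poincare_pairing A g 1 (E1 e) (ext_d A 1 (H1 (tdelta_b F z))))"
proof -
  \<comment> \<open>Bilinearity moves this constant from the derivative into the fields; it then
    cancels the prefactor of \<open>bracket\<close>.\<close>
  let ?k = "1 / (4 * pi)"
  have "(\<lambda>(\<delta>, \<beta>). (pairing_ED e \<delta> + pairing_BH \<beta> h) / (4 * pi)) =
      (\<lambda>(\<delta>, \<beta>). pairing_ED (?k *\<^sub>R e) \<delta> + pairing_BH \<beta> (?k *\<^sub>R h))"
    using bounded_bilinear.scaleR_left[OF bounded_pairing_ED] bounded_bilinear.scaleR_right[OF bounded_pairing_BH]
    by (auto simp: fun_eq_iff add_divide_distrib)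
  with assms have H: "(Hbar has_derivative (\<lambda>(\<delta>, \<beta>). pairing_ED (?k *\<^sub>R e) \<delta> + pairing_BH \<beta> (?k *\<^sub>R h))) (at z)"
    by (simp only:)
  show ?thesis
    unfolding bracket_def tdelta_of_derivative(3,4)[OF H] pairing_E_dH_scaleR
    by (simp add: field_simps)
qed

text \<open>A bounded linear functional is its own derivative, so every pair (e, h) occurs as the
  functional derivatives of an admissible test functional.\<close>

lemma linear_functional:
  defines "L e h \<equiv> \<lambda>z. pairing_ED e (fst z) + pairing_BH (snd z) h"
  shows "regular_functional (L e h)" "tdelta_d (L e h) z = e" "tdelta_b (L e h) z = h"
    "bounded_linear (L e h)"
proof -
  show bl: "bounded_linear (L e h)"
    unfolding L_def
    by (intro bounded_linear_add
        bounded_linear_compose[OF bounded_bilinear.bounded_linear_right[OF bounded_pairing_ED] bounded_linear_fst]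
        bounded_linear_compose[OF bounded_bilinear.bounded_linear_left[OF bounded_pairing_BH] bounded_linear_snd])
  have D: "(L e h has_derivative (\<lambda>(\<delta>, \<beta>). pairing_ED e \<delta> + pairing_BH \<beta> h)) (at z)" for z
    using bounded_linear_imp_has_derivative[OF bl] by (simp add: L_def case_prod_beta')
  show "tdelta_d (L e h) z = e" "tdelta_b (L e h) z = h"
    by (rule tdelta_of_derivative[OF D])+
  show "regular_functional (L e h)"
    unfolding regular_functional_def using tdelta_of_derivative(1,2)[OF D] D differentiable_def by blast
qed

text \<open>Testing the evolution with the linear functionals \<open>\<langle>e, d\<rangle> + \<langle>b, h\<rangle>\<close> gives the weak form of
  Maxwell's equations.\<close>

lemma weak_maxwell:
  assumes H: "(Hbar has_derivative (\<lambda>(\<delta>, \<beta>). (pairing_ED e \<delta> + pairing_BH \<beta> h) / (4 * pi))) (at (dt t, bt t))"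
    and dt: "dt differentiable (at t)" "bt differentiable (at t)"
    and ev: "\<And>F. regular_functional F \<Longrightarrow>
      ((\<lambda>s. F (dt s, bt s)) has_real_derivative bracket c F Hbar (dt t, bt t)) (at t)"
  shows "pairing_ED e' (vector_derivative dt (at t)) + pairing_BH (vector_derivative bt (at t)) h' =
    c * (poincare_pairing A g 1 (E1 e') (ext_d A 1 (H1 h)) - poincare_pairing A g 1 (E1 e) (ext_d A 1 (H1 h')))"
proof -
  let ?L = "\<lambda>z. pairing_ED e' (fst z) + pairing_BH (snd z) h'"
  let ?z' = "(vector_derivative dt (at t), vector_derivative bt (at t))"
  have "((\<lambda>s. (dt s, bt s)) has_vector_derivative ?z') (at t)"
    using dt by (intro has_vector_derivative_Pair) (simp_all add: vector_derivative_works[symmetric])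
  then have "((\<lambda>s. ?L (dt s, bt s)) has_vector_derivative ?L ?z') (at t)"
    by (rule bounded_linear.has_vector_derivative[OF linear_functional(4)])
  then have "((\<lambda>s. ?L (dt s, bt s)) has_real_derivative ?L ?z') (at t)"
    by (simp only: has_real_derivative_iff_has_vector_derivative)
  from DERIV_unique[OF this ev[OF linear_functional(1)]]
  show ?thesis
    unfolding bracket_Hbar[OF H] linear_functional by simp
qed

text \<open>The test pair (e', 0) isolates the equation for d. The pair (0, h') isolates the one for
  b, where integration by parts moves the exterior derivative from h' to e.\<close>

lemma maxwell:
  assumes "(Hbar has_derivative (\<lambda>(\<delta>, \<beta>). (pairing_ED e \<delta> + pairing_BH \<beta> h) / (4 * pi))) (at (dt t, bt t))"
    and "dt differentiable (at t)" "bt differentiable (at t)"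
    and "\<And>F. regular_functional F \<Longrightarrow>
      ((\<lambda>s. F (dt s, bt s)) has_real_derivative bracket c F Hbar (dt t, bt t)) (at t)"
  shows "D2 (vector_derivative dt (at t)) = c *\<^sub>R ext_d A 1 (H1 h)"
    "B2 (vector_derivative bt (at t)) = - (c *\<^sub>R ext_d A 1 (E1 e))"
proof -
  note weak = weak_maxwell[OF assms]
  note dH = ext_d_1_smooth_form[OF H1_smooth] and dE = ext_d_1_smooth_form[OF E1_smooth]
  show "D2 (vector_derivative dt (at t)) = c *\<^sub>R ext_d A 1 (H1 h)"
  proof (rule two_form_eq_by_E[OF D2_smooth smooth_form_scaleR[OF dH]])
    show "poincare_pairing A g 1 (E1 e') (D2 (vector_derivative dt (at t))) =
        poincare_pairing A g 1 (E1 e') (c *\<^sub>R ext_d A 1 (H1 h))" for e'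
      using weak[of e' 0] unfolding pairing_scaleR_right_1[OF dH] pairing_E_dH_zero
        bounded_bilinear.zero_right[OF bounded_pairing_BH] by simp
  qed
  have "B2 (vector_derivative bt (at t)) = (- c) *\<^sub>R ext_d A 1 (E1 e)"
  proof (rule two_form_eq_by_H[OF B2_smooth smooth_form_scaleR[OF dE]])
    show "poincare_pairing A g 2 (B2 (vector_derivative bt (at t))) (H1 h') =
        poincare_pairing A g 2 ((- c) *\<^sub>R ext_d A 1 (E1 e)) (H1 h')" for h'
      using weak[of 0 h'] unfolding pairing_scaleR_left_2[OF dE] pairing_E_dH_zero
        bounded_bilinear.zero_left[OF bounded_pairing_ED]
        integration_by_parts[OF E1_smooth H1_smooth integrable_dEH integrable_EdH boundary_terms_vanish] by simp
  qed
  then show "B2 (vector_derivative bt (at t)) = - (c *\<^sub>R ext_d A 1 (E1 e))"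
    by simp
qed

end

theorem mainTheorem5:
  fixes A :: "'m::{t2_space, second_countable_topology} chart set"
    and g :: "'m metric"
    and E1 :: "'e::real_normed_vector \<Rightarrow> 'm form"
    and B2 :: "'b::real_normed_vector \<Rightarrow> 'm form"
    and D2 :: "'d::real_normed_vector \<Rightarrow> 'm form"
    and H1 :: "'h::real_normed_vector \<Rightarrow> 'm form"
    and c :: real
    and K :: "'e \<times> 'b \<Rightarrow> real"
    and d :: "'e \<times> 'b \<Rightarrow> 'd"
    and h :: "'e \<times> 'b \<Rightarrow> 'h"
    and Hbar :: "'d \<times> 'b \<Rightarrow> real"
  assumes spaces: "em_field_spaces A g E1 B2 D2 H1"
    and c_pos: "0 < c"
    and K: "em_field_spaces.regular_K A g E1 B2 D2 H1 K"
    and d: "\<And>e b. D2 (d (e, b)) =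
        hodge_star A g 1 (E1 e) - (4 * pi) *\<^sub>R D2 (em_field_spaces.tdelta_e A g E1 D2 K (e, b))"
    and h: "\<And>e b. H1 (h (e, b)) =
        hodge_star A g 2 (B2 b) + (4 * pi) *\<^sub>R H1 (em_field_spaces.tdelta_b A g B2 H1 K (e, b))"
    and diffeo: "diffeomorphism (\<lambda>(e, b). (d (e, b), b))"
    and Hbar: "\<And>e b. Hbar (d (e, b), b) =
        K (e, b) - l2_inner A g 1 (E1 e) (E1 (em_field_spaces.delta_e A g E1 K (e, b)))
        + 1 / (8 * pi) * (l2_inner A g 1 (E1 e) (E1 e) + l2_inner A g 2 (B2 b) (B2 b))"
  shows
    "(\<forall>F. em_field_spaces.regular_functional A g E1 B2 D2 H1 F \<longrightarrow>
        (\<forall>e b. em_field_spaces.bracket A g E1 B2 D2 H1 c F Hbar (d (e, b), b) =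
           c * (poincare_pairing A g 1
                  (E1 (em_field_spaces.tdelta_d A g E1 D2 F (d (e, b), b)))
                  (ext_d A 1 (H1 (h (e, b))))
                - poincare_pairing A g 1 (E1 e)
                    (ext_d A 1 (H1 (em_field_spaces.tdelta_b A g B2 H1 F (d (e, b), b)))))))
     \<and>
     (\<forall>(T::real set) et bt dt.
        open T \<longrightarrow>
        (\<forall>t\<in>T. dt t = d (et t, bt t)) \<longrightarrow>
        (\<forall>t\<in>T. dt differentiable (at t) \<and> bt differentiable (at t)) \<longrightarrow>
        (\<forall>F. em_field_spaces.regular_functional A g E1 B2 D2 H1 F \<longrightarrow>
           (\<forall>t\<in>T. ((\<lambda>s. F (dt s, bt s)) has_real_derivative
              em_field_spaces.bracket A g E1 B2 D2 H1 c F Hbar (dt t, bt t)) (at t))) \<longrightarrow>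
        (\<forall>t\<in>T.
           D2 (vector_derivative dt (at t)) = c *\<^sub>R ext_d A 1 (H1 (h (et t, bt t))) \<and>
           B2 (vector_derivative bt (at t)) = - (c *\<^sub>R ext_d A 1 (E1 (et t)))))"
proof -
  interpret em_field_spaces A g E1 B2 D2 H1 by (rule spaces)
  note H = Hbar_has_derivative[OF K d h diffeo Hbar]
  show ?thesis
  proof (intro conjI allI impI ballI)
    fix F e b
    show "bracket c F Hbar (d (e, b), b) =
      c * (poincare_pairing A g 1 (E1 (tdelta_d F (d (e, b), b))) (ext_d A 1 (H1 (h (e, b))))
        - poincare_pairing A g 1 (E1 e) (ext_d A 1 (H1 (tdelta_b F (d (e, b), b)))))"
      by (rule bracket_Hbar[OF H])
  next
    fix T :: "real set" and et bt dt t
    assume dt: "\<forall>t\<in>T. dt t = d (et t, bt t)"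
      and diff: "\<forall>t\<in>T. dt differentiable (at t) \<and> bt differentiable (at t)"
      and ev: "\<forall>F. regular_functional F \<longrightarrow> (\<forall>t\<in>T. ((\<lambda>s. F (dt s, bt s)) has_real_derivative
        bracket c F Hbar (dt t, bt t)) (at t))"
      and t: "t \<in> T"
    \<comment> \<open>The derivative of \<open>Hbar\<close> is known at points
      \<open>(d (e, b), b)\<close>; the constitutive relation places the trajectory at such
      points.\<close>
    have "(Hbar has_derivative (\<lambda>(\<delta>, \<beta>). (pairing_ED (et t) \<delta> + pairing_BH \<beta> (h (et t, bt t))) / (4 * pi))) (at (dt t, bt t))"
      using H[of "et t" "bt t"] dt t by simp
    from maxwell[where dt = dt and bt = bt and t = t, OF this]
    show "D2 (vector_derivative dt (at t)) = c *\<^sub>R ext_d A 1 (H1 (h (et t, bt t)))"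
      "B2 (vector_derivative bt (at t)) = - (c *\<^sub>R ext_d A 1 (E1 (et t)))"
      using diff ev t by blast+
  qed
qed

end
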